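(* Let $m\ge10^3$ be an integer and $\alpha\in(0,\pi/6]$. Then for any axially symmetric function $v_\theta\in H^1(D_m)$ such that $$\int_{D_m}\rho\sin\phi\,v_\theta\,dx=0,$$ we have $$\int_{D_m}\frac{f^2}{\rho^2}\,dx\le\frac{8}{\sqrt3}\int_{D_m}|\partial_\rho f|^2\,dx+\frac{1}{5\sqrt3}\int_{D_m}\frac1{\rho^2}|\partial_\phi f|^2\,dx$$ both for $f=v_\theta$ and for $f=\frac{v_\theta}{\rho}$.
   Context: Spherical coordinates $(\rho,\phi,\theta)$ on $\mathbb{R}^3$: $\rho=|x|$, $\phi$ the angle from the positive $x_3$-axis, $\theta$ the azimuthal angle. $D_m=\{\frac1m<\rho<1,\ \frac\pi2-\alpha<\phi<\frac\pi2+\alpha,\ \theta\in[0,2\pi)\}$. Axially symmetric means independent of $\theta$. Here $v_\theta$ is a scalar function. *)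

theory Defs
  imports "HOL-Analysis.Analysis"
begin

section \<open>Square integrability, weak gradients and the space H1\<close>

definition L2 :: "'a::euclidean_space set \<Rightarrow> ('a \<Rightarrow> real) \<Rightarrow> bool" where
  "L2 \<Omega> f \<longleftrightarrow> f \<in> borel_measurable (lebesgue_on \<Omega>) \<and>
     integrable (lebesgue_on \<Omega>) (\<lambda>x. (f x)\<^sup>2)"

definition locally_integrable_on ::
    "'a::euclidean_space set \<Rightarrow> ('a \<Rightarrow> 'b::euclidean_space) \<Rightarrow> bool" where
  "locally_integrable_on \<Omega> f \<longleftrightarrow>
     (\<forall>K. compact K \<longrightarrow> K \<subseteq> \<Omega> \<longrightarrow> f absolutely_integrable_on K)"

text \<open>The class of k times continuously differentiable functions on the whole space.\<close>
primrec Ck :: "nat \<Rightarrow> ('a::euclidean_space \<Rightarrow> real) \<Rightarrow> bool" where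
  "Ck 0 f \<longleftrightarrow> continuous_on UNIV f"
| "Ck (Suc k) f \<longleftrightarrow> (\<forall>x. f differentiable (at x)) \<and>
     (\<forall>b\<in>Basis. Ck k (\<lambda>x. frechet_derivative f (at x) b))"

definition test_function :: "'a::euclidean_space set \<Rightarrow> ('a \<Rightarrow> real) \<Rightarrow> bool" where
  "test_function \<Omega> \<psi> \<longleftrightarrow> (\<forall>k. Ck k \<psi>) \<and>
     compact (closure {x. \<psi> x \<noteq> 0}) \<and> closure {x. \<psi> x \<noteq> 0} \<subseteq> \<Omega>"

text \<open>The following notions are meant for open \<Omega>.\<close>

definition has_weak_gradient ::
    "'a::euclidean_space set \<Rightarrow> ('a \<Rightarrow> real) \<Rightarrow> ('a \<Rightarrow> 'a) \<Rightarrow> bool" where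
  "has_weak_gradient \<Omega> f g \<longleftrightarrow> locally_integrable_on \<Omega> f \<and> locally_integrable_on \<Omega> g \<and>
     (\<forall>\<psi>. test_function \<Omega> \<psi> \<longrightarrow> (\<forall>b\<in>Basis.
        (LINT x|lebesgue_on \<Omega>. f x * frechet_derivative \<psi> (at x) b) =
        - (LINT x|lebesgue_on \<Omega>. (g x \<bullet> b) * \<psi> x)))"

text \<open>Weak gradients are unique only up to null sets; \<open>weak_gradient\<close> selects a representative
  whenever one exists, and is unspecified otherwise.\<close>
definition weak_gradient :: "'a::euclidean_space set \<Rightarrow> ('a \<Rightarrow> real) \<Rightarrow> 'a \<Rightarrow> 'a" where
  "weak_gradient \<Omega> f = (SOME g. has_weak_gradient \<Omega> f g)"

definition H1 :: "'a::euclidean_space set \<Rightarrow> ('a \<Rightarrow> real) \<Rightarrow> bool" where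
  "H1 \<Omega> f \<longleftrightarrow> L2 \<Omega> f \<and>
     (\<exists>g. has_weak_gradient \<Omega> f g \<and> (\<forall>b\<in>Basis. L2 \<Omega> (\<lambda>x. g x \<bullet> b)))"

section \<open>Spherical coordinates\<close>

definition spherical :: "real \<Rightarrow> real \<Rightarrow> real \<Rightarrow> real^3" where
  "spherical r p t = vector [r * sin p * cos t, r * sin p * sin t, r * cos p]"

definition rho :: "real^3 \<Rightarrow> real" where
  "rho x = norm x"

definition phi :: "real^3 \<Rightarrow> real" where
  "phi x = arccos (x $ 3 / norm x)"

definition theta :: "real^3 \<Rightarrow> real" where
  "theta x = Arg2pi (Complex (x $ 1) (x $ 2))"

text \<open>The coordinate vector fields of \<open>\<rho>\<close> and \<open>\<phi>\<close>, that is, the derivatives of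
  \<open>spherical\<close> with respect to its first and second argument. The second one is not normalised;
  its length is \<open>\<rho>\<close>.\<close>

definition coord_rho :: "real^3 \<Rightarrow> real^3" where
  "coord_rho x = vector [sin (phi x) * cos (theta x), sin (phi x) * sin (theta x), cos (phi x)]"

definition coord_phi :: "real^3 \<Rightarrow> real^3" where
  "coord_phi x = vector [rho x * cos (phi x) * cos (theta x),
     rho x * cos (phi x) * sin (theta x), - (rho x * sin (phi x))]"

lemma spherical_coordinates:
  assumes "x \<noteq> 0"
  shows "spherical (rho x) (phi x) (theta x) = x"
proof -
  have n: "norm x > 0" using assms by simp
  have nx: "(norm x)\<^sup>2 = (x$1)\<^sup>2 + (x$2)\<^sup>2 + (x$3)\<^sup>2"
    by (simp add: norm_eq_sqrt_inner inner_vec_def sum_3 power2_eq_square)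
  have le: "\<bar>x$3 / norm x\<bar> \<le> 1"
    using component_le_norm_cart[of x 3] n by (simp add: abs_divide)
  have c: "cos (phi x) = x$3 / norm x"
    unfolding phi_def using le by (intro cos_arccos) linarith+
  have "sin (phi x) = sqrt (1 - (x$3 / norm x)\<^sup>2)"
    unfolding phi_def using le by (intro sin_arccos_abs)
  also have "1 - (x$3 / norm x)\<^sup>2 = ((x$1)\<^sup>2 + (x$2)\<^sup>2) / (norm x)\<^sup>2"
  proof -
    have "(x$1)\<^sup>2 + (x$2)\<^sup>2 = (norm x)\<^sup>2 - (x$3)\<^sup>2" using nx by simp
    then show ?thesis using n by (simp add: power_divide diff_divide_distrib)
  qed
  finally have s: "norm x * sin (phi x) = cmod (Complex (x$1) (x$2))"
    using n by (simp add: real_sqrt_divide cmod_def)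
  show ?thesis
    using s c n cos_Arg2pi[of "Complex (x$1) (x$2)"] sin_Arg2pi[of "Complex (x$1) (x$2)"]
    by (simp add: spherical_def rho_def theta_def vec_eq_iff forall_3)
qed

lemma coord_rho_is_derivative:
  "((\<lambda>r. spherical r (phi x) (theta x)) has_vector_derivative coord_rho x) (at (rho x))"
proof (rule has_vector_derivative_transform)
  show "((\<lambda>r. r *\<^sub>R coord_rho x) has_vector_derivative coord_rho x) (at (rho x))"
    by (auto intro!: derivative_eq_intros)
qed (auto simp: spherical_def coord_rho_def vec_eq_iff forall_3)

lemma coord_phi_is_derivative:
  "((\<lambda>p. spherical (rho x) p (theta x)) has_vector_derivative coord_phi x) (at (phi x))"
proof -
  define u v :: "real^3"
    where "u = vector [rho x * cos (theta x), rho x * sin (theta x), 0]"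
      and "v = vector [0, 0, rho x]"
  have "((\<lambda>p. sin p *\<^sub>R u + cos p *\<^sub>R v) has_vector_derivative
      (cos (phi x) *\<^sub>R u - sin (phi x) *\<^sub>R v)) (at (phi x))"
    by (auto intro!: derivative_eq_intros)
  moreover have "(\<lambda>p. sin p *\<^sub>R u + cos p *\<^sub>R v) = (\<lambda>p. spherical (rho x) p (theta x))"
    by (auto simp: fun_eq_iff spherical_def u_def v_def vec_eq_iff forall_3)
  moreover have "cos (phi x) *\<^sub>R u - sin (phi x) *\<^sub>R v = coord_phi x"
    by (auto simp: coord_phi_def u_def v_def vec_eq_iff forall_3)
  ultimately show ?thesis by simp
qed

text \<open>The weak partial derivatives with respect to \<open>\<rho>\<close> and \<open>\<phi>\<close>, by the chain rule.\<close>

definition d_rho :: "(real^3) set \<Rightarrow> (real^3 \<Rightarrow> real) \<Rightarrow> real^3 \<Rightarrow> real" where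
  "d_rho \<Omega> f x = weak_gradient \<Omega> f x \<bullet> coord_rho x"

definition d_phi :: "(real^3) set \<Rightarrow> (real^3 \<Rightarrow> real) \<Rightarrow> real^3 \<Rightarrow> real" where
  "d_phi \<Omega> f x = weak_gradient \<Omega> f x \<bullet> coord_phi x"

text \<open>Elements of H1 are determined only almost everywhere, so independence of \<open>\<theta>\<close> is
  required only almost everywhere.\<close>
definition axisymmetric_on :: "(real^3) set \<Rightarrow> (real^3 \<Rightarrow> real) \<Rightarrow> bool" where
  "axisymmetric_on \<Omega> f \<longleftrightarrow> (\<exists>h. AE x in lebesgue_on \<Omega>. f x = h (rho x) (phi x))"

text \<open>No condition on \<open>\<theta>\<close> is needed: \<open>theta\<close> always takes values in \<open>[0, 2\<pi>)\<close>.\<close>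
definition D :: "nat \<Rightarrow> real \<Rightarrow> (real^3) set" where
  "D m \<alpha> = {x. 1 / real m < rho x \<and> rho x < 1 \<and>
     pi / 2 - \<alpha> < phi x \<and> phi x < pi / 2 + \<alpha>}"

end

theory Submission
  imports Defs
begin

text \<open>
  In spherical coordinates the claim concerns \<open>f(r, p)\<close> on a rectangle, with weight \<open>sin p\<close>. As
  \<open>sin p \<ge> sqrt 3 / 2\<close>, we have \<open>sin\<^sup>2 p \<le> sin p \<le> (2 / sqrt 3) sin\<^sup>2 p\<close>, so at the cost of the factor \<open>2 / sqrt 3\<close>
  the weight may be replaced by \<open>sin\<^sup>2 p\<close>, which is the weight in the integral condition. The splitting of
  \<open>f\<close> into its \<open>sin\<^sup>2\<close>-weighted mean over \<open>p\<close> and the remainder is orthogonal. The remainder satisfies a Poincare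
  inequality with constant 1/10 on every interval of length at most \<open>pi / 3\<close>. The mean \<open>h(r)\<close> satisfies
  \<open>\<integral> r ^ n h = 0\<close> with \<open>n = 3\<close> or \<open>n = 4\<close>, and this makes Hardy's inequality with constant 4 hold in spite of
  the boundary terms.

  To pass to weak derivatives, \<open>f\<close> is mollified with a radial kernel, which preserves axial symmetry exactly,
  on slightly smaller domains of the same shape; subtracting a constant, which tends to 0 as the
  subdomains exhaust the domain, restores the integral condition there.
\<close>

section \<open>Hardy and Poincare inequalities\<close>

text \<open>Hardy's inequality with constant 4 fails for nonzero constants, and instead of boundary
  values only one integral condition is given. That condition must also survive the reduction to
  functions of the radius. The integrand \<open>rho * sin p\<close> and the volume element
  \<open>rho\<^sup>2 * sin p\<close> multiply to \<open>rho ^ 3 * (sin p)\<^sup>2\<close>, so a mean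
  over \<open>p\<close> taken with the weight \<open>(sin p)\<^sup>2\<close> inherits the condition
  exactly, with \<open>n = 3\<close> for \<open>v\<close> and \<open>n = 4\<close> for
  \<open>v / rho\<close>. The constants of the theorem are then
  \<open>8 / sqrt 3 = 4 * (2 / sqrt 3)\<close> and
  \<open>1 / (5 * sqrt 3) = 1 / 10 * (2 / sqrt 3)\<close>. Mollified gradients are under control
  only at a positive distance from the boundary, hence the subdomains. Their half-opening is
  strictly below \<open>pi / 6\<close>, which keeps \<open>tan (3 * x)\<close> bounded in the
  Poincare inequality. Exact symmetry of the mollified function matters because its pointwise
  derivatives on all meridians are identified with those on a single one.\<close>

lemma hardy_mean_zero:
  fixes f f' :: "real \<Rightarrow> real"
  assumes a: "0 < a" "2 * a \<le> b" and n: "n \<ge> 1"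
    and der: "\<And>x. x \<in> {a..b} \<Longrightarrow> (f has_vector_derivative f' x) (at x within {a..b})"
    and cont: "continuous_on {a..b} f'"
    and zero: "integral {a..b} (\<lambda>x. x ^ n * f x) = 0"
  shows "integral {a..b} (\<lambda>x. (f x)\<^sup>2) \<le> 4 * integral {a..b} (\<lambda>x. x\<^sup>2 * (f' x)\<^sup>2)"
proof -
  have ab: "a \<le> b" using a by simp
  have cf [continuous_intros]: "continuous_on {a..b} f"
    using der by (meson continuous_on_vector_derivative)
  note [continuous_intros] = cont
  have der': "(f has_real_derivative f' x) (at x within {a..b})" if "x \<in> {a..b}" for x
    using der[OF that] by (simp add: has_real_derivative_iff_has_vector_derivative)
  \<comment> \<open>\<open>e\<close> vanishes exactly for the multiples of
    \<open>x powr (- 1 / 2)\<close>, for which Hardy's inequality with constant 4 is critical.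
    Completing the square with \<open>e\<close> in \<open>2\<close> leaves only the boundary terms
    of \<open>x * (f x)\<^sup>2 / 2\<close>.\<close>
  define e where "e x = x * f' x + f x / 2" for x
  have ce [continuous_intros]: "continuous_on {a..b} e"
    unfolding e_def by (auto intro!: continuous_intros)
  have I: "(\<lambda>x. g x) integrable_on {a..b}" if "continuous_on {a..b} g" for g :: "real \<Rightarrow> real"
    using integrable_continuous_real[OF that] .
  \<comment> \<open>Expanding \<open>\<integral> (e - s * x ^ n)\<^sup>2 \<ge> 0\<close> bounds the bad boundary term \<open>b * (f b)\<^sup>2\<close> by \<open>\<integral> e\<^sup>2\<close>, because
    \<open>\<integral> x ^ n * e\<close> is a pure boundary term when \<open>\<integral> x ^ n * f = 0\<close>.\<close>
  define s where "s = f b / b ^ n"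
  have b: "b > 0" using a by linarith
  have "((\<lambda>x. x * (f x)\<^sup>2 / 2) has_vector_derivative (f x * x * f' x + (f x)\<^sup>2 / 2)) (at x within {a..b})"
    if "x \<in> {a..b}" for x
    unfolding has_real_derivative_iff_has_vector_derivative[symmetric]
    using that by (auto intro!: derivative_eq_intros der' simp: power2_eq_square field_simps)
  from fundamental_theorem_of_calculus[OF ab this]
  have 1: "integral {a..b} (\<lambda>x. f x * x * f' x + (f x)\<^sup>2 / 2) = b * (f b)\<^sup>2 / 2 - a * (f a)\<^sup>2 / 2"
    by (rule integral_unique)
  have 2: "integral {a..b} (\<lambda>x. x\<^sup>2 * (f' x)\<^sup>2) - integral {a..b} (\<lambda>x. (e x)\<^sup>2)
     + (b * (f b)\<^sup>2 / 2 - a * (f a)\<^sup>2 / 2) = integral {a..b} (\<lambda>x. (f x)\<^sup>2) / 4"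
  proof -
    have "((\<lambda>x. x\<^sup>2 * (f' x)\<^sup>2 - (e x)\<^sup>2 + (f x * x * f' x + (f x)\<^sup>2 / 2)) has_integral
      (integral {a..b} (\<lambda>x. x\<^sup>2 * (f' x)\<^sup>2) - integral {a..b} (\<lambda>x. (e x)\<^sup>2)
     + integral {a..b} (\<lambda>x. f x * x * f' x + (f x)\<^sup>2 / 2))) {a..b}"
      by (intro has_integral_add has_integral_diff integrable_integral I continuous_intros) auto
    moreover have "x\<^sup>2 * (f' x)\<^sup>2 - (e x)\<^sup>2 + (f x * x * f' x + (f x)\<^sup>2 / 2) = (f x)\<^sup>2 / 4" for x
      by (simp add: e_def power2_eq_square algebra_simps)
    ultimately have "((\<lambda>x. (f x)\<^sup>2 / 4) has_integral
      (integral {a..b} (\<lambda>x. x\<^sup>2 * (f' x)\<^sup>2) - integral {a..b} (\<lambda>x. (e x)\<^sup>2)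
     + integral {a..b} (\<lambda>x. f x * x * f' x + (f x)\<^sup>2 / 2))) {a..b}" by simp
    from integral_unique[OF this] show ?thesis unfolding 1 by simp
  qed
  have "((\<lambda>x. x ^ Suc n * f x) has_vector_derivative (x ^ n * e x + (n + 1/2) * (x ^ n * f x))) (at x within {a..b})"
    if "x \<in> {a..b}" for x
    unfolding has_real_derivative_iff_has_vector_derivative[symmetric]
    by (rule DERIV_cong[OF DERIV_mult[OF DERIV_pow[of "Suc n"] der'[OF that]]])
      (simp add: e_def algebra_simps add_divide_distrib)
  from fundamental_theorem_of_calculus[OF ab this]
  have "integral {a..b} (\<lambda>x. x ^ n * e x + (n + 1/2) * (x ^ n * f x)) = b ^ Suc n * f b - a ^ Suc n * f a"
    by (rule integral_unique)
  also have "integral {a..b} (\<lambda>x. x ^ n * e x + (n + 1/2) * (x ^ n * f x)) = integral {a..b} (\<lambda>x. x ^ n * e x)"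
    by (subst integral_add) (auto intro!: I continuous_intros simp: zero)
  finally have 3: "integral {a..b} (\<lambda>x. x ^ n * e x) = b ^ Suc n * f b - a ^ Suc n * f a" .
  have "((\<lambda>x. x ^ (2*n+1) / (2*n+1)) has_vector_derivative (x ^ n)\<^sup>2) (at x within {a..b})"
    if "x \<in> {a..b}" for x
    unfolding has_real_derivative_iff_has_vector_derivative[symmetric]
    by (rule derivative_eq_intros refl | simp)+ (simp add: field_simps power_mult[symmetric] power_add[symmetric] mult_2)
  from fundamental_theorem_of_calculus[OF ab this]
  have "integral {a..b} (\<lambda>x. (x ^ n)\<^sup>2) = b ^ (2*n+1) / (2*n+1) - a ^ (2*n+1) / (2*n+1)"
    by (rule integral_unique)
  also have "\<dots> \<le> b ^ (2*n+1) / 3"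
  proof -
    have "b ^ (2*n+1) / (2*n+1) \<le> b ^ (2*n+1) / 3"
      using n b by (intro divide_left_mono) auto
    moreover have "0 \<le> a ^ (2*n+1) / (2*n+1)" using a by simp
    ultimately show ?thesis by linarith
  qed
  finally have 4: "integral {a..b} (\<lambda>x. (x ^ n)\<^sup>2) \<le> b ^ (2*n+1) / 3" .
  have "0 \<le> integral {a..b} (\<lambda>x. (e x - s * x ^ n)\<^sup>2)"
    by (intro integral_nonneg I continuous_intros) auto
  also have "\<dots> = integral {a..b} (\<lambda>x. (e x)\<^sup>2) - 2 * s * integral {a..b} (\<lambda>x. x ^ n * e x)
     + s\<^sup>2 * integral {a..b} (\<lambda>x. (x ^ n)\<^sup>2)"
  proof (rule integral_unique)
    have "((\<lambda>x. (e x)\<^sup>2 - 2 * s * (x ^ n * e x) + s\<^sup>2 * (x ^ n)\<^sup>2) has_integral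
      (integral {a..b} (\<lambda>x. (e x)\<^sup>2) - 2 * s * integral {a..b} (\<lambda>x. x ^ n * e x)
     + s\<^sup>2 * integral {a..b} (\<lambda>x. (x ^ n)\<^sup>2))) {a..b}"
      by (intro has_integral_add has_integral_diff has_integral_mult_right integrable_integral I continuous_intros)
    moreover have "(e x)\<^sup>2 - 2 * s * (x ^ n * e x) + s\<^sup>2 * (x ^ n)\<^sup>2 = (e x - s * x ^ n)\<^sup>2" for x
      by (simp add: power2_eq_square algebra_simps)
    ultimately show "((\<lambda>x. (e x - s * x ^ n)\<^sup>2) has_integral
      (integral {a..b} (\<lambda>x. (e x)\<^sup>2) - 2 * s * integral {a..b} (\<lambda>x. x ^ n * e x)
     + s\<^sup>2 * integral {a..b} (\<lambda>x. (x ^ n)\<^sup>2))) {a..b}" by simp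
  qed
  finally have 5: "integral {a..b} (\<lambda>x. (e x)\<^sup>2) \<ge> 2 * s * (b ^ Suc n * f b - a ^ Suc n * f a)
     - s\<^sup>2 * integral {a..b} (\<lambda>x. (x ^ n)\<^sup>2)"
    unfolding 3 by linarith
  have 6: "s\<^sup>2 * integral {a..b} (\<lambda>x. (x ^ n)\<^sup>2) \<le> s\<^sup>2 * (b ^ (2*n+1) / 3)"
    using 4 by (intro mult_left_mono) auto
  have 7: "s\<^sup>2 * (b ^ (2*n+1) / 3) = b * (f b)\<^sup>2 / 3"
    using b by (simp add: s_def power_divide power_add power_mult power2_eq_square field_simps)
  have 8: "s * (b ^ Suc n * f b) = b * (f b)\<^sup>2"
    using b by (simp add: s_def power2_eq_square)
  \<comment> \<open>The ratio of the radii enters here: \<open>2 * a \<le> b\<close> and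
    \<open>n \<ge> 1\<close> give \<open>(a / b) ^ n \<le> 1 / 2\<close>, which makes the mixed
    boundary term small enough to be absorbed through \<open>10\<close> and
    \<open>11\<close>.\<close>
  have 9: "s * (a ^ Suc n * f a) \<le> a * \<bar>f a\<bar> * \<bar>f b\<bar> / 2"
  proof -
    have "(a / b) ^ n \<le> (1/2) ^ n" using a b by (intro power_mono) (auto simp: field_simps)
    also have "\<dots> \<le> (1/2) ^ 1" using n by (intro power_decreasing) auto
    finally have q: "(a / b) ^ n \<le> 1/2" by simp
    have "s * (a ^ Suc n * f a) = (a / b) ^ n * (a * f a * f b)"
      by (simp add: s_def power_divide)
    also have "\<dots> \<le> (a / b) ^ n * (a * \<bar>f a\<bar> * \<bar>f b\<bar>)"
      using a b by (intro mult_left_mono) (auto simp: abs_mult[symmetric] mult.assoc)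
    also have "\<dots> \<le> 1/2 * (a * \<bar>f a\<bar> * \<bar>f b\<bar>)"
      using q a by (intro mult_right_mono) auto
    finally show ?thesis by simp
  qed
  have 10: "a * \<bar>f a\<bar> * \<bar>f b\<bar> \<le> a * (f a)\<^sup>2 / 2 + a * (f b)\<^sup>2 / 2"
  proof -
    have "0 \<le> a * (\<bar>f a\<bar> - \<bar>f b\<bar>)\<^sup>2" using a by simp
    then show ?thesis by (simp add: power2_diff algebra_simps)
  qed
  have 11: "a * (f b)\<^sup>2 \<le> b * (f b)\<^sup>2 / 2"
    using mult_right_mono[OF a(2), of "(f b)\<^sup>2"] by simp
  \<comment> \<open>With \<open>X = a * (f a)\<^sup>2\<close> and
    \<open>Y = b * (f b)\<^sup>2\<close>, the bounds give
    \<open>\<integral> e\<^sup>2 \<ge> 2 * Y - Y / 3 - X / 2 - Y / 4\<close>, which is at least the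
    boundary term \<open>Y / 2 - X / 2\<close> in \<open>2\<close>.\<close>
  have "b * (f b)\<^sup>2 \<ge> 0" "a * (f a)\<^sup>2 \<ge> 0" using a b by auto
  moreover have "2 * s * (b ^ Suc n * f b - a ^ Suc n * f a) = 2 * (s * (b ^ Suc n * f b)) - 2 * (s * (a ^ Suc n * f a))"
    by (simp add: algebra_simps)
  ultimately show ?thesis using 2 5 6 7 8 9 10 11 by linarith
qed

text \<open>The primitive \<open>P\<close> of \<open>f * cos\<^sup>2\<close> vanishes at both ends,
  so the condition on the mean becomes a Dirichlet condition. An inequality for \<open>P\<close>
  with weight \<open>1 / cos\<^sup>2\<close> and constant 10 then dualises to the claim. The 10 is
  \<open>3\<^sup>2 + 1\<^sup>2\<close>, from the factors \<open>cos (3 * x)\<close> and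
  \<open>cos x\<close> of the comparison function, and \<open>B < pi / 6\<close> keeps the first of
  them positive.\<close>

lemma poincare_cos_squared:
  fixes f f' :: "real \<Rightarrow> real"
  assumes B: "0 < B" "B < pi / 6"
    and der: "\<And>x. x \<in> {-B..B} \<Longrightarrow> (f has_vector_derivative f' x) (at x within {-B..B})"
    and cont: "continuous_on {-B..B} f'"
    and zero: "integral {-B..B} (\<lambda>x. f x * (cos x)\<^sup>2) = 0"
  shows "10 * integral {-B..B} (\<lambda>x. (f x)\<^sup>2 * (cos x)\<^sup>2) \<le> integral {-B..B} (\<lambda>x. (f' x)\<^sup>2 * (cos x)\<^sup>2)"
proof -
  have cf [continuous_intros]: "continuous_on {-B..B} f"
    using der by (meson continuous_on_vector_derivative)
  note [continuous_intros] = cont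
  have der': "(f has_real_derivative f' x) (at x within {-B..B})" if "x \<in> {-B..B}" for x
    using der[OF that] by (simp add: has_real_derivative_iff_has_vector_derivative)
  have I: "(\<lambda>x. g x) integrable_on {-B..B}" if "continuous_on {-B..B} g" for g :: "real \<Rightarrow> real"
    using integrable_continuous_real[OF that] .
  have c0: "cos x > 0" and c3: "cos (3 * x) > 0" if "x \<in> {-B..B}" for x
    using that B by (auto intro!: cos_gt_zero_pi)
  define P where "P x = integral {-B..x} (\<lambda>x. f x * (cos x)\<^sup>2)" for x
  have dP: "(P has_real_derivative f x * (cos x)\<^sup>2) (at x within {-B..B})" if "x \<in> {-B..B}" for x
    unfolding has_real_derivative_iff_has_vector_derivative P_def
    using that by (intro integral_has_vector_derivative continuous_intros)
  have cP [continuous_intros]: "continuous_on {-B..B} P"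
    by (rule DERIV_continuous_on[OF dP])
  have P0: "P (-B) = 0" "P B = 0" by (simp_all add: P_def zero)
  have ab: "-B \<le> B" using B by simp
  have "((\<lambda>x. f x * P x) has_vector_derivative (f' x * P x + (f x)\<^sup>2 * (cos x)\<^sup>2)) (at x within {-B..B})"
    if "x \<in> {-B..B}" for x
    unfolding has_real_derivative_iff_has_vector_derivative[symmetric]
    using that by (auto intro!: derivative_eq_intros der' dP simp: power2_eq_square)
  from fundamental_theorem_of_calculus[OF ab this]
  have 1: "integral {-B..B} (\<lambda>x. f' x * P x + (f x)\<^sup>2 * (cos x)\<^sup>2) = 0"
    by (simp add: integral_unique P0)
  \<comment> \<open>\<open>S\<close> is minus the logarithmic derivative of \<open>cos x * cos (3 * x)\<close>. That function vanishes at \<open>pi / 6\<close>,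
    is positive on the interval, and is a supersolution of \<open>(P' / cos\<^sup>2)' + 10 * P / cos\<^sup>2 = 0\<close>.\<close>
  define S :: "real \<Rightarrow> real" where "S x = 3 * tan (3 * x) + tan x" for x
  \<comment> \<open>\<open>P\<^sup>2 * S / cos\<^sup>2\<close> vanishes at both ends, so its
    derivative has integral 0 and may be added in \<open>3\<close> in order to complete a
    square.\<close>
  have "((\<lambda>x. (P x)\<^sup>2 * (3 * sin (3 * x) / cos (3 * x) + sin x / cos x) / (cos x)\<^sup>2) has_vector_derivative
      (2 * S x * P x * f x + (P x)\<^sup>2 * (9 / (cos (3 * x))\<^sup>2 + 1 / (cos x)\<^sup>2 + 2 * S x * tan x) / (cos x)\<^sup>2)) (at x within {-B..B})"
    if "x \<in> {-B..B}" for x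
  proof -
    have *: "9 * (cos (3*x) * cos (3*x)) + 9 * (sin (3*x) * sin (3*x)) = 9" "cos x * cos x + sin x * sin x = 1"
      by (simp_all only: distrib_left[symmetric] sin_cos_squared_add3 mult_1_right)
    have "cos x \<noteq> 0" "cos (3*x) \<noteq> 0" using c0 c3 that by force+
    note nz = this
    have t3: "((\<lambda>x. 3 * sin (3 * x) / cos (3 * x)) has_real_derivative 9 / (cos (3*x))\<^sup>2) (at x within {-B..B})"
      using nz *(1) by (auto intro!: derivative_eq_intros simp: power2_eq_square algebra_simps)
    have t1: "((\<lambda>x. sin x / cos x) has_real_derivative 1 / (cos x)\<^sup>2) (at x within {-B..B})"
      using nz *(2) by (auto intro!: derivative_eq_intros simp: power2_eq_square algebra_simps)
    have t0: "((\<lambda>x. (P x)\<^sup>2 / (cos x)\<^sup>2) has_real_derivative 2 * P x * f x + 2 * (P x)\<^sup>2 * tan x / (cos x)\<^sup>2) (at x within {-B..B})"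
      using nz that by (auto intro!: derivative_eq_intros dP simp: power2_eq_square tan_def field_simps)
    have "((\<lambda>x. ((P x)\<^sup>2 / (cos x)\<^sup>2) * (3 * sin (3 * x) / cos (3 * x) + sin x / cos x)) has_real_derivative
      (2 * S x * P x * f x + (P x)\<^sup>2 * (9 / (cos (3 * x))\<^sup>2 + 1 / (cos x)\<^sup>2 + 2 * S x * tan x) / (cos x)\<^sup>2)) (at x within {-B..B})"
      apply (rule DERIV_cong[OF DERIV_mult[OF t0 DERIV_add[OF t3 t1]]])
      using nz by (simp add: S_def tan_def field_simps)
    then show ?thesis
      unfolding has_real_derivative_iff_has_vector_derivative[symmetric] by (simp add: mult.commute)
  qed
  from fundamental_theorem_of_calculus[OF ab this]
  have 2: "integral {-B..B} (\<lambda>x. 2 * S x * P x * f x + (P x)\<^sup>2 * (9 / (cos (3 * x))\<^sup>2 + 1 / (cos x)\<^sup>2 + 2 * S x * tan x) / (cos x)\<^sup>2) = 0"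
    by (simp add: integral_unique P0)
  have cS [continuous_intros]: "continuous_on {-B..B} S" "continuous_on {-B..B} tan"
    unfolding S_def using c0 c3 by (force intro!: continuous_intros)+
  have nz: "cos x \<noteq> 0" "cos (3*x) \<noteq> 0" if "x \<in> {-B..B}" for x using c0[OF that] c3[OF that] by auto
  have 3: "10 * integral {-B..B} (\<lambda>x. (P x)\<^sup>2 / (cos x)\<^sup>2) \<le> integral {-B..B} (\<lambda>x. (f x)\<^sup>2 * (cos x)\<^sup>2)"
  proof -
    have "10 * integral {-B..B} (\<lambda>x. (P x)\<^sup>2 / (cos x)\<^sup>2) = integral {-B..B} (\<lambda>x. 10 * ((P x)\<^sup>2 / (cos x)\<^sup>2))"
      by (rule integral_mult_right[symmetric])
    also have "\<dots> \<le> integral {-B..B} (\<lambda>x. (f x)\<^sup>2 * (cos x)\<^sup>2 + (2 * S x * P x * f x + (P x)\<^sup>2 * (9 / (cos (3 * x))\<^sup>2 + 1 / (cos x)\<^sup>2 + 2 * S x * tan x) / (cos x)\<^sup>2))"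
    proof (rule integral_le)
      fix x assume x: "x \<in> {-B..B}"
      have e3: "1 / (cos (3*x))\<^sup>2 = 1 + (tan (3*x))\<^sup>2" and e1: "1 / (cos x)\<^sup>2 = 1 + (tan x)\<^sup>2"
        using nz[OF x] tan_sec[of "3*x"] tan_sec[of x] by (simp_all add: power_inverse inverse_eq_divide power_divide)
      \<comment> \<open>The squared secants contribute \<open>9 + 1\<close>. Their squared tangents
        and \<open>2 * S x * tan x\<close> combine to
        \<open>(S x)\<^sup>2 + 2 * (tan x)\<^sup>2\<close>, of which the first summand completes the
        square with \<open>f\<close> and the second is dropped.\<close>
      have k: "9 / (cos (3 * x))\<^sup>2 + 1 / (cos x)\<^sup>2 + 2 * S x * tan x = 10 + 2 * (tan x)\<^sup>2 + (S x)\<^sup>2"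
      proof -
        have "9 / (cos (3 * x))\<^sup>2 = 9 * (1 / (cos (3 * x))\<^sup>2)" by simp
        then show ?thesis unfolding e3 e1 S_def by (simp add: power2_eq_square algebra_simps)
      qed
      have "(f x * cos x + S x * (P x / cos x))\<^sup>2 = (f x)\<^sup>2 * (cos x)\<^sup>2 + 2 * S x * P x * f x + (P x)\<^sup>2 * (S x)\<^sup>2 / (cos x)\<^sup>2"
        using nz[OF x] by (simp add: power2_eq_square field_simps)
      moreover have "0 \<le> (f x * cos x + S x * (P x / cos x))\<^sup>2" by simp
      moreover have "0 \<le> (P x)\<^sup>2 * (2 * (tan x)\<^sup>2) / (cos x)\<^sup>2" by simp
      moreover have k2: "(P x)\<^sup>2 * (10 + 2 * (tan x)\<^sup>2 + (S x)\<^sup>2) / (cos x)\<^sup>2 = 10 * ((P x)\<^sup>2 / (cos x)\<^sup>2)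
         + (P x)\<^sup>2 * (2 * (tan x)\<^sup>2) / (cos x)\<^sup>2 + (P x)\<^sup>2 * (S x)\<^sup>2 / (cos x)\<^sup>2"
        by (simp add: distrib_left add_divide_distrib)
      ultimately show "10 * ((P x)\<^sup>2 / (cos x)\<^sup>2) \<le> (f x)\<^sup>2 * (cos x)\<^sup>2 + (2 * S x * P x * f x + (P x)\<^sup>2 * (9 / (cos (3 * x))\<^sup>2 + 1 / (cos x)\<^sup>2 + 2 * S x * tan x) / (cos x)\<^sup>2)"
        unfolding k k2 by linarith
    qed (auto intro!: I continuous_intros simp: nz)
    also have "\<dots> = integral {-B..B} (\<lambda>x. (f x)\<^sup>2 * (cos x)\<^sup>2)"
      by (subst integral_add) (auto intro!: I continuous_intros simp: nz 2)
    finally show ?thesis .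
  qed
  \<comment> \<open>The dual step. Let \<open>X = \<integral> f\<^sup>2 * cos\<^sup>2\<close>. By
    \<open>1\<close>, \<open>\<integral> f' * P = - X\<close>, so the square gives
    \<open>\<integral> f'\<^sup>2 * cos\<^sup>2 \<ge> 20 * X - 100 * \<integral> P\<^sup>2 /
    cos\<^sup>2\<close>, and by \<open>3\<close> the right side is at least
    \<open>20 * X - 10 * X\<close>.\<close>
  have "0 \<le> integral {-B..B} (\<lambda>x. (f' x * cos x + 10 * (P x / cos x))\<^sup>2)"
    by (intro integral_nonneg I continuous_intros) (auto simp: nz)
  also have "\<dots> = integral {-B..B} (\<lambda>x. (f' x)\<^sup>2 * (cos x)\<^sup>2 + 20 * (f' x * P x + (f x)\<^sup>2 * (cos x)\<^sup>2)
       + 100 * ((P x)\<^sup>2 / (cos x)\<^sup>2) - 20 * ((f x)\<^sup>2 * (cos x)\<^sup>2))"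
    by (rule integral_cong) (use nz in \<open>simp add: power2_eq_square field_simps\<close>)
  also have "\<dots> = integral {-B..B} (\<lambda>x. (f' x)\<^sup>2 * (cos x)\<^sup>2) + 20 * integral {-B..B} (\<lambda>x. f' x * P x + (f x)\<^sup>2 * (cos x)\<^sup>2)
     + 100 * integral {-B..B} (\<lambda>x. (P x)\<^sup>2 / (cos x)\<^sup>2) - 20 * integral {-B..B} (\<lambda>x. (f x)\<^sup>2 * (cos x)\<^sup>2)"
    by (intro integral_unique has_integral_add has_integral_diff has_integral_mult_right
      integrable_integral I continuous_intros) (auto simp: nz)
  finally show ?thesis using 1 3 by linarith
qed

text \<open>Here \<open>q\<close> is the angle from the equatorial plane, so \<open>cos q\<close>
  stands for \<open>sin p\<close>. The mean \<open>Fm\<close> satisfies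
  \<open>\<integral> r ^ n * Fm r = 0\<close> and is left to Hardy's inequality, the remainder at
  each radius to the Poincare inequality. The factor \<open>r\<close> beside \<open>Fr\<close> comes
  from the volume element.\<close>

lemma hardy_poincare_rectangle:
  fixes F Fr Fq :: "real \<Rightarrow> real \<Rightarrow> real"
  assumes a: "0 < a" "2 * a \<le> b" and n: "n \<ge> 1" and B: "0 < B" "B < pi / 6"
    and der_r: "\<And>r q. r \<in> {a..b} \<Longrightarrow> q \<in> {-B..B} \<Longrightarrow>
      ((\<lambda>r. F r q) has_vector_derivative Fr r q) (at r within {a..b})"
    and der_q: "\<And>r q. r \<in> {a..b} \<Longrightarrow> q \<in> {-B..B} \<Longrightarrow>
      ((\<lambda>q. F r q) has_vector_derivative Fq r q) (at q within {-B..B})"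
    and cont: "continuous_on ({a..b} \<times> {-B..B}) (\<lambda>z. F (fst z) (snd z))"
    and cont_r: "continuous_on ({a..b} \<times> {-B..B}) (\<lambda>z. Fr (fst z) (snd z))"
    and cont_q: "continuous_on ({a..b} \<times> {-B..B}) (\<lambda>z. Fq (fst z) (snd z))"
    and zero: "integral {a..b} (\<lambda>r. integral {-B..B} (\<lambda>q. r ^ n * F r q * (cos q)\<^sup>2)) = 0"
  shows "integral {a..b} (\<lambda>r. integral {-B..B} (\<lambda>q. (F r q)\<^sup>2 * cos q))
    \<le> 8 / sqrt 3 * integral {a..b} (\<lambda>r. integral {-B..B} (\<lambda>q. (r * Fr r q)\<^sup>2 * cos q))
      + 1 / (5 * sqrt 3) * integral {a..b} (\<lambda>r. integral {-B..B} (\<lambda>q. (Fq r q)\<^sup>2 * cos q))"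
proof -
  let ?I = "{a..b}" and ?J = "{-B..B}"
  note [continuous_intros] = cont cont_r cont_q
  have I: "g integrable_on ?I" if "continuous_on ?I g" for g :: "real \<Rightarrow> real"
    using integrable_continuous_real[OF that] .
  have J: "g integrable_on ?J" if "continuous_on ?J g" for g :: "real \<Rightarrow> real"
    using integrable_continuous_real[OF that] .
  have cI: "continuous_on ?I (\<lambda>r. integral ?J (G r))"
    if "continuous_on (?I \<times> ?J) (\<lambda>z. G (fst z) (snd z))" for G :: "real \<Rightarrow> real \<Rightarrow> real"
    using that integral_continuous_on_param[of ?I "-B" B G] by (auto simp: split_beta)
  have slice: "continuous_on ?J (G r)"
    if "continuous_on (?I \<times> ?J) (\<lambda>z. G (fst z) (snd z))" "r \<in> ?I" for G :: "real \<Rightarrow> real \<Rightarrow> real" and r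
  proof -
    have "continuous_on ?J (\<lambda>q. G (fst (r, q)) (snd (r, q)))"
      by (rule continuous_on_compose2[OF that(1) continuous_on_Pair[OF continuous_on_const continuous_on_id]])
        (use that(2) in auto)
    then show ?thesis by simp
  qed
  define A where "A = integral ?J (\<lambda>q. (cos q)\<^sup>2)"
  have c0: "cos q > 0" if "q \<in> ?J" for q
    using that B by (auto intro!: cos_gt_zero_pi)
  have c1: "cos q \<le> 2 / sqrt 3 * (cos q)\<^sup>2" if "q \<in> ?J" for q
  proof -
    have "cos (pi / 6) \<le> cos \<bar>q\<bar>"
      using that B by (intro cos_monotone_0_pi_le) auto
    then have "sqrt 3 / 2 \<le> cos q" by (simp add: cos_30)
    then have "1 \<le> 2 / sqrt 3 * cos q" by (simp add: field_simps)
    from mult_right_mono[OF this, of "cos q"] c0[OF that] show ?thesis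
      by (simp add: power2_eq_square mult.assoc)
  qed
  have c2: "(cos q)\<^sup>2 \<le> cos q" if "q \<in> ?J" for q
    using c0[OF that] mult_left_mono[of "cos q" 1 "cos q"] by (simp add: power2_eq_square)
  have "A > 0"
  proof -
    have "integral ?J (\<lambda>q. 3/4) \<le> A"
      unfolding A_def
    proof (intro integral_le J continuous_intros)
      fix q assume q: "q \<in> ?J"
      have "cos (pi / 6) \<le> cos \<bar>q\<bar>"
        using q B by (intro cos_monotone_0_pi_le) auto
      then have "sqrt 3 / 2 \<le> cos q" by (simp add: cos_30)
      from power_mono[OF this, of 2] show "3/4 \<le> (cos q)\<^sup>2" by (simp add: power_divide)
    qed
    then show ?thesis using B by simp
  qed
  define Fm where "Fm r = integral ?J (\<lambda>q. F r q * (cos q)\<^sup>2) / A" for r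
  define Gm where "Gm r = integral ?J (\<lambda>q. Fr r q * (cos q)\<^sup>2) / A" for r
  have cGm: "continuous_on ?I Gm" unfolding Gm_def
    using \<open>A > 0\<close> by (intro continuous_intros cI) auto
  have dFm: "(Fm has_vector_derivative Gm r) (at r within ?I)" if r: "r \<in> ?I" for r
  proof -
    have "((\<lambda>r. integral (cbox (-B) B) (\<lambda>q. F r q * (cos q)\<^sup>2)) has_vector_derivative
       integral (cbox (-B) B) (\<lambda>q. Fr r q * (cos q)\<^sup>2)) (at r within ?I)"
    proof (rule leibniz_rule_vector_derivative)
      show "continuous_on ({a..b} \<times> cbox (- B) B) (\<lambda>(x, q). Fr x q * (cos q)\<^sup>2)"
        unfolding split_beta by (auto intro!: continuous_intros)
      show "(\<lambda>q. F r q * (cos q)\<^sup>2) integrable_on cbox (- B) B" if "r \<in> ?I" for r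
        using that by (auto intro!: J continuous_intros slice)
      show "((\<lambda>x. F x q * (cos q)\<^sup>2) has_vector_derivative Fr r q * (cos q)\<^sup>2) (at r within {a..b})"
        if "r \<in> ?I" "q \<in> cbox (-B) B" for r q
        using has_vector_derivative_mult_left[OF der_r[of r q]] that by auto
    qed (use r in auto)
    from has_vector_derivative_mult_left[OF this, of "1/A"] show ?thesis
      by (simp add: Fm_def[abs_def] Gm_def)
  qed
  have cFm: "continuous_on ?I Fm"
    using dFm by (rule continuous_on_vector_derivative)
  \<comment> \<open>Pythagoras: \<open>m\<close> is the orthogonal projection of \<open>G r\<close>
    onto the constants in the space with weight \<open>(cos q)\<^sup>2\<close>. It is used for
    \<open>F\<close> to split off the mean and for \<open>Fr\<close> to bound the derivative of the
    mean.\<close>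
  have var: "integral ?J (\<lambda>q. (G r q)\<^sup>2 * (cos q)\<^sup>2) = A * m\<^sup>2 + integral ?J (\<lambda>q. (G r q - m)\<^sup>2 * (cos q)\<^sup>2)"
    if G: "continuous_on (?I \<times> ?J) (\<lambda>z. G (fst z) (snd z))" and r: "r \<in> ?I" and m: "m = integral ?J (\<lambda>q. G r q * (cos q)\<^sup>2) / A"
    for G :: "real \<Rightarrow> real \<Rightarrow> real" and r m
  proof -
    note [continuous_intros] = slice[OF G r]
    have m': "integral ?J (\<lambda>q. G r q * (cos q)\<^sup>2) = m * A" using m \<open>A > 0\<close> by simp
    have "((\<lambda>q. (G r q)\<^sup>2 * (cos q)\<^sup>2 - 2 * m * (G r q * (cos q)\<^sup>2) + m\<^sup>2 * (cos q)\<^sup>2) has_integral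
      (integral ?J (\<lambda>q. (G r q)\<^sup>2 * (cos q)\<^sup>2) - 2 * m * (m * A) + m\<^sup>2 * A)) ?J"
      unfolding m'[symmetric]
      by (intro has_integral_add has_integral_diff has_integral_mult_right integrable_integral J continuous_intros)
       (auto simp: A_def intro!: integrable_integral J continuous_intros)
    moreover have "(G r q)\<^sup>2 * (cos q)\<^sup>2 - 2 * m * (G r q * (cos q)\<^sup>2) + m\<^sup>2 * (cos q)\<^sup>2 = (G r q - m)\<^sup>2 * (cos q)\<^sup>2" for q
      by (simp add: power2_eq_square algebra_simps)
    ultimately have "integral ?J (\<lambda>q. (G r q - m)\<^sup>2 * (cos q)\<^sup>2) =
      integral ?J (\<lambda>q. (G r q)\<^sup>2 * (cos q)\<^sup>2) - 2 * m * (m * A) + m\<^sup>2 * A"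
      by (simp add: integral_unique)
    then show ?thesis by (simp add: power2_eq_square)
  qed
  have fluct: "10 * integral ?J (\<lambda>q. (F r q - Fm r)\<^sup>2 * (cos q)\<^sup>2) \<le> integral ?J (\<lambda>q. (Fq r q)\<^sup>2 * (cos q)\<^sup>2)"
    if r: "r \<in> ?I" for r
  proof (rule poincare_cos_squared[OF B])
    show "((\<lambda>q. F r q - Fm r) has_vector_derivative Fq r q) (at q within ?J)" if "q \<in> ?J" for q
      using has_vector_derivative_diff[OF der_q[OF r that] has_vector_derivative_const[of "Fm r"]] by simp
    show "continuous_on ?J (Fq r)" using slice[OF cont_q r] .
    have "integral ?J (\<lambda>q. F r q * (cos q)\<^sup>2 - Fm r * (cos q)\<^sup>2) = Fm r * A - Fm r * A"
      using \<open>A > 0\<close> r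
      by (subst integral_diff) (auto intro!: J continuous_intros slice[OF cont] simp: Fm_def A_def[symmetric])
    then show "integral ?J (\<lambda>q. (F r q - Fm r) * (cos q)\<^sup>2) = 0"
      by (simp add: algebra_simps)
  qed
  have mean: "A * (Gm r)\<^sup>2 \<le> integral ?J (\<lambda>q. (Fr r q)\<^sup>2 * (cos q)\<^sup>2)" if r: "r \<in> ?I" for r
  proof -
    have "0 \<le> integral ?J (\<lambda>q. (Fr r q - Gm r)\<^sup>2 * (cos q)\<^sup>2)"
      using r by (intro integral_nonneg J continuous_intros slice) auto
    then show ?thesis using var[OF cont_r r, of "Gm r"] by (simp add: Gm_def)
  qed
  have hardy: "integral ?I (\<lambda>r. (Fm r)\<^sup>2) \<le> 4 * integral ?I (\<lambda>r. r\<^sup>2 * (Gm r)\<^sup>2)"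
  proof (rule hardy_mean_zero[OF a n dFm cGm])
    have "integral ?J (\<lambda>q. r ^ n * F r q * (cos q)\<^sup>2) / A = r ^ n * Fm r" for r
      by (simp add: Fm_def mult.assoc)
    then have "integral ?I (\<lambda>r. r ^ n * Fm r) = integral ?I (\<lambda>r. integral ?J (\<lambda>q. r ^ n * F r q * (cos q)\<^sup>2) / A)"
      by simp
    then show "integral ?I (\<lambda>r. r ^ n * Fm r) = 0"
      using zero by simp
  qed
  have m1: "A * integral ?I (\<lambda>r. r\<^sup>2 * (Gm r)\<^sup>2) \<le> integral ?I (\<lambda>r. integral ?J (\<lambda>q. (r * Fr r q)\<^sup>2 * cos q))"
  proof -
    have "A * integral ?I (\<lambda>r. r\<^sup>2 * (Gm r)\<^sup>2) = integral ?I (\<lambda>r. A * (r\<^sup>2 * (Gm r)\<^sup>2))"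
      by (rule integral_mult_right[symmetric])
    also have "\<dots> \<le> integral ?I (\<lambda>r. integral ?J (\<lambda>q. (r * Fr r q)\<^sup>2 * cos q))"
    proof (rule integral_le)
      fix r assume r: "r \<in> ?I"
      have "A * (r\<^sup>2 * (Gm r)\<^sup>2) = r\<^sup>2 * (A * (Gm r)\<^sup>2)" by simp
      also have "\<dots> \<le> r\<^sup>2 * integral ?J (\<lambda>q. (Fr r q)\<^sup>2 * (cos q)\<^sup>2)"
        by (intro mult_left_mono mean r) auto
      also have "\<dots> = integral ?J (\<lambda>q. r\<^sup>2 * ((Fr r q)\<^sup>2 * (cos q)\<^sup>2))"
        by (rule integral_mult_right[symmetric])
      also have "\<dots> \<le> integral ?J (\<lambda>q. (r * Fr r q)\<^sup>2 * cos q)"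
        using r by (intro integral_le J continuous_intros slice)
         (auto simp: power_mult_distrib mult.assoc intro!: mult_left_mono c2)
      finally show "A * (r\<^sup>2 * (Gm r)\<^sup>2) \<le> integral ?J (\<lambda>q. (r * Fr r q)\<^sup>2 * cos q)" .
    qed (auto intro!: I cI continuous_intros cGm)
    finally show ?thesis .
  qed
  \<comment> \<open>The factor \<open>sqrt 3 / 2\<close>, the lower bound of the cosine, is paid on
    this side alone. On the derivative side the passage from \<open>(cos q)\<^sup>2\<close> to
    \<open>cos q\<close> is free.\<close>
  have m2: "A * integral ?I (\<lambda>r. (Fm r)\<^sup>2) + integral ?I (\<lambda>r. integral ?J (\<lambda>q. (Fq r q)\<^sup>2 * cos q)) / 10
     \<ge> sqrt 3 / 2 * integral ?I (\<lambda>r. integral ?J (\<lambda>q. (F r q)\<^sup>2 * cos q))"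
  proof -
    have "sqrt 3 / 2 * integral ?I (\<lambda>r. integral ?J (\<lambda>q. (F r q)\<^sup>2 * cos q)) =
      integral ?I (\<lambda>r. sqrt 3 / 2 * integral ?J (\<lambda>q. (F r q)\<^sup>2 * cos q))"
      by (rule integral_mult_right[symmetric])
    also have "\<dots> \<le> integral ?I (\<lambda>r. A * (Fm r)\<^sup>2 + integral ?J (\<lambda>q. (Fq r q)\<^sup>2 * cos q) / 10)"
    proof (rule integral_le)
      fix r assume r: "r \<in> ?I"
      have "sqrt 3 / 2 * integral ?J (\<lambda>q. (F r q)\<^sup>2 * cos q) = integral ?J (\<lambda>q. sqrt 3 / 2 * ((F r q)\<^sup>2 * cos q))"
        by (rule integral_mult_right[symmetric])
      also have "\<dots> \<le> integral ?J (\<lambda>q. (F r q)\<^sup>2 * (cos q)\<^sup>2)"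
      proof (intro integral_le J continuous_intros slice[OF cont r])
        fix q assume "q \<in> ?J"
        then have "sqrt 3 / 2 * cos q \<le> (cos q)\<^sup>2" using c1[of q] by (simp add: field_simps)
        from mult_left_mono[OF this, of "(F r q)\<^sup>2"]
        show "sqrt 3 / 2 * ((F r q)\<^sup>2 * cos q) \<le> (F r q)\<^sup>2 * (cos q)\<^sup>2" by (simp add: algebra_simps)
      qed
      also have "\<dots> = A * (Fm r)\<^sup>2 + integral ?J (\<lambda>q. (F r q - Fm r)\<^sup>2 * (cos q)\<^sup>2)"
        by (rule var[OF cont r]) (simp add: Fm_def)
      also have "\<dots> \<le> A * (Fm r)\<^sup>2 + integral ?J (\<lambda>q. (Fq r q)\<^sup>2 * (cos q)\<^sup>2) / 10"
        using fluct[OF r] by simp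
      also have "integral ?J (\<lambda>q. (Fq r q)\<^sup>2 * (cos q)\<^sup>2) \<le> integral ?J (\<lambda>q. (Fq r q)\<^sup>2 * cos q)"
        using r by (intro integral_le J continuous_intros slice) (auto intro!: mult_left_mono c2)
      finally show "sqrt 3 / 2 * integral ?J (\<lambda>q. (F r q)\<^sup>2 * cos q) \<le> A * (Fm r)\<^sup>2 + integral ?J (\<lambda>q. (Fq r q)\<^sup>2 * cos q) / 10"
        by simp
    qed (auto intro!: I cI continuous_intros cFm)
    also have "\<dots> = A * integral ?I (\<lambda>r. (Fm r)\<^sup>2) + integral ?I (\<lambda>r. integral ?J (\<lambda>q. (Fq r q)\<^sup>2 * cos q)) / 10"
      by (subst integral_add) (auto intro!: I cI continuous_intros cFm)
    finally show ?thesis .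
  qed
  define X Y Z where "X = integral ?I (\<lambda>r. integral ?J (\<lambda>q. (F r q)\<^sup>2 * cos q))"
    and "Y = integral ?I (\<lambda>r. integral ?J (\<lambda>q. (r * Fr r q)\<^sup>2 * cos q))"
    and "Z = integral ?I (\<lambda>r. integral ?J (\<lambda>q. (Fq r q)\<^sup>2 * cos q))"
  have "sqrt 3 / 2 * X \<le> 4 * Y + Z / 10"
    using m1 m2 mult_left_mono[OF hardy less_imp_le[OF \<open>A > 0\<close>]]
    unfolding X_def[symmetric] Y_def[symmetric] Z_def[symmetric] mult.left_commute[of A 4]
    by linarith
  then have "X \<le> 8 / sqrt 3 * Y + 1 / (5 * sqrt 3) * Z"
    by (simp add: field_simps)
  then show ?thesis by (simp add: X_def Y_def Z_def)
qed

section \<open>Smooth functions\<close>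

lemma Ck_SucI:
  assumes "\<And>x. (f has_derivative f' x) (at x)" "\<And>b. b \<in> Basis \<Longrightarrow> Ck k (\<lambda>x. f' x b)"
  shows "Ck (Suc k) f"
proof -
  have "frechet_derivative f (at x) = f' x" for x
    using frechet_derivative_at[OF assms(1)] by simp
  then show ?thesis using assms by (auto simp: differentiable_def)
qed

lemma Ck_Suc_has_derivative:
  "Ck (Suc k) f \<Longrightarrow> (f has_derivative frechet_derivative f (at x)) (at x)"
  by (simp add: frechet_derivative_works[symmetric])

lemma Ck_Suc_imp: "Ck (Suc k) f \<Longrightarrow> Ck k f"
proof (induction k arbitrary: f)
  case 0
  then show ?case
    by (auto intro!: differentiable_imp_continuous_on simp: differentiable_on_def
      intro: differentiable_at_withinI)
qed auto

lemma Ck_continuous_on: "Ck k f \<Longrightarrow> continuous_on S f"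
proof (induction k)
  case 0
  then show ?case by (auto intro: continuous_on_subset)
qed (auto dest: Ck_Suc_imp simp del: Ck.simps)

lemma Ck_const: "Ck k (\<lambda>_. c)"
proof (induction k arbitrary: c)
  case (Suc k)
  show ?case by (rule Ck_SucI[where f' = "\<lambda>_ _. 0"]) (auto simp: Suc)
qed auto

lemma Ck_inner_right: "Ck k (\<lambda>x. x \<bullet> c)"
proof (cases k)
  case (Suc j)
  show ?thesis unfolding Suc
    by (rule Ck_SucI[where f' = "\<lambda>_ h. h \<bullet> c"]) (auto simp: Ck_const intro!: derivative_eq_intros)
qed (auto intro!: continuous_intros)

lemma Ck_inner_left: "Ck k (\<lambda>x. c \<bullet> x)"
  using Ck_inner_right[of k c] by (simp add: inner_commute)

lemma Ck_add: "Ck k f \<Longrightarrow> Ck k g \<Longrightarrow> Ck k (\<lambda>x. f x + g x)"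
proof (induction k arbitrary: f g)
  case (Suc k)
  note D = Ck_Suc_has_derivative[OF Suc.prems(1)] Ck_Suc_has_derivative[OF Suc.prems(2)]
  show ?case
    by (rule Ck_SucI, rule has_derivative_add[OF D]) (use Suc in auto)
qed (auto intro!: continuous_intros)

lemma Ck_mult: "Ck k f \<Longrightarrow> Ck k g \<Longrightarrow> Ck k (\<lambda>x. f x * g x)"
proof (induction k arbitrary: f g)
  case (Suc k)
  note D = Ck_Suc_has_derivative[OF Suc.prems(1)] Ck_Suc_has_derivative[OF Suc.prems(2)]
  show ?case
    by (rule Ck_SucI, rule has_derivative_mult[OF D])
      (use Suc.prems Ck_Suc_imp[OF Suc.prems(1)] Ck_Suc_imp[OF Suc.prems(2)] in \<open>auto intro!: Ck_add Suc.IH\<close>)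
qed (auto intro!: continuous_intros)

lemma Ck_cmult: "Ck k f \<Longrightarrow> Ck k (\<lambda>x. c * f x)"
  by (intro Ck_mult Ck_const)

lemma Ck_diff: "Ck k f \<Longrightarrow> Ck k g \<Longrightarrow> Ck k (\<lambda>x. f x - g x)"
  using Ck_add[of k f "\<lambda>x. (-1) * g x"] Ck_cmult[of k g "-1"] by simp

lemma Ck_prod: "(\<And>i. i \<in> A \<Longrightarrow> Ck k (f i)) \<Longrightarrow> Ck k (\<lambda>x. \<Prod>i\<in>A. f i x)"
  by (induction A rule: infinite_finite_induct) (auto intro!: Ck_const Ck_mult simp del: Ck.simps)

lemma Ck_inner_self: "Ck k (\<lambda>x. x \<bullet> x)"
proof (cases k)
  case (Suc j)
  show ?thesis unfolding Suc
    by (rule Ck_SucI[where f' = "\<lambda>x h. 2 * (x \<bullet> h)"])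
      (auto simp: inner_commute intro!: derivative_eq_intros Ck_cmult Ck_inner_left Ck_inner_right simp del: Ck.simps)
qed (auto intro!: continuous_intros)

text \<open>\<open>flat 0\<close> is the classical function \<open>exp (- 1 / t)\<close>, extended
  by 0. With the powers \<open>inverse t ^ j\<close> the derivatives are linear combinations of
  members of the same family, so smoothness of all members follows by one induction.\<close>

definition flat :: "nat \<Rightarrow> real \<Rightarrow> real" where
  "flat j t = (if t \<le> 0 then 0 else inverse t ^ j * exp (- inverse t))"

lemma flat_nonneg: "0 \<le> flat j t"
  by (simp add: flat_def)

lemma flat_eq_0_iff: "flat j t = 0 \<longleftrightarrow> t \<le> 0"
  by (simp add: flat_def)

lemma flat_0_le_1: "flat 0 t \<le> 1"
  by (simp add: flat_def)

lemma tendsto_flat_at_0: "(flat j \<longlongrightarrow> 0) (at 0)"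
proof -
  have "((\<lambda>t. inverse t ^ j / exp (inverse t)) \<longlongrightarrow> 0) (at_right (0::real))"
    using filterlim_compose[OF tendsto_power_div_exp_0 filterlim_inverse_at_top_right] by simp
  then have "(flat j \<longlongrightarrow> 0) (at_right 0)"
    by (rule Lim_transform_eventually)
      (auto simp: flat_def eventually_at_filter exp_minus field_simps)
  moreover have "(flat j \<longlongrightarrow> 0) (at_left 0)"
    by (rule tendsto_eventually) (auto simp: flat_def eventually_at_filter)
  ultimately show ?thesis by (simp add: filterlim_split_at)
qed

lemma DERIV_inverse_power:
  fixes t :: real
  assumes "t \<noteq> 0"
  shows "((\<lambda>t. inverse t ^ j) has_real_derivative - (real j * inverse t ^ (j + 1))) (at t)"
  by (rule DERIV_cong[OF DERIV_power[OF DERIV_inverse[OF assms]]]) (cases j; simp add: algebra_simps)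

lemma DERIV_flat: "(flat j has_real_derivative flat (j + 2) t - j * flat (j + 1) t) (at t)"
proof (cases t "0::real" rule: linorder_cases)
  case less
  have "((\<lambda>_. 0) has_real_derivative 0) (at t)" by simp
  then have "(flat j has_real_derivative 0) (at t)"
    by (rule has_field_derivative_transform_within_open[of _ _ _ "{..<0}"])
      (use less in \<open>auto simp: flat_def\<close>)
  then show ?thesis using less by (simp add: flat_def)
next
  case equal
  \<comment> \<open>For \<open>h \<noteq> 0\<close> the difference quotient of \<open>flat j\<close>
    at 0 is \<open>flat (Suc j) h\<close>, whose limit is already known.\<close>
  have "((\<lambda>h. (flat j (0 + h) - flat j 0) / h) \<longlongrightarrow> 0) (at 0)"
    by (rule Lim_transform_eventually[OF tendsto_flat_at_0[of "Suc j"]])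
      (auto simp: flat_def eventually_at_filter field_simps)
  then show ?thesis using equal by (simp add: DERIV_def flat_def)
next
  case greater
  have "((\<lambda>t. inverse t ^ j * exp (- inverse t)) has_real_derivative flat (j + 2) t - j * flat (j + 1) t) (at t)"
    using greater
    by (auto intro!: derivative_eq_intros DERIV_inverse_power[THEN DERIV_cong] simp: flat_def algebra_simps power2_eq_square)
  then show ?thesis
    by (rule has_field_derivative_transform_within_open[of _ _ _ "{0<..}"])
      (use greater in \<open>auto simp: flat_def\<close>)
qed

lemma Ck_flat_compose: "Ck k q \<Longrightarrow> Ck k (\<lambda>x. flat j (q x))"
proof (induction k arbitrary: j)
  case 0
  have "continuous_on UNIV (flat j)"
    by (rule DERIV_continuous_on[OF DERIV_flat])
  then show ?case using 0 by (auto intro: continuous_on_compose2)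
next
  case (Suc k)
  have "((\<lambda>x. flat j (q x)) has_derivative
    (\<lambda>h. (flat (j + 2) (q x) - j * flat (j + 1) (q x)) * frechet_derivative q (at x) h)) (at x)" for x
    using has_derivative_compose[OF Ck_Suc_has_derivative[OF Suc.prems], of "flat j"] DERIV_flat[of j "q x"]
    by (simp add: has_field_derivative_def)
  then show ?case
    by (rule Ck_SucI)
      (use Suc.prems in \<open>auto intro!: Ck_mult Ck_diff Ck_cmult Suc.IH Ck_const Ck_Suc_imp[OF Suc.prems] simp del: Ck.simps(1)\<close>)
qed

section \<open>Multiplication by inverse powers of the norm\<close>

lemma has_derivative_inverse_norm_power:
  fixes x :: "'a::euclidean_space"
  assumes "x \<noteq> 0"
  shows "((\<lambda>x. inverse (norm x) ^ j) has_derivative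
    (\<lambda>h. - (real j * ((x \<bullet> h) * inverse (norm x) ^ (j + 2))))) (at x)"
proof -
  have "(norm has_derivative (\<lambda>h. x \<bullet> h * inverse (norm x))) (at x)"
    using has_derivative_norm[OF assms] by (simp add: sgn_div_norm inverse_eq_divide inner_commute)
  moreover have "((\<lambda>t. inverse t ^ j) has_derivative (*) (- (real j * inverse (norm x) ^ (j + 1)))) (at (norm x))"
    using DERIV_inverse_power[of "norm x" j] assms by (simp add: has_field_derivative_def)
  ultimately have "((\<lambda>x. inverse (norm x) ^ j) has_derivative
    (\<lambda>h. - (real j * inverse (norm x) ^ (j + 1)) * (x \<bullet> h * inverse (norm x)))) (at x)"
    by (rule has_derivative_compose)
  then show ?thesis
    by (rule has_derivative_eq_rhs) (simp add: fun_eq_iff algebra_simps)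
qed

text \<open>Vanishing of \<open>\<psi>\<close> near the origin removes the singularity of the norm.
  The exponent is arbitrary because a partial derivative consists of two terms of the same form: one
  with the derivative of \<open>\<psi>\<close> and exponent \<open>j\<close>, one with
  \<open>(x \<bullet> b) * \<psi> x\<close> and exponent \<open>j + 2\<close>.\<close>

lemma Ck_mult_inverse_norm:
  fixes \<psi> :: "'a::euclidean_space \<Rightarrow> real"
  assumes "0 < \<delta>" "Ck k \<psi>" "\<And>x. norm x < \<delta> \<Longrightarrow> \<psi> x = 0"
  shows "Ck k (\<lambda>x. \<psi> x * inverse (norm x) ^ j)"
  using assms(2,3)
proof (induction k arbitrary: \<psi> j)
  case 0
  have "isCont (\<lambda>x. \<psi> x * inverse (norm x) ^ j) x" for x
  proof (cases "x = 0")
    case True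
    have "isCont (\<lambda>_. 0 :: real) x" by simp
    moreover have "\<forall>\<^sub>F x in nhds x. (0 :: real) = \<psi> x * inverse (norm x) ^ j"
      unfolding eventually_nhds using 0(2) \<open>0 < \<delta>\<close> True
      by (intro exI[of _ "ball 0 \<delta>"]) auto
    ultimately show ?thesis using isCont_cong by fast
  next
    case False
    moreover have "isCont \<psi> x" using 0(1) by (auto simp: continuous_on_eq_continuous_at)
    ultimately show ?thesis by (auto intro!: continuous_intros)
  qed
  then show ?case by (auto simp: continuous_on_eq_continuous_at)
next
  case (Suc k)
  note D = Ck_Suc_has_derivative[OF Suc.prems(1)]
  have zero: "frechet_derivative \<psi> (at x) h = 0" if "norm x < \<delta>" for x h
  proof -
    have "((\<lambda>_. 0) has_derivative (\<lambda>_. 0)) (at x)" by simp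
    then have "(\<psi> has_derivative (\<lambda>_. 0)) (at x)"
      by (rule has_derivative_transform_within_open[of _ _ _ _ "ball 0 \<delta>"])
        (use that Suc.prems(2) in auto)
    from frechet_derivative_at[OF this] show ?thesis by metis
  qed
  have "((\<lambda>x. \<psi> x * inverse (norm x) ^ j) has_derivative
     (\<lambda>h. frechet_derivative \<psi> (at x) h * inverse (norm x) ^ j
        - real j * ((x \<bullet> h) * \<psi> x * inverse (norm x) ^ (j + 2)))) (at x)" for x
  proof (cases "x = 0")
    case True
    have "((\<lambda>_. 0) has_derivative (\<lambda>_. 0)) (at x)" by simp
    then have "((\<lambda>x. \<psi> x * inverse (norm x) ^ j) has_derivative (\<lambda>_. 0)) (at x)"
      by (rule has_derivative_transform_within_open[of _ _ _ _ "ball 0 \<delta>"])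
        (use True Suc.prems(2) \<open>0 < \<delta>\<close> in auto)
    then show ?thesis using True zero[of 0] \<open>0 < \<delta>\<close> by simp
  next
    case False
    from has_derivative_mult[OF D[of x] has_derivative_inverse_norm_power[OF False]] show ?thesis
      by (simp add: algebra_simps)
  qed
  then show ?case
  proof (rule Ck_SucI)
    fix b :: 'a assume b: "b \<in> Basis"
    have "Ck k (\<lambda>x. frechet_derivative \<psi> (at x) b * inverse (norm x) ^ j)"
      using Suc.prems(1) b zero by (intro Suc.IH) auto
    moreover have "Ck k (\<lambda>x. ((x \<bullet> b) * \<psi> x) * inverse (norm x) ^ (j + 2))"
      using Suc.prems(2) by (intro Suc.IH Ck_mult Ck_inner_right Ck_Suc_imp[OF Suc.prems(1)]) auto
    ultimately show "Ck k (\<lambda>x. frechet_derivative \<psi> (at x) b * inverse (norm x) ^ j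
        - real j * ((x \<bullet> b) * \<psi> x * inverse (norm x) ^ (j + 2)))"
      by (intro Ck_diff Ck_cmult)
  qed
qed

section \<open>Square integrable functions\<close>

lemma integral_Cauchy_Schwarz:
  fixes f g :: "'a \<Rightarrow> real"
  assumes f: "f \<in> borel_measurable M" "integrable M (\<lambda>x. (f x)\<^sup>2)"
    and g: "g \<in> borel_measurable M" "integrable M (\<lambda>x. (g x)\<^sup>2)"
  shows "integrable M (\<lambda>x. f x * g x)" "(LINT x|M. f x * g x)\<^sup>2 \<le> (LINT x|M. (f x)\<^sup>2) * (LINT x|M. (g x)\<^sup>2)"
proof -
  show i: "integrable M (\<lambda>x. f x * g x)"
  proof (rule Bochner_Integration.integrable_bound)
    show "integrable M (\<lambda>x. (f x)\<^sup>2 + (g x)\<^sup>2)" using f g by simp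
    show "AE x in M. norm (f x * g x) \<le> norm ((f x)\<^sup>2 + (g x)\<^sup>2)"
    proof (rule AE_I2)
      fix x
      have "2 * \<bar>f x\<bar> * \<bar>g x\<bar> \<le> (f x)\<^sup>2 + (g x)\<^sup>2"
        using sum_squares_bound[of "\<bar>f x\<bar>" "\<bar>g x\<bar>"] by simp
      moreover have "0 \<le> \<bar>f x\<bar> * \<bar>g x\<bar>" by simp
      ultimately have "\<bar>f x\<bar> * \<bar>g x\<bar> \<le> (f x)\<^sup>2 + (g x)\<^sup>2" by linarith
      then show "norm (f x * g x) \<le> norm ((f x)\<^sup>2 + (g x)\<^sup>2)"
        by (simp only: real_norm_def abs_mult order_trans[OF _ abs_ge_self])
    qed
  qed (use f g in auto)
  define A B C where "A = (LINT x|M. (f x)\<^sup>2)" and "B = (LINT x|M. f x * g x)" and "C = (LINT x|M. (g x)\<^sup>2)"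
  have q: "0 \<le> s\<^sup>2 * A - 2 * s * t * B + t\<^sup>2 * C" for s t
  proof -
    have "0 \<le> (LINT x|M. (s * f x - t * g x)\<^sup>2)" by simp
    also have "\<dots> = (LINT x|M. s\<^sup>2 * (f x)\<^sup>2 - 2 * s * t * (f x * g x) + t\<^sup>2 * (g x)\<^sup>2)"
      by (simp add: power2_diff power_mult_distrib algebra_simps)
    also have "\<dots> = s\<^sup>2 * A - 2 * s * t * B + t\<^sup>2 * C"
      using f g i by (simp add: A_def B_def C_def)
    finally show ?thesis .
  qed
  have A: "0 \<le> A" by (simp add: A_def)
  have "B\<^sup>2 \<le> A * C"
  proof (cases "A = 0")
    case True
    have "B = 0"
    proof (rule ccontr)
      assume "B \<noteq> 0"
      \<comment> \<open>For this choice of \<open>s\<close> and \<open>t\<close> the quadratic form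
        has the value \<open>- 1\<close>.\<close>
      then show False using q[of "(C + 1) / (2 * B)" 1] True by simp
    qed
    then show ?thesis using True by simp
  next
    case False
    have "0 \<le> A * (A * C - B\<^sup>2)"
      using q[of B A] by (simp add: power2_eq_square algebra_simps)
    then show ?thesis using A False by (simp add: zero_le_mult_iff)
  qed
  then show "(LINT x|M. f x * g x)\<^sup>2 \<le> (LINT x|M. (f x)\<^sup>2) * (LINT x|M. (g x)\<^sup>2)"
    by (simp add: A_def B_def C_def)
qed

definition L2_on :: "'a measure \<Rightarrow> ('a \<Rightarrow> real) \<Rightarrow> bool" where
  "L2_on M f \<longleftrightarrow> f \<in> borel_measurable M \<and> integrable M (\<lambda>x. (f x)\<^sup>2)"

text \<open>Membership in \<open>L2_on\<close> is part of the notion because the integral of a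
  non-integrable function is 0 by convention; without it a vanishing limit would carry no
  information.\<close>

definition L2_lim :: "'a measure \<Rightarrow> (nat \<Rightarrow> 'a \<Rightarrow> real) \<Rightarrow> ('a \<Rightarrow> real) \<Rightarrow> bool" where
  "L2_lim M hs h \<longleftrightarrow> (\<forall>n. L2_on M (hs n)) \<and> L2_on M h \<and> (\<lambda>n. LINT x|M. (hs n x - h x)\<^sup>2) \<longlonglongrightarrow> 0"

lemma L2_onD: "L2_on M f \<Longrightarrow> f \<in> borel_measurable M" "L2_on M f \<Longrightarrow> integrable M (\<lambda>x. (f x)\<^sup>2)"
  by (auto simp: L2_on_def)

lemma L2_limD: "L2_lim M hs h \<Longrightarrow> L2_on M (hs n)" "L2_lim M hs h \<Longrightarrow> L2_on M h"
  "L2_lim M hs h \<Longrightarrow> (\<lambda>n. LINT x|M. (hs n x - h x)\<^sup>2) \<longlonglongrightarrow> 0"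
  by (auto simp: L2_lim_def)

lemma L2_on_mult_bounded:
  assumes f: "L2_on M f" and m: "m \<in> borel_measurable M" "\<And>x. x \<in> space M \<Longrightarrow> \<bar>m x\<bar> \<le> C"
  shows "L2_on M (\<lambda>x. m x * f x)" "(LINT x|M. (m x * f x)\<^sup>2) \<le> C\<^sup>2 * (LINT x|M. (f x)\<^sup>2)"
proof -
  have le: "(m x * f x)\<^sup>2 \<le> C\<^sup>2 * (f x)\<^sup>2" if "x \<in> space M" for x
  proof -
    have "\<bar>m x\<bar> \<le> \<bar>C\<bar>" using m(2)[OF that] by linarith
    then show ?thesis by (simp add: abs_le_square_iff power_mult_distrib mult_right_mono)
  qed
  have i: "integrable M (\<lambda>x. (m x * f x)\<^sup>2)"
    by (rule Bochner_Integration.integrable_bound[of _ "\<lambda>x. C\<^sup>2 * (f x)\<^sup>2"])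
      (use f m(1) le in \<open>auto simp: L2_on_def\<close>)
  then show "L2_on M (\<lambda>x. m x * f x)" using f m(1) by (auto simp: L2_on_def)
  have "(LINT x|M. (m x * f x)\<^sup>2) \<le> (LINT x|M. C\<^sup>2 * (f x)\<^sup>2)"
    using i f le by (intro integral_mono) (auto simp: L2_on_def)
  then show "(LINT x|M. (m x * f x)\<^sup>2) \<le> C\<^sup>2 * (LINT x|M. (f x)\<^sup>2)" by simp
qed

lemma L2_on_add:
  assumes "L2_on M f" "L2_on M g"
  shows "L2_on M (\<lambda>x. f x + g x)" "(LINT x|M. (f x + g x)\<^sup>2) \<le> 2 * (LINT x|M. (f x)\<^sup>2) + 2 * (LINT x|M. (g x)\<^sup>2)"
proof -
  have i: "integrable M (\<lambda>x. f x * g x)" "integrable M (\<lambda>x. (f x)\<^sup>2)" "integrable M (\<lambda>x. (g x)\<^sup>2)"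
    using assms integral_Cauchy_Schwarz(1) by (auto simp: L2_on_def)
  have e: "(\<lambda>x. (f x + g x)\<^sup>2) = (\<lambda>x. (f x)\<^sup>2 + (g x)\<^sup>2 + 2 * (f x * g x))"
    by (simp add: power2_sum mult.assoc)
  show "L2_on M (\<lambda>x. f x + g x)" using assms i unfolding L2_on_def e by auto
  have "(LINT x|M. (f x + g x)\<^sup>2) \<le> (LINT x|M. 2 * (f x)\<^sup>2 + 2 * (g x)\<^sup>2)"
  proof (rule integral_mono)
    show "(f x + g x)\<^sup>2 \<le> 2 * (f x)\<^sup>2 + 2 * (g x)\<^sup>2" for x
      using sum_squares_bound[of "f x" "g x"] by (simp add: power2_sum)
  qed (use i in \<open>auto simp: e\<close>)
  then show "(LINT x|M. (f x + g x)\<^sup>2) \<le> 2 * (LINT x|M. (f x)\<^sup>2) + 2 * (LINT x|M. (g x)\<^sup>2)"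
    using i by simp
qed

lemma L2_on_minus: "L2_on M f \<Longrightarrow> L2_on M (\<lambda>x. - f x)"
  by (auto simp: L2_on_def)

lemma L2_on_diff: "L2_on M f \<Longrightarrow> L2_on M g \<Longrightarrow> L2_on M (\<lambda>x. f x - g x)"
  using L2_on_add(1)[of M f "\<lambda>x. - g x"] L2_on_minus[of M g] by simp

lemma L2_lim_add:
  assumes "L2_lim M fs f" "L2_lim M gs g"
  shows "L2_lim M (\<lambda>n x. fs n x + gs n x) (\<lambda>x. f x + g x)"
  unfolding L2_lim_def
proof (intro conjI allI)
  note F = L2_limD[OF assms(1)] and G = L2_limD[OF assms(2)]
  show "L2_on M (\<lambda>x. fs n x + gs n x)" for n by (intro L2_on_add F G)
  show "L2_on M (\<lambda>x. f x + g x)" by (intro L2_on_add F G)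
  have "(\<lambda>n. 2 * (LINT x|M. (fs n x - f x)\<^sup>2) + 2 * (LINT x|M. (gs n x - g x)\<^sup>2)) \<longlonglongrightarrow> 2 * 0 + 2 * 0"
    by (intro tendsto_intros F G)
  then have lim: "(\<lambda>n. 2 * (LINT x|M. (fs n x - f x)\<^sup>2) + 2 * (LINT x|M. (gs n x - g x)\<^sup>2)) \<longlonglongrightarrow> 0" by simp
  show "(\<lambda>n. LINT x|M. (fs n x + gs n x - (f x + g x))\<^sup>2) \<longlonglongrightarrow> 0"
  proof (rule tendsto_sandwich[OF _ _ tendsto_const lim])
    have "(LINT x|M. (fs n x + gs n x - (f x + g x))\<^sup>2) \<le> 2 * (LINT x|M. (fs n x - f x)\<^sup>2) + 2 * (LINT x|M. (gs n x - g x)\<^sup>2)" for n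
      using L2_on_add(2)[OF L2_on_diff[OF F(1,2)] L2_on_diff[OF G(1,2)], of n n] by (simp add: algebra_simps)
    then show "\<forall>\<^sub>F n in sequentially. (LINT x|M. (fs n x + gs n x - (f x + g x))\<^sup>2) \<le> 2 * (LINT x|M. (fs n x - f x)\<^sup>2) + 2 * (LINT x|M. (gs n x - g x)\<^sup>2)"
      by simp
  qed simp
qed

lemma L2_lim_mult_bounded:
  assumes f: "L2_lim M fs f" and m: "m \<in> borel_measurable M" "\<And>x. x \<in> space M \<Longrightarrow> \<bar>m x\<bar> \<le> C"
  shows "L2_lim M (\<lambda>n x. m x * fs n x) (\<lambda>x. m x * f x)"
  unfolding L2_lim_def
proof (intro conjI allI)
  note F = L2_limD[OF f]
  show "L2_on M (\<lambda>x. m x * fs n x)" for n by (rule L2_on_mult_bounded(1)[OF F(1) m])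
  show "L2_on M (\<lambda>x. m x * f x)" by (rule L2_on_mult_bounded(1)[OF F(2) m])
  have "(\<lambda>n. C\<^sup>2 * (LINT x|M. (fs n x - f x)\<^sup>2)) \<longlonglongrightarrow> C\<^sup>2 * 0"
    by (intro tendsto_intros F)
  then have lim: "(\<lambda>n. C\<^sup>2 * (LINT x|M. (fs n x - f x)\<^sup>2)) \<longlonglongrightarrow> 0" by simp
  show "(\<lambda>n. LINT x|M. (m x * fs n x - m x * f x)\<^sup>2) \<longlonglongrightarrow> 0"
  proof (rule tendsto_sandwich[OF _ _ tendsto_const lim])
    show "\<forall>\<^sub>F n in sequentially. (LINT x|M. (m x * fs n x - m x * f x)\<^sup>2) \<le> C\<^sup>2 * (LINT x|M. (fs n x - f x)\<^sup>2)"
      using L2_on_mult_bounded(2)[OF L2_on_diff[OF F(1,2)] m] by (simp add: right_diff_distrib)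
  qed simp
qed

lemma L2_lim_sum:
  assumes "finite A" "\<And>b. b \<in> A \<Longrightarrow> L2_lim M (\<lambda>n x. fs b n x) (f b)"
  shows "L2_lim M (\<lambda>n x. \<Sum>b\<in>A. fs b n x) (\<lambda>x. \<Sum>b\<in>A. f b x)"
  using assms
proof (induction A rule: finite_induct)
  case empty
  then show ?case by (simp add: L2_lim_def L2_on_def)
next
  case (insert b A)
  then show ?case using L2_lim_add[of M "fs b" "f b" "\<lambda>n x. \<Sum>b\<in>A. fs b n x" "\<lambda>x. \<Sum>b\<in>A. f b x"] by simp
qed

text \<open>Cauchy-Schwarz against the fixed function \<open>m\<close>. This makes the weighted
  means of the mollified functions converge.\<close>

lemma L2_lim_inner:
  assumes f: "L2_lim M fs f" and m: "L2_on M m"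
  shows "(\<lambda>n. LINT x|M. m x * fs n x) \<longlonglongrightarrow> (LINT x|M. m x * f x)"
proof -
  note F = L2_limD[OF f]
  have d: "((LINT x|M. m x * fs n x) - (LINT x|M. m x * f x))\<^sup>2 \<le> (LINT x|M. (m x)\<^sup>2) * (LINT x|M. (fs n x - f x)\<^sup>2)" for n
  proof -
    have "(LINT x|M. m x * fs n x) - (LINT x|M. m x * f x) = (LINT x|M. m x * (fs n x - f x))"
      using integral_Cauchy_Schwarz(1)[OF L2_onD[OF m] L2_onD[OF F(1)[of n]]] integral_Cauchy_Schwarz(1)[OF L2_onD[OF m] L2_onD[OF F(2)]]
      by (simp add: right_diff_distrib)
    then show ?thesis
      using integral_Cauchy_Schwarz(2)[OF L2_onD[OF m] L2_onD[OF L2_on_diff[OF F(1)[of n] F(2)]]] by simp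
  qed
  have "(\<lambda>n. (LINT x|M. (m x)\<^sup>2) * (LINT x|M. (fs n x - f x)\<^sup>2)) \<longlonglongrightarrow> (LINT x|M. (m x)\<^sup>2) * 0"
    by (intro tendsto_intros F)
  then have lim: "(\<lambda>n. (LINT x|M. (m x)\<^sup>2) * (LINT x|M. (fs n x - f x)\<^sup>2)) \<longlonglongrightarrow> 0" by simp
  have "(\<lambda>n. ((LINT x|M. m x * fs n x) - (LINT x|M. m x * f x))\<^sup>2) \<longlonglongrightarrow> 0"
    by (rule tendsto_sandwich[OF _ _ tendsto_const lim]) (use d in auto)
  then have "(\<lambda>n. (LINT x|M. m x * fs n x) - (LINT x|M. m x * f x)) \<longlonglongrightarrow> 0"
    using tendsto_real_sqrt by (fastforce intro: tendsto_rabs_zero_cancel)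
  then show ?thesis by (simp add: LIM_zero_iff)
qed

text \<open>The identity \<open>(fs n x)\<^sup>2 = 2 * (f x * fs n x) + (fs n x - f x)\<^sup>2 - (f
  x)\<^sup>2\<close> reduces convergence of the norms to convergence of inner products with
  \<open>f\<close>.\<close>

lemma L2_lim_square:
  assumes f: "L2_lim M fs f"
  shows "(\<lambda>n. LINT x|M. (fs n x)\<^sup>2) \<longlonglongrightarrow> (LINT x|M. (f x)\<^sup>2)"
proof -
  note F = L2_limD[OF f]
  have "(\<lambda>n. 2 * (LINT x|M. f x * fs n x) + (LINT x|M. (fs n x - f x)\<^sup>2) - (LINT x|M. (f x)\<^sup>2))
     \<longlonglongrightarrow> 2 * (LINT x|M. f x * f x) + 0 - (LINT x|M. (f x)\<^sup>2)"
    by (intro tendsto_intros L2_lim_inner f F)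
  moreover have "2 * (LINT x|M. f x * fs n x) + (LINT x|M. (fs n x - f x)\<^sup>2) - (LINT x|M. (f x)\<^sup>2) = (LINT x|M. (fs n x)\<^sup>2)" for n
  proof -
    have "(LINT x|M. (fs n x)\<^sup>2) = (LINT x|M. 2 * (f x * fs n x) + (fs n x - f x)\<^sup>2 - (f x)\<^sup>2)"
      by (simp add: power2_diff algebra_simps)
    then show ?thesis
      using integral_Cauchy_Schwarz(1)[OF L2_onD[OF F(2)] L2_onD[OF F(1)[of n]]] L2_onD(2)[OF F(2)] L2_onD(2)[OF L2_on_diff[OF F(1)[of n] F(2)]]
      by simp
  qed
  ultimately show ?thesis by (simp add: power2_eq_square)
qed

lemma L2_lim_scalar:
  assumes c: "c \<longlonglongrightarrow> (l :: real)" and m: "L2_on M m"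
  shows "L2_lim M (\<lambda>n x. c n * m x) (\<lambda>x. l * m x)"
  unfolding L2_lim_def
proof (intro conjI allI)
  show "L2_on M (\<lambda>x. c n * m x)" "L2_on M (\<lambda>x. l * m x)" for n
    using m by (auto simp: L2_on_def power_mult_distrib)
  have "(\<lambda>n. (c n - l)\<^sup>2 * (LINT x|M. (m x)\<^sup>2)) \<longlonglongrightarrow> (l - l)\<^sup>2 * (LINT x|M. (m x)\<^sup>2)"
    by (intro tendsto_intros c)
  then show "(\<lambda>n. LINT x|M. (c n * m x - l * m x)\<^sup>2) \<longlonglongrightarrow> 0"
    by (simp add: left_diff_distrib[symmetric] power_mult_distrib)
qed

lemma L2_iff_L2_on: "L2 \<Omega> f \<longleftrightarrow> L2_on (lebesgue_on \<Omega>) f"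
  by (simp add: L2_def L2_on_def)

lemma L2_mult_bounded:
  fixes m f :: "'a::euclidean_space \<Rightarrow> real"
  assumes "\<Omega> \<in> sets lebesgue" "L2 \<Omega> f" "m \<in> borel_measurable (lebesgue_on \<Omega>)"
    and "\<And>x. x \<in> \<Omega> \<Longrightarrow> \<bar>m x\<bar> \<le> C"
  shows "L2 \<Omega> (\<lambda>x. m x * f x)"
  using L2_on_mult_bounded(1)[of "lebesgue_on \<Omega>" f m C] assms by (simp add: L2_iff_L2_on)

section \<open>Weak gradients\<close>

lemma integrable_mult_compact_support:
  fixes h \<psi> :: "'a::euclidean_space \<Rightarrow> real"
  assumes \<Omega>: "open \<Omega>" and h: "locally_integrable_on \<Omega> h" and \<psi>: "continuous_on UNIV \<psi>"
    and K: "compact K" "K \<subseteq> \<Omega>" "\<And>x. x \<notin> K \<Longrightarrow> \<psi> x = 0"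
  shows "integrable (lebesgue_on \<Omega>) (\<lambda>x. h x * \<psi> x)"
proof -
  have "h absolutely_integrable_on K" using h K by (auto simp: locally_integrable_on_def)
  moreover have "bounded (\<psi> ` K)"
    using \<psi> K by (intro compact_imp_bounded compact_continuous_image) (auto intro: continuous_on_subset)
  moreover have "\<psi> \<in> borel_measurable (lebesgue_on K)"
    using \<psi> fmeasurableD[OF lmeasurable_compact[OF K(1)]]
    by (intro continuous_imp_measurable_on_sets_lebesgue) (auto intro: continuous_on_subset)
  moreover have "K \<in> sets lebesgue" using fmeasurableD[OF lmeasurable_compact[OF K(1)]] .
  ultimately have "(\<lambda>x. \<psi> x * h x) absolutely_integrable_on K"
    by (intro absolutely_integrable_bounded_measurable_product[where h = "(*)"] bilinear_times)
  then have "integrable lebesgue (\<lambda>x. indicator K x *\<^sub>R (\<psi> x * h x))"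
    by (simp add: set_integrable_def)
  also have "(\<lambda>x. indicator K x *\<^sub>R (\<psi> x * h x)) = (\<lambda>x. indicator \<Omega> x *\<^sub>R (h x * \<psi> x))"
    using K by (auto simp: fun_eq_iff indicator_def)
  finally show ?thesis
    using \<Omega> by (subst integrable_restrict_space) auto
qed

lemma test_function_integrable:
  assumes "open \<Omega>" "locally_integrable_on \<Omega> h" "test_function \<Omega> \<psi>"
  shows "integrable (lebesgue_on \<Omega>) (\<lambda>x. h x * \<psi> x)"
proof (rule integrable_mult_compact_support[OF assms(1,2)])
  show "continuous_on UNIV \<psi>" using assms(3) by (auto simp: test_function_def intro: Ck_continuous_on)
  show "compact (closure {x. \<psi> x \<noteq> 0})" "closure {x. \<psi> x \<noteq> 0} \<subseteq> \<Omega>"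
    using assms(3) by (auto simp: test_function_def)
  show "\<psi> x = 0" if "x \<notin> closure {x. \<psi> x \<noteq> 0}" for x
    using that closure_subset[of "{x. \<psi> x \<noteq> 0}"] by blast
qed

section \<open>Test functions and the fundamental lemma\<close>

lemma test_functionI:
  assumes "\<And>k. Ck k \<psi>" "compact K" "K \<subseteq> \<Omega>" "\<And>x. x \<notin> K \<Longrightarrow> \<psi> x = 0"
  shows "test_function \<Omega> \<psi>"
proof -
  have "closure {x. \<psi> x \<noteq> 0} \<subseteq> K"
    using assms by (intro closure_minimal compact_imp_closed) auto
  then show ?thesis
    using assms compact_Int_closed[OF \<open>compact K\<close> closed_closure[of "{x. \<psi> x \<noteq> 0}"]]
    by (auto simp: test_function_def Int_absorb1)
qed

text \<open>As \<open>s\<close> grows, \<open>flat 0 (s * t)\<close> tends to 1 for positive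
  \<open>t\<close> and stays 0 otherwise, so these products tend to the indicator of the open box.
  Boxes are the target because they are an intersection-stable generator of the Borel sets.\<close>

definition box_bump :: "'a::euclidean_space \<Rightarrow> 'a \<Rightarrow> real \<Rightarrow> 'a \<Rightarrow> real" where
  "box_bump c d s x = (\<Prod>b\<in>Basis. flat 0 (s * ((x - c) \<bullet> b)) * flat 0 (s * ((d - x) \<bullet> b)))"

lemma Ck_box_bump: "Ck k (box_bump c d s)"
  unfolding box_bump_def inner_diff_left
  by (intro Ck_prod Ck_mult Ck_flat_compose Ck_diff Ck_inner_right Ck_const)

lemma box_bump_eq_0: "0 < s \<Longrightarrow> x \<notin> box c d \<Longrightarrow> box_bump c d s x = 0"
  unfolding box_bump_def
  by (rule prod_zero) (force simp: mem_box flat_eq_0_iff inner_diff_left zero_less_mult_iff not_less[symmetric])+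

lemma box_bump_bounds: "0 \<le> box_bump c d s x" "box_bump c d s x \<le> 1"
  unfolding box_bump_def
  by (auto intro!: prod_nonneg prod_le_1 mult_nonneg_nonneg flat_nonneg mult_le_one flat_0_le_1)

lemma test_function_box_bump:
  assumes "cbox c d \<subseteq> \<Omega>" "0 < s" shows "test_function \<Omega> (box_bump c d s)"
proof (rule test_functionI[of _ "cbox c d"])
  show "box_bump c d s x = 0" if "x \<notin> cbox c d" for x
    using box_subset_cbox[of c d] that by (intro box_bump_eq_0 \<open>0 < s\<close>) blast
qed (use assms(1) in \<open>auto intro: Ck_box_bump simp del: Ck.simps\<close>)

lemma box_bump_tendsto: "(\<lambda>n. box_bump c d (real (Suc n)) x) \<longlonglongrightarrow> indicator (box c d) x"
proof (cases "x \<in> box c d")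
  case True
  have "(\<lambda>n. flat 0 (real (Suc n) * t)) \<longlonglongrightarrow> 1" if "0 < t" for t
  proof -
    have "(\<lambda>n. exp (- (inverse (real (Suc n)) * inverse t))) \<longlonglongrightarrow> exp (- (0 * inverse t))"
      by (intro tendsto_intros LIMSEQ_inverse_real_of_nat)
    moreover have "flat 0 (real (Suc n) * t) = exp (- (inverse (real (Suc n)) * inverse t))" for n
      using that by (simp add: flat_def mult_le_0_iff del: of_nat_Suc)
    ultimately show ?thesis by simp
  qed
  then have "(\<lambda>n. box_bump c d (real (Suc n)) x) \<longlonglongrightarrow> (\<Prod>b\<in>(Basis::'a set). 1 * 1)"
    unfolding box_bump_def
    using True by (intro tendsto_prod tendsto_mult) (auto simp: mem_box inner_diff_left)
  then show ?thesis using True by simp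
qed (simp add: box_bump_eq_0)

text \<open>Dominated convergence along the box bumps. Local integrability makes \<open>g\<close>
  integrable on the closed box, so \<open>\<bar>G x\<bar>\<close> dominates.\<close>

lemma integral_box_eq_0:
  fixes g :: "'a::euclidean_space \<Rightarrow> real"
  assumes \<Omega>: "open \<Omega>" and g: "locally_integrable_on \<Omega> g"
    and zero: "\<And>\<psi>. test_function \<Omega> \<psi> \<Longrightarrow> (LINT x|lebesgue_on \<Omega>. g x * \<psi> x) = 0"
    and cd: "cbox c d \<subseteq> \<Omega>"
  shows "(LINT x|lebesgue. indicator (box c d) x * g x) = 0"
proof -
  define G where "G x = indicator (cbox c d) x * g x" for x
  have G: "integrable lebesgue G"
    using g cd by (simp add: locally_integrable_on_def set_integrable_def G_def[abs_def])
  note [measurable] = borel_measurable_integrable[OF G]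
  have [measurable]: "box_bump c d s \<in> borel_measurable lebesgue" for s
    using Ck_continuous_on[OF Ck_box_bump, of UNIV c d s] continuous_imp_measurable_on_sets_lebesgue[of UNIV]
    by (auto simp: lebesgue_on_UNIV_eq)
  have "(\<lambda>n. LINT x|lebesgue. G x * box_bump c d (real (Suc n)) x) \<longlonglongrightarrow> (LINT x|lebesgue. G x * indicator (box c d) x)"
  proof (rule integral_dominated_convergence[where w = "\<lambda>x. \<bar>G x\<bar>"])
    show "AE x in lebesgue. (\<lambda>n. G x * box_bump c d (real (Suc n)) x) \<longlonglongrightarrow> G x * indicator (box c d) x"
      by (intro AE_I2 tendsto_mult tendsto_const box_bump_tendsto)
    show "AE x in lebesgue. norm (G x * box_bump c d (real (Suc n)) x) \<le> \<bar>G x\<bar>" for n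
      using box_bump_bounds[of c d "real (Suc n)"] by (intro AE_I2) (auto simp: abs_mult intro!: mult_left_le)
    show "(\<lambda>x. G x * indicator (box c d) x) \<in> borel_measurable lebesgue"
      by (intro borel_measurable_times borel_measurable_integrable[OF G]
        borel_measurable_indicator fmeasurableD[OF lmeasurable_box])
    show "(\<lambda>x. G x * box_bump c d (real (Suc n)) x) \<in> borel_measurable lebesgue" for n
      by (intro borel_measurable_times borel_measurable_integrable[OF G]) auto
  qed (use G in auto)
  moreover have "(LINT x|lebesgue. G x * box_bump c d (real (Suc n)) x) = 0" for n
  proof -
    have "(LINT x|lebesgue_on \<Omega>. g x * box_bump c d (real (Suc n)) x) = 0"
      by (intro zero test_function_box_bump cd) auto
    then have "(LINT x|lebesgue. indicator \<Omega> x *\<^sub>R (g x * box_bump c d (real (Suc n)) x)) = 0"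
      using \<Omega> by (subst (asm) integral_restrict_space) auto
    also have "(\<lambda>x. indicator \<Omega> x *\<^sub>R (g x * box_bump c d (real (Suc n)) x)) = (\<lambda>x. G x * box_bump c d (real (Suc n)) x)"
    proof
      fix x show "indicator \<Omega> x *\<^sub>R (g x * box_bump c d (real (Suc n)) x) = G x * box_bump c d (real (Suc n)) x"
      proof (cases "x \<in> box c d")
        case True
        then have "x \<in> cbox c d" "x \<in> \<Omega>" using cd box_subset_cbox[of c d] by blast+
        then show ?thesis by (simp add: G_def)
      qed (simp add: box_bump_eq_0 del: of_nat_Suc)
    qed
    finally show ?thesis .
  qed
  ultimately have "(\<lambda>_. 0) \<longlonglongrightarrow> (LINT x|lebesgue. G x * indicator (box c d) x)"
    by (simp only:)
  then have "(LINT x|lebesgue. G x * indicator (box c d) x) = 0"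
    by (simp only: LIMSEQ_const_iff)
  moreover have "G x * indicator (box c d) x = indicator (box c d) x * g x" for x
    using box_subset_cbox[of c d] by (auto simp: G_def indicator_def)
  ultimately show ?thesis by simp
qed

text \<open>The positive and the negative part of \<open>h\<close> are densities of two measures
  that agree on boxes, hence on all Borel sets, and densities are unique almost everywhere.\<close>

lemma AE_eq_0_if_box_integrals_0:
  fixes h :: "'a::euclidean_space \<Rightarrow> real"
  assumes h: "integrable lborel h" and zero: "\<And>u v. (LINT x|lborel. indicator (box u v) x * h x) = 0"
  shows "AE x in lborel. h x = 0"
proof -
  note [measurable] = borel_measurable_integrable[OF h]
  \<comment> \<open>\<open>ennreal\<close> sends negative numbers to 0, so these densities are the
    positive and the negative part of \<open>h\<close>.\<close>
  let ?M = "density lborel (\<lambda>x. ennreal (h x))" and ?N = "density lborel (\<lambda>x. ennreal (- h x))"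
  have fin: "(\<integral>\<^sup>+x. ennreal (h x) \<partial>lborel) < \<infinity>" "(\<integral>\<^sup>+x. ennreal (- h x) \<partial>lborel) < \<infinity>"
    using h by (auto simp: real_integrable_def less_top)
  have le: "(\<integral>\<^sup>+x. ennreal (h x) * indicator A x \<partial>lborel) < \<infinity>" "(\<integral>\<^sup>+x. ennreal (- h x) * indicator A x \<partial>lborel) < \<infinity>" for A
    by (rule le_less_trans[OF nn_integral_mono fin(1)] le_less_trans[OF nn_integral_mono fin(2)];
      simp split: split_indicator)+
  have "?M = ?N"
  proof (rule measure_eqI_generator_eq)
    let ?E = "range (\<lambda>(a, b). box a b::'a set)"
    show "Int_stable ?E"
      by (auto simp: Int_stable_def box_Int_box)
    show "?E \<subseteq> Pow UNIV" "sets ?M = sigma_sets UNIV ?E" "sets ?N = sigma_sets UNIV ?E"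
      by (simp_all add: borel_eq_box)
    let ?A = "\<lambda>n::nat. box (- (real n *\<^sub>R One)) (real n *\<^sub>R One) :: 'a set"
    show "range ?A \<subseteq> ?E" "(\<Union>i. ?A i) = UNIV"
      unfolding UN_box_eq_UNIV by auto
    show "emeasure ?M (?A i) \<noteq> \<infinity>" for i
      using le(1)[of "?A i"] by (simp add: emeasure_density)
    show "emeasure ?M X = emeasure ?N X" if "X \<in> ?E" for X
    proof -
      from that obtain p where "X = (\<lambda>(a, b). box a b) p" by (rule imageE)
      then obtain u v where X: "X = box u v" by (cases p) simp
      have i: "integrable lborel (\<lambda>x. indicator X x * h x)"
        using integrable_mult_indicator[OF _ h, of X] by (simp add: X)
      have e: "ennreal (indicator X x * h x) = ennreal (h x) * indicator X x"
        "ennreal (- (indicator X x * h x)) = ennreal (- h x) * indicator X x" for x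
        by (auto simp: indicator_def)
      have "enn2real (\<integral>\<^sup>+x. ennreal (h x) * indicator X x \<partial>lborel) = enn2real (\<integral>\<^sup>+x. ennreal (- h x) * indicator X x \<partial>lborel)"
        using real_lebesgue_integral_def[OF i] zero[of u v] by (simp add: X[symmetric] e)
      then have "(\<integral>\<^sup>+x. ennreal (h x) * indicator X x \<partial>lborel) = (\<integral>\<^sup>+x. ennreal (- h x) * indicator X x \<partial>lborel)"
        using le[of X] by (metis ennreal_enn2real infinity_ennreal_def)
      then show ?thesis by (simp add: emeasure_density X)
    qed
  qed
  then have "AE x in lborel. ennreal (h x) = ennreal (- h x)"
    by (intro sigma_finite_measure.density_unique[OF lborel.sigma_finite_measure_axioms]) auto
  then show ?thesis
  proof eventually_elim
    case (elim x)
    then show ?case by (cases "h x" "0 :: real" rule: linorder_cases) (auto simp: ennreal_neg)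
  qed
qed

text \<open>Cut off to a cell inside \<open>\<Omega>\<close>, the function is integrable, and its
  integral over any box vanishes because two boxes meet in a box. Countably many cells cover
  \<open>\<Omega>\<close>, so the exceptional sets still form a null set.\<close>

lemma fundamental_lemma_calculus_of_variations:
  fixes g :: "'a::euclidean_space \<Rightarrow> real"
  assumes \<Omega>: "open \<Omega>" and g: "locally_integrable_on \<Omega> g"
    and zero: "\<And>\<psi>. test_function \<Omega> \<psi> \<Longrightarrow> (LINT x|lebesgue_on \<Omega>. g x * \<psi> x) = 0"
  shows "AE x in lebesgue_on \<Omega>. g x = 0"
proof -
  have cell: "AE x in lebesgue. x \<in> cbox c d \<longrightarrow> g x = 0" if cd: "cbox c d \<subseteq> \<Omega>" for c d
  proof -
    define G where "G x = indicator (box c d) x * g x" for x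
    have "indicator (box c d) x *\<^sub>R (indicator (cbox c d) x *\<^sub>R g x) = G x" for x
      using box_subset_cbox[of c d] by (cases "x \<in> box c d") (auto simp: G_def)
    moreover have "integrable lebesgue (\<lambda>x. indicator (cbox c d) x *\<^sub>R g x)"
      using g cd by (simp add: locally_integrable_on_def set_integrable_def)
    ultimately have G: "integrable lebesgue G"
      using integrable_mult_indicator[OF fmeasurableD[OF lmeasurable_box, of c d], where f = "\<lambda>x. indicator (cbox c d) x *\<^sub>R g x"]
      by (simp cong: Bochner_Integration.integrable_cong)
    \<comment> \<open>A Borel representative, because agreement on boxes determines measures on the
      Borel sets.\<close>
    obtain h where h [measurable]: "h \<in> borel_measurable lborel" and Gh: "AE x in lborel. G x = h x"
      using completion_ex_borel_measurable_real[OF borel_measurable_integrable[OF G]] by auto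
    have Gh': "AE x in lebesgue. G x = h x" using AE_completion[OF Gh] .
    have h': "h \<in> borel_measurable lebesgue" using h by (rule measurable_completion)
    have "integrable lebesgue h"
      using G h' Gh' integrable_cong_AE[of G lebesgue h] by (simp add: borel_measurable_integrable)
    then have hi: "integrable lborel h" using h by (simp add: integrable_completion)
    have "(LINT x|lborel. indicator (box u v) x * h x) = 0" for u v
    proof -
      obtain l r where lr: "box u v \<inter> box c d = box l r" by (rule that, rule box_Int_box)
      have "(LINT x|lborel. indicator (box u v) x * h x) = (LINT x|lebesgue. indicator (box u v) x * h x)"
        by (rule integral_completion[symmetric]) measurable
      also have "\<dots> = (LINT x|lebesgue. indicator (box u v) x * G x)"
      proof (rule integral_cong_AE)
        show "(\<lambda>x. indicator (box u v) x * h x) \<in> borel_measurable lebesgue"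
          by (intro borel_measurable_times h' borel_measurable_indicator fmeasurableD[OF lmeasurable_box])
        show "(\<lambda>x. indicator (box u v) x * G x) \<in> borel_measurable lebesgue"
          by (intro borel_measurable_times borel_measurable_integrable[OF G]
            borel_measurable_indicator fmeasurableD[OF lmeasurable_box])
        show "AE x in lebesgue. indicator (box u v) x * h x = indicator (box u v) x * G x"
          using Gh' by eventually_elim simp
      qed
      also have "(\<lambda>x. indicator (box u v) x * G x) = (\<lambda>x. indicator (box l r) x * g x)"
        by (simp add: G_def lr[symmetric] indicator_inter_arith mult.assoc)
      also have "(LINT x|lebesgue. indicator (box l r) x * g x) = 0"
      proof (cases "box l r = {}")
        case False
        have "box l r \<subseteq> box c d" using lr by auto
        then have "cbox l r \<subseteq> cbox c d"
          using False closure_mono[of "box l r" "cbox c d"] box_subset_cbox[of c d] by (simp add: closure_box)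
        then show ?thesis using cd by (intro integral_box_eq_0[OF \<Omega> g zero]) auto
      qed simp
      finally show ?thesis .
    qed
    from AE_completion[OF AE_eq_0_if_box_integrals_0[OF hi this]]
    have "AE x in lebesgue. G x = 0" using Gh' by eventually_elim simp
    \<comment> \<open>\<open>G\<close> lives on the open cell, whereas the cover of
      \<open>\<Omega>\<close> uses closed ones; the difference is a null set.\<close>
    moreover have "AE x in lebesgue. x \<notin> cbox c d - box c d"
      using negligible_frontier_interval[of c d] by (intro AE_not_in) (simp add: negligible_iff_null_sets)
    ultimately show ?thesis by eventually_elim (auto simp: G_def indicator_def split: if_splits)
  qed
  obtain \<D> where \<D>: "countable \<D>" "\<D> \<subseteq> Pow \<Omega>" "\<And>X. X \<in> \<D> \<Longrightarrow> \<exists>a b. X = cbox a b" "\<Union>\<D> = \<Omega>"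
    using open_countable_Union_open_cbox[OF \<Omega>] by metis
  have "AE x in lebesgue. x \<in> X \<longrightarrow> g x = 0" if "X \<in> \<D>" for X
    using \<D>(2,3) that cell by blast
  then have "AE x in lebesgue. \<forall>X\<in>\<D>. x \<in> X \<longrightarrow> g x = 0"
    by (intro AE_ball_countable[THEN iffD2] \<D>) auto
  then have "AE x in lebesgue. x \<in> \<Omega> \<longrightarrow> g x = 0"
    by eventually_elim (use \<D>(4) in auto)
  then show ?thesis using \<Omega> by (subst AE_restrict_space_iff) auto
qed

text \<open>The fundamental lemma is applied to each component of the difference. The result links
  the gradient that \<open>weak_gradient\<close> selects, which is known only by its defining
  property, with the square integrable one that \<open>H1\<close> provides.\<close>

lemma weak_gradient_unique:
  assumes \<Omega>: "open \<Omega>" and g: "has_weak_gradient \<Omega> f g" "has_weak_gradient \<Omega> f g'"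
  shows "AE x in lebesgue_on \<Omega>. g x = g' x"
proof -
  have loc: "locally_integrable_on \<Omega> (\<lambda>x. k x \<bullet> b)" if "has_weak_gradient \<Omega> f k" for k b
    using that unfolding has_weak_gradient_def locally_integrable_on_def
    by (blast intro: absolutely_integrable_component)
  have "AE x in lebesgue_on \<Omega>. (g x - g' x) \<bullet> b = 0" if b: "b \<in> Basis" for b
  proof (rule fundamental_lemma_calculus_of_variations[OF \<Omega>])
    show "locally_integrable_on \<Omega> (\<lambda>x. (g x - g' x) \<bullet> b)"
      using loc[OF g(1), of b] loc[OF g(2), of b] unfolding inner_diff_left locally_integrable_on_def
      by (auto intro: set_integral_diff)
    fix \<psi> assume \<psi>: "test_function \<Omega> \<psi>"
    have "(LINT x|lebesgue_on \<Omega>. (g x \<bullet> b) * \<psi> x) = (LINT x|lebesgue_on \<Omega>. (g' x \<bullet> b) * \<psi> x)"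
      using g \<psi> b by (auto simp: has_weak_gradient_def)
    then show "(LINT x|lebesgue_on \<Omega>. ((g x - g' x) \<bullet> b) * \<psi> x) = 0"
      using test_function_integrable[OF \<Omega> loc[OF g(1)] \<psi>] test_function_integrable[OF \<Omega> loc[OF g(2)] \<psi>]
      by (simp add: inner_diff_left left_diff_distrib)
  qed
  then have "AE x in lebesgue_on \<Omega>. \<forall>b\<in>Basis. (g x - g' x) \<bullet> b = 0"
    by (subst AE_ball_countable) (auto intro: countable_finite)
  then show ?thesis
    by eventually_elim (rule euclidean_eqI, simp add: inner_diff_left)
qed

section \<open>The weak gradient of a quotient by the norm\<close>

lemma locally_integrable_scaleR:
  fixes m :: "'a::euclidean_space \<Rightarrow> real" and f :: "'a \<Rightarrow> 'b::euclidean_space"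
  assumes m: "continuous_on \<Omega> m" and f: "locally_integrable_on \<Omega> f"
  shows "locally_integrable_on \<Omega> (\<lambda>x. m x *\<^sub>R f x)"
  unfolding locally_integrable_on_def
proof (intro allI impI)
  fix K assume K: "compact K" "K \<subseteq> \<Omega>"
  have mK: "continuous_on K m" using m K(2) by (rule continuous_on_subset)
  have KL: "K \<in> sets lebesgue" by (rule fmeasurableD[OF lmeasurable_compact[OF K(1)]])
  show "(\<lambda>x. m x *\<^sub>R f x) absolutely_integrable_on K"
  proof (rule absolutely_integrable_bounded_measurable_product[where h = "scaleR"])
    show "bilinear (scaleR :: real \<Rightarrow> 'b \<Rightarrow> 'b)"
      by (rule bilinear_conv_bounded_bilinear[THEN iffD2]) (rule bounded_bilinear_scaleR)
    show "m \<in> borel_measurable (lebesgue_on K)"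
      by (rule continuous_imp_measurable_on_sets_lebesgue[OF mK KL])
    show "bounded (m ` K)" by (intro compact_imp_bounded compact_continuous_image mK K)
    show "f absolutely_integrable_on K" using f K by (simp add: locally_integrable_on_def)
  qed (rule KL)
qed

lemma locally_integrable_mult_vector:
  fixes m :: "'a::euclidean_space \<Rightarrow> 'b::euclidean_space" and f :: "'a \<Rightarrow> real"
  assumes m: "continuous_on \<Omega> m" and f: "locally_integrable_on \<Omega> f"
  shows "locally_integrable_on \<Omega> (\<lambda>x. f x *\<^sub>R m x)"
  unfolding locally_integrable_on_def
proof (intro allI impI)
  fix K assume K: "compact K" "K \<subseteq> \<Omega>"
  have mK: "continuous_on K m" using m K(2) by (rule continuous_on_subset)
  have KL: "K \<in> sets lebesgue" by (rule fmeasurableD[OF lmeasurable_compact[OF K(1)]])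
  show "(\<lambda>x. f x *\<^sub>R m x) absolutely_integrable_on K"
  proof (rule absolutely_integrable_bounded_measurable_product[where h = "\<lambda>v c. c *\<^sub>R v"])
    show "bilinear (\<lambda>(v :: 'b) (c :: real). c *\<^sub>R v)"
      by (rule bilinear_conv_bounded_bilinear[THEN iffD2]) (rule bounded_bilinear.flip[OF bounded_bilinear_scaleR])
    show "m \<in> borel_measurable (lebesgue_on K)"
      by (rule continuous_imp_measurable_on_sets_lebesgue[OF mK KL])
    show "bounded (m ` K)" by (intro compact_imp_bounded compact_continuous_image mK K)
    show "f absolutely_integrable_on K" using f K by (simp add: locally_integrable_on_def)
  qed (rule KL)
qed

lemma locally_integrable_diff:
  assumes "locally_integrable_on \<Omega> f" "locally_integrable_on \<Omega> g"
  shows "locally_integrable_on \<Omega> (\<lambda>x. f x - g x)"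
  using assms unfolding locally_integrable_on_def by (blast intro: set_integral_diff)

lemma frechet_derivative_outside_support:
  assumes "closed K" "\<And>x. x \<notin> K \<Longrightarrow> \<psi> x = (0 :: real)" "x \<notin> K"
  shows "frechet_derivative \<psi> (at x) h = 0"
proof -
  have "((\<lambda>_. 0) has_derivative (\<lambda>_. 0)) (at x)" by simp
  then have "(\<psi> has_derivative (\<lambda>_. 0)) (at x)"
    by (rule has_derivative_transform_within_open[of _ _ _ _ "- K"]) (use assms in auto)
  from frechet_derivative_at[OF this] show ?thesis by metis
qed

lemma test_function_support:
  assumes "test_function \<Omega> \<psi>"
  obtains K where "compact K" "K \<subseteq> \<Omega>" "\<And>x. x \<notin> K \<Longrightarrow> \<psi> x = 0"
proof (rule that)
  show "compact (closure {x. \<psi> x \<noteq> 0})" "closure {x. \<psi> x \<noteq> 0} \<subseteq> \<Omega>"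
    using assms by (auto simp: test_function_def)
  show "\<psi> x = 0" if "x \<notin> closure {x. \<psi> x \<noteq> 0}" for x
    using that closure_subset[of "{x. \<psi> x \<noteq> 0}"] by blast
qed

text \<open>The quotient is shifted onto the test function: \<open>\<psi> x / norm x\<close> is
  again a test function, since \<open>\<psi>\<close> vanishes near the origin. The term with
  \<open>inverse (norm x) ^ 3\<close> is what the product rule leaves over.\<close>

lemma has_weak_gradient_divide_norm:
  fixes f :: "'a::euclidean_space \<Rightarrow> real"
  assumes \<Omega>: "open \<Omega>" and \<delta>: "0 < \<delta>" "\<And>x. x \<in> \<Omega> \<Longrightarrow> \<delta> \<le> norm x"
    and g: "has_weak_gradient \<Omega> f g"
  shows "has_weak_gradient \<Omega> (\<lambda>x. f x / norm x) (\<lambda>x. inverse (norm x) *\<^sub>R g x - f x *\<^sub>R (inverse (norm x) ^ 3 *\<^sub>R x))"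
  unfolding has_weak_gradient_def
proof (intro conjI allI impI ballI)
  have nz: "x \<noteq> 0" if "x \<in> \<Omega>" for x using \<delta>(2)[OF that] \<delta>(1) by auto
  have f: "locally_integrable_on \<Omega> f" and g': "locally_integrable_on \<Omega> g"
    using g by (auto simp: has_weak_gradient_def)
  have cn: "continuous_on \<Omega> (\<lambda>x. inverse (norm x))" by (intro continuous_intros) (use nz in auto)
  show "locally_integrable_on \<Omega> (\<lambda>x. f x / norm x)"
    using locally_integrable_scaleR[OF cn f] by (simp add: divide_inverse mult.commute)
  show "locally_integrable_on \<Omega> (\<lambda>x. inverse (norm x) *\<^sub>R g x - f x *\<^sub>R (inverse (norm x) ^ 3 *\<^sub>R x))"
    by (intro locally_integrable_diff locally_integrable_scaleR locally_integrable_mult_vector f g' cn continuous_intros)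
  fix \<psi> :: "'a \<Rightarrow> real" and b :: 'a
  assume \<psi>: "test_function \<Omega> \<psi>" and b: "b \<in> Basis"
  have ck: "Ck k \<psi>" for k using \<psi> by (simp add: test_function_def)
  obtain K where K: "compact K" "K \<subseteq> \<Omega>" "\<And>x. x \<notin> K \<Longrightarrow> \<psi> x = 0"
    using test_function_support[OF \<psi>] by blast
  have near: "\<psi> x = 0" if "norm x < \<delta>" for x using \<delta>(2)[of x] that K by force
  define \<eta> where "\<eta> x = \<psi> x * inverse (norm x) ^ 1" for x
  have \<eta>: "test_function \<Omega> \<eta>"
    unfolding \<eta>_def using K by (intro test_functionI[OF _ K(1,2)] Ck_mult_inverse_norm[OF \<delta>(1) ck near]) auto
  have d\<psi>: "(\<psi> has_derivative frechet_derivative \<psi> (at x)) (at x)" for x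
    by (rule Ck_Suc_has_derivative[OF ck[of 1, simplified One_nat_def]])
  have d\<eta>: "frechet_derivative \<eta> (at x) b = frechet_derivative \<psi> (at x) b / norm x - (x \<bullet> b) * inverse (norm x) ^ 3 * \<psi> x"
    if "x \<in> \<Omega>" for x
  proof -
    have "(\<eta> has_derivative (\<lambda>h. frechet_derivative \<psi> (at x) h / norm x - (x \<bullet> h) * inverse (norm x) ^ 3 * \<psi> x)) (at x)"
      unfolding \<eta>_def
      by (rule has_derivative_eq_rhs[OF has_derivative_mult[OF d\<psi> has_derivative_inverse_norm_power[OF nz[OF that]]]])
        (simp add: fun_eq_iff divide_inverse eval_nat_numeral algebra_simps)
    from frechet_derivative_at[OF this] show ?thesis by metis
  qed
  have c1: "continuous_on UNIV (\<lambda>x. frechet_derivative \<psi> (at x) b * inverse (norm x) ^ 1)"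
    using ck[of "Suc 0"] b frechet_derivative_outside_support[OF compact_imp_closed[OF K(1)] K(3)] \<delta>(2) K(2)
    by (intro Ck_continuous_on[of 0] Ck_mult_inverse_norm[OF \<delta>(1)]) force+
  have i1: "integrable (lebesgue_on \<Omega>) (\<lambda>x. f x * (frechet_derivative \<psi> (at x) b * inverse (norm x) ^ 1))"
    by (rule integrable_mult_compact_support[OF \<Omega> f c1 K(1,2)])
      (simp add: frechet_derivative_outside_support[OF compact_imp_closed[OF K(1)] K(3)])
  have c2: "continuous_on UNIV (\<lambda>x. ((x \<bullet> b) * \<psi> x) * inverse (norm x) ^ 3)"
    by (intro Ck_continuous_on[of 0] Ck_mult_inverse_norm[OF \<delta>(1)] Ck_mult Ck_inner_right ck) (simp add: near)
  have i2: "integrable (lebesgue_on \<Omega>) (\<lambda>x. f x * (((x \<bullet> b) * \<psi> x) * inverse (norm x) ^ 3))"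
    by (rule integrable_mult_compact_support[OF \<Omega> f c2 K(1,2)]) (simp add: K(3))
  have gb: "locally_integrable_on \<Omega> (\<lambda>x. g x \<bullet> b)"
    using g' unfolding locally_integrable_on_def by (blast intro: absolutely_integrable_component)
  have i3: "integrable (lebesgue_on \<Omega>) (\<lambda>x. (g x \<bullet> b) * \<eta> x)"
    by (rule test_function_integrable[OF \<Omega> gb \<eta>])
  have eq: "(LINT x|lebesgue_on \<Omega>. f x * frechet_derivative \<eta> (at x) b) = - (LINT x|lebesgue_on \<Omega>. (g x \<bullet> b) * \<eta> x)"
    using g \<eta> b by (auto simp: has_weak_gradient_def)
  have "(LINT x|lebesgue_on \<Omega>. f x * frechet_derivative \<eta> (at x) b) =
    (LINT x|lebesgue_on \<Omega>. f x * (frechet_derivative \<psi> (at x) b * inverse (norm x) ^ 1) - f x * (((x \<bullet> b) * \<psi> x) * inverse (norm x) ^ 3))"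
    by (rule Bochner_Integration.integral_cong) (simp_all add: d\<eta> algebra_simps divide_inverse)
  also have "\<dots> = (LINT x|lebesgue_on \<Omega>. f x * (frechet_derivative \<psi> (at x) b * inverse (norm x) ^ 1))
     - (LINT x|lebesgue_on \<Omega>. f x * (((x \<bullet> b) * \<psi> x) * inverse (norm x) ^ 3))"
    by (rule Bochner_Integration.integral_diff[OF i1 i2])
  finally have 1: "(LINT x|lebesgue_on \<Omega>. f x * (frechet_derivative \<psi> (at x) b * inverse (norm x) ^ 1)) =
    (LINT x|lebesgue_on \<Omega>. f x * (((x \<bullet> b) * \<psi> x) * inverse (norm x) ^ 3)) - (LINT x|lebesgue_on \<Omega>. (g x \<bullet> b) * \<eta> x)"
    using eq by simp
  have "(LINT x|lebesgue_on \<Omega>. f x / norm x * frechet_derivative \<psi> (at x) b) =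
     (LINT x|lebesgue_on \<Omega>. f x * (((x \<bullet> b) * \<psi> x) * inverse (norm x) ^ 3) - (g x \<bullet> b) * \<eta> x)"
    unfolding Bochner_Integration.integral_diff[OF i2 i3] 1[symmetric]
    by (simp add: divide_inverse mult_ac)
  also have "\<dots> = (LINT x|lebesgue_on \<Omega>. - (((inverse (norm x) *\<^sub>R g x - f x *\<^sub>R (inverse (norm x) ^ 3 *\<^sub>R x)) \<bullet> b) * \<psi> x))"
    by (rule Bochner_Integration.integral_cong) (simp_all add: \<eta>_def inner_diff_left algebra_simps)
  finally show "(LINT x|lebesgue_on \<Omega>. f x / norm x * frechet_derivative \<psi> (at x) b) =
    - (LINT x|lebesgue_on \<Omega>. ((inverse (norm x) *\<^sub>R g x - f x *\<^sub>R (inverse (norm x) ^ 3 *\<^sub>R x)) \<bullet> b) * \<psi> x)"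
    by simp
qed

lemma continuous_on_imp_measurable_lebesgue_on:
  fixes m :: "'a::euclidean_space \<Rightarrow> real"
  shows "open \<Omega> \<Longrightarrow> continuous_on \<Omega> m \<Longrightarrow> m \<in> borel_measurable (lebesgue_on \<Omega>)"
  by (rule continuous_imp_measurable_on_sets_lebesgue) auto

text \<open>All factors are bounded because \<open>\<Omega>\<close> keeps away from the origin. This
  puts \<open>v / rho\<close> on the same footing as \<open>v\<close>.\<close>

lemma H1_divide_norm:
  fixes f :: "'a::euclidean_space \<Rightarrow> real"
  assumes \<Omega>: "open \<Omega>" and \<delta>: "0 < \<delta>" "\<And>x. x \<in> \<Omega> \<Longrightarrow> \<delta> \<le> norm x" and f: "H1 \<Omega> f"
  shows "H1 \<Omega> (\<lambda>x. f x / norm x)"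
  unfolding H1_def
proof (intro conjI)
  have nz: "x \<noteq> 0" if "x \<in> \<Omega>" for x using \<delta>(2)[OF that] \<delta>(1) by auto
  have \<Omega>L: "\<Omega> \<in> sets lebesgue" using \<Omega> by auto
  have inv: "\<bar>inverse (norm x)\<bar> \<le> inverse \<delta>" if "x \<in> \<Omega>" for x
    using \<delta>(2)[OF that] \<delta>(1) by (simp add: le_imp_inverse_le)
  have mi: "(\<lambda>x. inverse (norm x)) \<in> borel_measurable (lebesgue_on \<Omega>)"
    by (intro continuous_on_imp_measurable_lebesgue_on[OF \<Omega>] continuous_intros) (use nz in auto)
  have f2: "L2 \<Omega> f" using f by (simp add: H1_def)
  show "L2 \<Omega> (\<lambda>x. f x / norm x)"
    using L2_mult_bounded[OF \<Omega>L f2 mi inv] by (simp add: divide_inverse mult.commute)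
  obtain g where g: "has_weak_gradient \<Omega> f g" "\<And>b. b \<in> Basis \<Longrightarrow> L2 \<Omega> (\<lambda>x. g x \<bullet> b)"
    using f by (auto simp: H1_def)
  have "L2 \<Omega> (\<lambda>x. (inverse (norm x) *\<^sub>R g x - f x *\<^sub>R (inverse (norm x) ^ 3 *\<^sub>R x)) \<bullet> b)" if b: "b \<in> Basis" for b
  proof -
    have "L2 \<Omega> (\<lambda>x. (inverse (norm x) ^ 3 * (x \<bullet> b)) * f x)"
    proof (rule L2_mult_bounded[OF \<Omega>L f2])
      show "(\<lambda>x. inverse (norm x) ^ 3 * (x \<bullet> b)) \<in> borel_measurable (lebesgue_on \<Omega>)"
        by (intro continuous_on_imp_measurable_lebesgue_on[OF \<Omega>] continuous_intros) (use nz in auto)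
      fix x assume x: "x \<in> \<Omega>"
      have "\<bar>inverse (norm x) ^ 3 * (x \<bullet> b)\<bar> \<le> inverse (norm x) ^ 3 * norm x"
        using Basis_le_norm[OF b, of x] by (simp add: abs_mult mult_left_mono)
      also have "\<dots> = inverse (norm x) ^ 2" using nz[OF x] by (simp add: eval_nat_numeral)
      also have "\<dots> \<le> inverse \<delta> ^ 2" using inv[OF x] by (intro power_mono) auto
      finally show "\<bar>inverse (norm x) ^ 3 * (x \<bullet> b)\<bar> \<le> inverse \<delta> ^ 2" .
    qed
    with L2_mult_bounded[OF \<Omega>L g(2)[OF b] mi inv]
    have "L2 \<Omega> (\<lambda>x. inverse (norm x) * (g x \<bullet> b) - (inverse (norm x) ^ 3 * (x \<bullet> b)) * f x)"
      unfolding L2_iff_L2_on by (rule L2_on_diff)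
    then show ?thesis by (simp add: inner_diff_left mult_ac)
  qed
  then show "\<exists>g. has_weak_gradient \<Omega> (\<lambda>x. f x / norm x) g \<and> (\<forall>b\<in>Basis. L2 \<Omega> (\<lambda>x. g x \<bullet> b))"
    using has_weak_gradient_divide_norm[OF \<Omega> \<delta> g(1)] by blast
qed

section \<open>Integration in spherical coordinates\<close>

text \<open>The second coordinate is the angle from the equatorial plane, \<open>phi - pi / 2\<close>.\<close>

definition sph :: "real^3 \<Rightarrow> real^3" where
  "sph y = spherical (y $ 1) (pi / 2 + y $ 2) (y $ 3)"

text \<open>One family for the given domain and for the smaller domains of the same shape on which
  mollification is possible; \<open>\<beta>\<close> is the half-opening on either side of the
  equatorial plane.\<close>

definition wedge :: "real \<Rightarrow> real \<Rightarrow> real \<Rightarrow> (real^3) set" where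
  "wedge a b \<beta> = {x. a < rho x \<and> rho x < b \<and> pi / 2 - \<beta> < phi x \<and> phi x < pi / 2 + \<beta>}"

section \<open>The coordinates of a point and the Jacobian determinant\<close>

lemma rho_spherical: "0 \<le> r \<Longrightarrow> rho (spherical r p t) = r"
proof -
  assume r: "0 \<le> r"
  have "(r * sin p * cos t)\<^sup>2 + (r * sin p * sin t)\<^sup>2 + (r * cos p)\<^sup>2
     = r\<^sup>2 * ((sin p)\<^sup>2 * ((sin t)\<^sup>2 + (cos t)\<^sup>2) + (cos p)\<^sup>2)"
    by (simp add: power_mult_distrib algebra_simps del: sin_cos_squared_add sin_cos_squared_add2)
  also have "\<dots> = r\<^sup>2" by simp
  finally show ?thesis
    using r by (simp add: rho_def spherical_def norm_vec_def L2_set_def sum_3)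
qed

lemma phi_spherical: "0 < r \<Longrightarrow> 0 \<le> p \<Longrightarrow> p \<le> pi \<Longrightarrow> phi (spherical r p t) = p"
  using rho_spherical[of r p t]
  by (simp add: phi_def rho_def arccos_cos) (simp add: spherical_def arccos_cos)

lemma theta_spherical:
  assumes "0 < r" "0 < p" "p < pi" "0 \<le> t" "t < 2 * pi"
  shows "theta (spherical r p t) = t"
proof -
  have "Complex (r * sin p * cos t) (r * sin p * sin t) = of_real (r * sin p) * exp (\<i> * of_real t)"
    by (simp add: complex_eq_iff exp_Euler cos_of_real sin_of_real)
  then show ?thesis
    using assms sin_gt_zero[of p] unfolding theta_def
    by (intro Arg2pi_unique[of "r * sin p"]) (auto simp: spherical_def)
qed

definition sph_derivative :: "real^3 \<Rightarrow> real^3 \<Rightarrow> real^3" where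
  "sph_derivative y h = vector [
      h $ 1 * (cos (y $ 2) * cos (y $ 3)) - h $ 2 * (y $ 1 * sin (y $ 2) * cos (y $ 3)) - h $ 3 * (y $ 1 * cos (y $ 2) * sin (y $ 3)),
      h $ 1 * (cos (y $ 2) * sin (y $ 3)) - h $ 2 * (y $ 1 * sin (y $ 2) * sin (y $ 3)) + h $ 3 * (y $ 1 * cos (y $ 2) * cos (y $ 3)),
      - (h $ 1 * sin (y $ 2)) - h $ 2 * (y $ 1 * cos (y $ 2))]"

lemma vector_3_eq_axis:
  "(vector [a, b, c] :: real^3) = a *\<^sub>R axis 1 1 + b *\<^sub>R axis 2 1 + c *\<^sub>R axis 3 1"
  by (simp add: vec_eq_iff forall_3 axis_def)

lemma sph_has_derivative:
  "(sph has_derivative sph_derivative y) (at y within S)"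
proof -
  have s: "sph = (\<lambda>y. vector [y $ 1 * cos (y $ 2) * cos (y $ 3), y $ 1 * cos (y $ 2) * sin (y $ 3), - (y $ 1 * sin (y $ 2))])"
    by (simp add: fun_eq_iff sph_def spherical_def sin_add cos_add)
  show ?thesis
    unfolding s sph_derivative_def[abs_def] vector_3_eq_axis
    by (rule has_derivative_eq_rhs) (auto intro!: derivative_eq_intros bounded_linear_imp_has_derivative[OF bounded_linear_vec_nth]
      simp: fun_eq_iff algebra_simps)
qed

lemma det_sph_derivative:
  "det (matrix (sph_derivative y)) = (y $ 1)\<^sup>2 * cos (y $ 2)"
proof -
  define r p t where "r = y $ 1" and "p = y $ 2" and "t = y $ 3"
  have "det (matrix (\<lambda>h. vector [
      h $ 1 * (cos p * cos t) - h $ 2 * (r * sin p * cos t) - h $ 3 * (r * cos p * sin t),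
      h $ 1 * (cos p * sin t) - h $ 2 * (r * sin p * sin t) + h $ 3 * (r * cos p * cos t),
      - (h $ 1 * sin p) - h $ 2 * (r * cos p)] :: real^3)) =
     r * r * cos p * (cos p * cos p + sin p * sin p) * (cos t * cos t + sin t * sin t)"
    by (simp add: det_3 matrix_def axis_def algebra_simps del: sin_cos_squared_add3)
  also have "\<dots> = r\<^sup>2 * cos p" by (simp only: sin_cos_squared_add3 mult_1_right power2_eq_square)
  finally show ?thesis by (simp only: r_def p_def t_def sph_derivative_def[abs_def])
qed

section \<open>Boxes and iterated integrals in \<open>real^3\<close>\<close>

lemma emeasure_lborel_Times:
  fixes A :: "'a::euclidean_space set" and B :: "'b::euclidean_space set"
  assumes "A \<in> sets borel" "B \<in> sets borel"
  shows "emeasure lborel (A \<times> B) = emeasure lborel A * emeasure lborel B"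
  using assms by (subst lborel_prod[symmetric]) (auto intro: lborel.emeasure_pair_measure_Times)

lemma continuous_on_uncurry:
  assumes "continuous_on (A \<times> B) (\<lambda>z. K (fst z) (snd z))" "continuous_on S f" "continuous_on S g"
    and "\<And>x. x \<in> S \<Longrightarrow> f x \<in> A \<and> g x \<in> B"
  shows "continuous_on S (\<lambda>x. K (f x) (g x))"
proof -
  have "continuous_on S (\<lambda>x. K (fst (f x, g x)) (snd (f x, g x)))"
    by (rule continuous_on_compose2[OF assms(1) continuous_on_Pair[OF assms(2,3)]]) (use assms(4) in auto)
  then show ?thesis by simp
qed

lemma borel_measurable_vector_3: "(\<lambda>(r, q, t). vector [r, q, t] :: real^3) \<in> borel_measurable borel"
  unfolding vector_3_eq_axis split_beta by (intro borel_measurable_continuous_onI continuous_intros)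

text \<open>Identifies Lebesgue measure on the product type, where integrals are iterated, with that
  on \<open>real^3\<close>, where the change of variables takes place. Both give the same volume to
  boxes.\<close>

lemma distr_vector_3: "distr lborel borel (\<lambda>(r, q, t). vector [r, q, t] :: real^3) = lborel"
proof (rule lborel_eqI[symmetric])
  let ?T = "\<lambda>(r :: real, q, t). vector [r, q, t] :: real^3"
  fix l u :: "real^3" assume lu: "\<And>b. b \<in> Basis \<Longrightarrow> l \<bullet> b \<le> u \<bullet> b"
  have le: "l $ i \<le> u $ i" for i
    using lu[of "axis i 1"] by (simp add: inner_axis axis_in_Basis_iff)
  have "emeasure (distr lborel borel ?T) (box l u) = emeasure lborel (?T -` box l u \<inter> space lborel)"
    using borel_measurable_vector_3 by (intro emeasure_distr) auto
  also have "?T -` box l u \<inter> space lborel = {l$1<..<u$1} \<times> ({l$2<..<u$2} \<times> {l$3<..<u$3})"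
    by (auto simp: mem_box_cart forall_3)
  also have "emeasure lborel \<dots> = ennreal (u$1 - l$1) * (ennreal (u$2 - l$2) * ennreal (u$3 - l$3))"
    using le by (simp add: emeasure_lborel_Times borel_open open_Times)
  also have "\<dots> = ennreal ((u$1 - l$1) * ((u$2 - l$2) * (u$3 - l$3)))"
    using le by (simp add: ennreal_mult[symmetric])
  also have "(u$1 - l$1) * ((u$2 - l$2) * (u$3 - l$3)) = (\<Prod>b\<in>Basis. (u - l) \<bullet> b)"
  proof -
    have "Basis = (\<lambda>i. axis i 1 :: real^3) ` UNIV" by (auto simp: Basis_vec_def)
    then have "(\<Prod>b\<in>Basis. (u - l) \<bullet> b) = prod ((\<bullet>) (u - l)) ((\<lambda>i. axis i 1) ` UNIV)"
      by simp
    also have "\<dots> = (\<Prod>i\<in>UNIV. (u - l) \<bullet> axis i 1)"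
      by (subst prod.reindex) (auto simp: inj_on_def axis_eq_axis)
    also have "\<dots> = (u - l) $ 1 * ((u - l) $ 2 * (u - l) $ 3)"
      unfolding inner_axis UNIV_3 by simp
    finally show ?thesis by (simp only: vector_minus_component)
  qed
  finally show "emeasure (distr lborel borel ?T) (box l u) = (\<Prod>b\<in>Basis. (u - l) \<bullet> b)" .
qed simp

lemma integral_cbox_3:
  fixes K :: "real \<Rightarrow> real \<Rightarrow> real" and a b c d T :: real
  assumes cont: "continuous_on ({a..b} \<times> {c..d}) (\<lambda>z. K (fst z) (snd z))" and T: "0 \<le> T"
  shows "integral (cbox (vector [a, c, 0]) (vector [b, d, T] :: real^3)) (\<lambda>y. K (y $ 1) (y $ 2))
    = T * integral {a..b} (\<lambda>r. integral {c..d} (\<lambda>q. K r q))"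
proof -
  let ?l = "vector [a, c, 0] :: real^3" and ?u = "vector [b, d, T] :: real^3"
  let ?C = "cbox (a, c, 0 :: real) (b, d, T)"
  let ?T = "\<lambda>(r :: real, q, t). vector [r, q, t] :: real^3"
  have c3: "continuous_on (cbox ?l ?u) (\<lambda>y. K (y $ 1) (y $ 2))"
    by (rule continuous_on_uncurry[OF cont]) (auto simp: mem_box_cart forall_3 intro!: continuous_intros)
  have cP: "continuous_on ?C (\<lambda>z. K (fst z) (fst (snd z)))"
    by (rule continuous_on_uncurry[OF cont]) (auto simp: cbox_Pair_eq intro!: continuous_intros)
  have i3: "integrable lborel (\<lambda>y. indicator (cbox ?l ?u) y *\<^sub>R K (y $ 1) (y $ 2))"
    using c3 by (intro borel_integrable_compact) auto
  have iP: "integrable lborel (\<lambda>z. indicator ?C z *\<^sub>R K (fst z) (fst (snd z)))"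
    using cP by (intro borel_integrable_compact) auto
  have "integral (cbox ?l ?u) (\<lambda>y. K (y $ 1) (y $ 2)) = (LINT y|lborel. indicator (cbox ?l ?u) y *\<^sub>R K (y $ 1) (y $ 2))"
    using set_borel_integral_eq_integral(2)[of "cbox ?l ?u" "\<lambda>y. K (y $ 1) (y $ 2)"] i3
    by (simp add: set_integrable_def set_lebesgue_integral_def)
  also have "\<dots> = (LINT z|lborel. indicator (cbox ?l ?u) (?T z) *\<^sub>R K (?T z $ 1) (?T z $ 2))"
    using borel_measurable_vector_3 borel_measurable_integrable[OF i3]
    by (subst (1) distr_vector_3[symmetric], subst integral_distr) auto
  also have "\<dots> = (LINT z|lborel. indicator ?C z *\<^sub>R K (fst z) (fst (snd z)))"
    by (rule Bochner_Integration.integral_cong)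
      (auto simp: mem_box_cart forall_3 cbox_Pair_eq split: split_indicator)
  also have "\<dots> = integral ?C (\<lambda>z. K (fst z) (fst (snd z)))"
    using set_borel_integral_eq_integral(2)[of ?C "\<lambda>z. K (fst z) (fst (snd z))"] iP
    by (simp add: set_integrable_def set_lebesgue_integral_def)
  also have "\<dots> = integral {a..b} (\<lambda>r. integral (cbox (c, 0) (d, T)) (\<lambda>z. K r (fst z)))"
    using integral_prod_continuous[OF cP] by simp
  also have "\<dots> = integral {a..b} (\<lambda>r. integral {c..d} (\<lambda>q. integral {0..T} (\<lambda>t. K r q)))"
  proof (rule integral_cong)
    fix r assume r: "r \<in> {a..b}"
    have "continuous_on (cbox (c, 0) (d, T)) (\<lambda>z. K r (fst z))"
      by (rule continuous_on_uncurry[OF cont]) (use r in \<open>auto simp: cbox_Pair_eq intro!: continuous_intros\<close>)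
    from integral_prod_continuous[OF this]
    show "integral (cbox (c, 0) (d, T)) (\<lambda>z. K r (fst z)) = integral {c..d} (\<lambda>q. integral {0..T} (\<lambda>t. K r q))"
      by simp
  qed
  also have "\<dots> = T * integral {a..b} (\<lambda>r. integral {c..d} (\<lambda>q. K r q))"
    using T by simp
  finally show ?thesis .
qed

section \<open>Wedges as images of boxes\<close>

lemma continuous_on_phi: "continuous_on (- {0}) phi"
  unfolding phi_def
proof (rule continuous_on_arccos)
  show "continuous_on (- {0}) (\<lambda>x :: real^3. x $ 3 / norm x)"
    by (intro continuous_intros) auto
  show "\<forall>x\<in>- {0 :: real^3}. - 1 \<le> x $ 3 / norm x \<and> x $ 3 / norm x \<le> 1"
  proof
    fix x :: "real^3" assume "x \<in> - {0}"
    then have "\<bar>x $ 3 / norm x\<bar> \<le> 1"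
      using component_le_norm_cart[of x 3] by (simp add: abs_divide)
    then show "- 1 \<le> x $ 3 / norm x \<and> x $ 3 / norm x \<le> 1" by linarith
  qed
qed

text \<open>\<open>0 \<le> a\<close> keeps out the origin, where \<open>phi\<close> takes the
  conventional value \<open>arccos 0\<close> and is not continuous.\<close>

lemma open_wedge: "0 \<le> a \<Longrightarrow> open (wedge a b \<beta>)"
proof -
  assume a: "0 \<le> a"
  have "open (- {0} \<inter> phi -` {pi / 2 - \<beta><..<pi / 2 + \<beta>})"
    by (rule continuous_open_preimage[OF continuous_on_phi]) auto
  moreover have "open {x :: real^3. a < norm x \<and> norm x < b}"
    by (intro open_Collect_conj open_Collect_less continuous_intros)
  ultimately have "open ((- {0} \<inter> phi -` {pi / 2 - \<beta><..<pi / 2 + \<beta>}) \<inter> {x. a < norm x \<and> norm x < b})"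
    by (rule open_Int)
  also have "\<dots> = wedge a b \<beta>"
    using a by (auto simp: wedge_def rho_def)
  finally show ?thesis .
qed

text \<open>The open box makes \<open>sph\<close> injective. The price is the half-plane of azimuth
  0, which the image misses; it lies in a coordinate plane and is negligible.\<close>

lemma sph_image:
  fixes a b \<beta> :: real
  assumes a: "0 \<le> a" and \<beta>: "0 < \<beta>" "\<beta> < pi / 2"
  defines "S \<equiv> box (vector [a, -\<beta>, 0]) (vector [b, \<beta>, 2 * pi] :: real^3)"
  shows "sph ` S \<subseteq> wedge a b \<beta>" "wedge a b \<beta> - sph ` S \<subseteq> {x. x $ 2 = 0}" "inj_on sph S"
proof -
  have S: "y \<in> S \<longleftrightarrow> a < y$1 \<and> y$1 < b \<and> -\<beta> < y$2 \<and> y$2 < \<beta> \<and> 0 < y$3 \<and> y$3 < 2 * pi" for y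
    by (auto simp: S_def mem_box_cart forall_3)
  have sph: "rho (sph y) = y$1 \<and> phi (sph y) = pi / 2 + y$2 \<and> theta (sph y) = y$3" if "y \<in> S" for y
    using that a \<beta> unfolding S sph_def
    by (auto intro!: rho_spherical phi_spherical theta_spherical)
  show "sph ` S \<subseteq> wedge a b \<beta>" using sph by (auto simp: wedge_def S)
  show "inj_on sph S"
  proof (rule inj_onI)
    fix x y assume "x \<in> S" "y \<in> S" "sph x = sph y"
    then have "x$1 = y$1" "x$2 = y$2" "x$3 = y$3" using sph[of x] sph[of y] by auto
    then show "x = y" by (simp add: vec_eq_iff forall_3)
  qed
  show "wedge a b \<beta> - sph ` S \<subseteq> {x. x $ 2 = 0}"
  proof
    fix x assume x: "x \<in> wedge a b \<beta> - sph ` S"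
    then have "x \<noteq> 0" using a by (auto simp: wedge_def rho_def)
    note s = spherical_coordinates[OF this]
    define y :: "real^3" where "y = vector [rho x, phi x - pi / 2, theta x]"
    have "sph y = x" using s by (simp add: y_def sph_def)
    then have "y \<notin> S" using x by auto
    then have "theta x \<le> 0 \<or> theta x \<ge> 2 * pi" using x by (auto simp: S y_def wedge_def)
    then have "theta x = 0" using Arg2pi_ge_0[of "Complex (x$1) (x$2)"] Arg2pi_lt_2pi[of "Complex (x$1) (x$2)"]
      by (auto simp: theta_def)
    then have "spherical (rho x) (phi x) (theta x) $ 2 = 0" by (simp add: spherical_def)
    then show "x \<in> {x. x $ 2 = 0}" using s by simp
  qed
qed

text \<open>Values of \<open>G\<close> are prescribed for parameters in the open box; the rest of
  the wedge is a null set. Continuity of \<open>H\<close> up to the boundary supplies integrability.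
  The Jacobian \<open>r\<^sup>2 * cos q\<close> has a cosine because \<open>q\<close> is measured
  from the equatorial plane.\<close>

lemma spherical_integral:
  fixes G :: "real^3 \<Rightarrow> real" and H :: "real \<Rightarrow> real \<Rightarrow> real"
  assumes a: "0 \<le> a" "a < b" and \<beta>: "0 < \<beta>" "\<beta> < pi / 2"
    and cont: "continuous_on ({a..b} \<times> {-\<beta>..\<beta>}) (\<lambda>z. H (fst z) (snd z))"
    and G: "\<And>r q t. a < r \<Longrightarrow> r < b \<Longrightarrow> -\<beta> < q \<Longrightarrow> q < \<beta> \<Longrightarrow> 0 < t \<Longrightarrow> t < 2 * pi \<Longrightarrow>
       G (spherical r (pi / 2 + q) t) = H r q"
  shows "integrable (lebesgue_on (wedge a b \<beta>)) G"
    "(LINT x|lebesgue_on (wedge a b \<beta>). G x) = 2 * pi * integral {a..b} (\<lambda>r. integral {-\<beta>..\<beta>} (\<lambda>q. H r q * (r\<^sup>2 * cos q)))"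
proof -
  define l u :: "real^3" where "l = vector [a, -\<beta>, 0]" and "u = vector [b, \<beta>, 2 * pi]"
  define K where "K r q = H r q * (r\<^sup>2 * cos q)" for r q
  note img = sph_image[OF a(1) \<beta>, of b, folded l_def u_def]
  have cK: "continuous_on ({a..b} \<times> {-\<beta>..\<beta>}) (\<lambda>z. K (fst z) (snd z))"
    unfolding K_def by (intro continuous_intros cont)
  have cc: "continuous_on (cbox l u) (\<lambda>y. K (y $ 1) (y $ 2))"
    by (rule continuous_on_uncurry[OF cK])
      (auto simp: mem_box_cart forall_3 l_def u_def intro!: continuous_intros)
  have ai: "(\<lambda>y. K (y $ 1) (y $ 2)) absolutely_integrable_on box l u"
    using absolutely_integrable_continuous[OF cc]
    by (rule set_integrable_subset) (auto simp: box_subset_cbox)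
  have val: "integral (box l u) (\<lambda>y. K (y $ 1) (y $ 2)) = 2 * pi * integral {a..b} (\<lambda>r. integral {-\<beta>..\<beta>} (\<lambda>q. K r q))"
    using integral_cbox_3[OF cK, of "2 * pi"] by (simp add: l_def u_def integral_open_interval)
  have pull: "\<bar>det (matrix (sph_derivative y))\<bar> *\<^sub>R G (sph y) = K (y $ 1) (y $ 2)" if "y \<in> box l u" for y
  proof -
    have y: "a < y$1" "y$1 < b" "-\<beta> < y$2" "y$2 < \<beta>" "0 < y$3" "y$3 < 2 * pi"
      using that by (auto simp: l_def u_def mem_box_cart forall_3)
    then have "cos (y$2) > 0" using \<beta> by (intro cos_gt_zero_pi) auto
    then show ?thesis
      unfolding det_sph_derivative using G[OF y] by (simp add: K_def sph_def abs_mult)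
  qed
  \<comment> \<open>the change of variables theorem takes integrands with values in some \<open>real^'n\<close>\<close>
  let ?v = "\<lambda>x. vec (G x) :: real^1"
  have bl: "bounded_linear (vec :: real \<Rightarrow> real^1)"
    by (rule linear_conv_bounded_linear[THEN iffD1]) (auto intro!: linearI simp: vec_eq_iff)
  have "(\<lambda>y. vec (K (y $ 1) (y $ 2)) :: real^1) absolutely_integrable_on box l u"
    using absolutely_integrable_linear[OF ai bl] by (simp add: o_def)
  moreover have "\<bar>det (matrix (sph_derivative y))\<bar> *\<^sub>R ?v (sph y) = vec (K (y $ 1) (y $ 2))" if "y \<in> box l u" for y
    using pull[OF that] by (simp add: vec_eq_iff)
  ultimately have ai': "(\<lambda>y. \<bar>det (matrix (sph_derivative y))\<bar> *\<^sub>R ?v (sph y)) absolutely_integrable_on box l u"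
    by (subst set_integrable_cong[OF refl refl]) auto
  have "?v absolutely_integrable_on sph ` box l u \<and> integral (sph ` box l u) ?v = integral (box l u) (\<lambda>y. \<bar>det (matrix (sph_derivative y))\<bar> *\<^sub>R ?v (sph y))"
    using has_absolute_integral_change_of_variables[OF _ sph_has_derivative img(3), of ?v] ai' by auto
  then have v: "?v absolutely_integrable_on sph ` box l u"
    "integral (sph ` box l u) ?v = integral (box l u) (\<lambda>y. vec (K (y $ 1) (y $ 2)))"
    using \<open>\<And>y. y \<in> box l u \<Longrightarrow> \<bar>det (matrix (sph_derivative y))\<bar> *\<^sub>R ?v (sph y) = vec (K (y $ 1) (y $ 2))\<close>
    by (auto cong: integral_cong)
  have bl': "bounded_linear (\<lambda>x :: real^1. x $ 1)" by (rule bounded_linear_vec_nth)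
  have G1: "G absolutely_integrable_on sph ` box l u"
    using absolutely_integrable_linear[OF v(1) bl'] by (simp add: o_def)
  have G2: "integral (sph ` box l u) G = integral (box l u) (\<lambda>y. K (y $ 1) (y $ 2))"
    using arg_cong[OF v(2), of "\<lambda>x. x $ 1"]
      integral_linear[OF set_lebesgue_integral_eq_integral(1)[OF v(1)] bl']
      integral_linear[OF set_lebesgue_integral_eq_integral(1)[OF ai] bl]
    by (simp add: o_def)
  have neg1: "negligible {x \<in> wedge a b \<beta> - sph ` box l u. G x \<noteq> 0}"
    using img(2) by (intro negligible_subset[OF negligible_standard_hyperplane_cart[of 2]]) auto
  have neg2: "negligible {x \<in> sph ` box l u - wedge a b \<beta>. G x \<noteq> 0}"
    using img(1) by (intro negligible_subset[OF negligible_empty]) auto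
  have W: "G absolutely_integrable_on wedge a b \<beta>"
    using G1 absolutely_integrable_spike_set_eq[OF neg1 neg2] by simp
  have W2: "integral (wedge a b \<beta>) G = integral (sph ` box l u) G"
    by (rule integral_spike_set[OF neg1 neg2])
  have Wl: "wedge a b \<beta> \<in> sets lebesgue"
    using open_wedge[OF a(1)] by auto
  show "integrable (lebesgue_on (wedge a b \<beta>)) G"
    using W Wl by (simp add: integrable_restrict_space set_integrable_def)
  show "(LINT x|lebesgue_on (wedge a b \<beta>). G x) = 2 * pi * integral {a..b} (\<lambda>r. integral {-\<beta>..\<beta>} (\<lambda>q. H r q * (r\<^sup>2 * cos q)))"
    using set_lebesgue_integral_eq_integral(2)[OF W] Wl W2 G2 val
    by (simp add: integral_restrict_space set_lebesgue_integral_def K_def)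
qed

section \<open>Mollification\<close>

lemma continuous_measurable_lebesgue:
  fixes k :: "'a::euclidean_space \<Rightarrow> 'b::topological_space"
  shows "continuous_on UNIV k \<Longrightarrow> k \<in> borel_measurable lebesgue"
  by (intro measurable_completion) (auto intro: borel_measurable_continuous_onI)

lemma integrable_power2_add:
  fixes f g :: "'a \<Rightarrow> real"
  assumes "f \<in> borel_measurable M" "g \<in> borel_measurable M"
    and "integrable M (\<lambda>x. (f x)\<^sup>2)" "integrable M (\<lambda>x. (g x)\<^sup>2)"
  shows "integrable M (\<lambda>x. (f x + g x)\<^sup>2)"
    "(LINT x|M. (f x + g x)\<^sup>2) \<le> 2 * (LINT x|M. (f x)\<^sup>2) + 2 * (LINT x|M. (g x)\<^sup>2)"
  using L2_on_add[of M f g] assms by (auto simp: L2_on_def)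

lemma integrable_of_square_bounded_support:
  fixes w :: "'a::euclidean_space \<Rightarrow> real"
  assumes w: "w \<in> borel_measurable lebesgue" "integrable lebesgue (\<lambda>x. (w x)\<^sup>2)"
    and R: "\<And>x. R < norm x \<Longrightarrow> w x = 0"
  shows "integrable lebesgue w"
proof (rule Bochner_Integration.integrable_bound)
  have "integrable lebesgue (indicator (cball 0 R) :: 'a \<Rightarrow> real)"
    using lmeasurable_cball[of "0::'a" R] by (simp add: fmeasurable_def)
  then show "integrable lebesgue (\<lambda>x. (w x)\<^sup>2 + indicator (cball 0 R) x)"
    using w by simp
  show "AE x in lebesgue. norm (w x) \<le> norm ((w x)\<^sup>2 + indicator (cball 0 R) x)"
  proof (rule AE_I2)
    fix x
    have "\<bar>w x\<bar> \<le> (w x)\<^sup>2 + 1"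
      using sum_squares_bound[of "\<bar>w x\<bar>" 1] by simp
    then show "norm (w x) \<le> norm ((w x)\<^sup>2 + indicator (cball 0 R) x)"
      using R[of x] by (cases "norm x \<le> R") auto
  qed
qed (rule w)

section \<open>Mean-square approximation by continuous functions\<close>

definition clip :: "real \<Rightarrow> real \<Rightarrow> real" where
  "clip M t = max (- M) (min M t)"

lemma clip_simps: "0 \<le> M \<Longrightarrow> \<bar>clip M t\<bar> \<le> M" "0 \<le> M \<Longrightarrow> clip M 0 = 0" "\<bar>t\<bar> \<le> M \<Longrightarrow> clip M t = t"
  "0 \<le> M \<Longrightarrow> \<bar>t - clip M t\<bar> \<le> \<bar>t\<bar>" "0 \<le> M \<Longrightarrow> clip M (clip M t) = clip M t"
  by (auto simp: clip_def)

lemma continuous_on_clip: "continuous_on S f \<Longrightarrow> continuous_on S (\<lambda>x. clip M (f x))"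
  unfolding clip_def by (intro continuous_intros)

lemma L2_approx_clip:
  fixes w :: "'a \<Rightarrow> real"
  assumes w: "w \<in> borel_measurable N" "integrable N (\<lambda>x. (w x)\<^sup>2)" and \<delta>: "0 < \<delta>"
  obtains M where "0 \<le> M" "integrable N (\<lambda>x. (w x - clip M (w x))\<^sup>2)" "(LINT x|N. (w x - clip M (w x))\<^sup>2) < \<delta>"
proof -
  have m [measurable]: "(\<lambda>x. (w x - clip M (w x))\<^sup>2) \<in> borel_measurable N" for M
    using w(1) unfolding clip_def by measurable
  have b: "norm ((w x - clip (real n) (w x))\<^sup>2) \<le> (w x)\<^sup>2" for x n
    using clip_simps(4)[of "real n" "w x"] by (simp add: abs_le_square_iff)
  have "(\<lambda>n. LINT x|N. (w x - clip (real n) (w x))\<^sup>2) \<longlonglongrightarrow> (LINT x|N. 0)"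
  proof (rule integral_dominated_convergence[where w = "\<lambda>x. (w x)\<^sup>2"])
    show "AE x in N. (\<lambda>n. (w x - clip (real n) (w x))\<^sup>2) \<longlonglongrightarrow> 0"
    proof (rule AE_I2)
      fix x
      obtain n0 where "\<bar>w x\<bar> \<le> real n0" using real_arch_simple by blast
      then have "\<forall>\<^sub>F n in sequentially. (w x - clip (real n) (w x))\<^sup>2 = 0"
        by (intro eventually_sequentiallyI[of n0]) (auto simp: clip_simps)
      then show "(\<lambda>n. (w x - clip (real n) (w x))\<^sup>2) \<longlonglongrightarrow> 0" by (rule tendsto_eventually)
    qed
  qed (use w m b in auto)
  then have "\<forall>\<^sub>F n in sequentially. (LINT x|N. (w x - clip (real n) (w x))\<^sup>2) < \<delta>"
    using \<delta> by (auto dest: order_tendstoD)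
  then obtain n :: nat where "(LINT x|N. (w x - clip (real n) (w x))\<^sup>2) < \<delta>"
    by (auto simp: eventually_sequentially)
  moreover have "integrable N (\<lambda>x. (w x - clip (real n) (w x))\<^sup>2)"
    by (rule Bochner_Integration.integrable_bound[OF w(2)]) (use m b in auto)
  ultimately show ?thesis using that[of "real n"] by simp
qed

text \<open>A measurable function is an almost everywhere limit of continuous ones. Clipping these
  at \<open>M\<close> and multiplying by a cut-off that falls from 1 to 0 between the radii
  \<open>R\<close> and \<open>R + 1\<close> preserves continuity and the limit, and it supplies a
  dominating function.\<close>

lemma L2_approx_continuous_bounded:
  fixes v :: "'a::euclidean_space \<Rightarrow> real"
  assumes v: "v \<in> borel_measurable lebesgue" "\<And>x. \<bar>v x\<bar> \<le> M"
    and R: "\<And>x. R < norm x \<Longrightarrow> v x = 0" and \<delta>: "0 < \<delta>"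
  obtains \<kappa> where "continuous_on UNIV \<kappa>" "\<And>x. R + 1 \<le> norm x \<Longrightarrow> \<kappa> x = 0"
    "integrable lebesgue (\<lambda>x. (v x - \<kappa> x)\<^sup>2)" "(LINT x|lebesgue. (v x - \<kappa> x)\<^sup>2) < \<delta>"
proof -
  have M: "0 \<le> M" using v(2)[of undefined] by linarith
  obtain N g where N: "negligible N" and g: "\<And>n::nat. continuous_on UNIV (g n)"
    and lim: "\<And>x. x \<notin> N \<Longrightarrow> (\<lambda>n. g n x) \<longlonglongrightarrow> v x"
    using lebesgue_measurable_imp_measurable_on_real[OF v(1), of UNIV] unfolding measurable_on_def by auto
  define \<kappa> where "\<kappa> n x = max 0 (min 1 (R + 1 - norm x)) * clip M (g n x)" for n x
  have c\<kappa>: "continuous_on UNIV (\<kappa> n)" for n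
    unfolding \<kappa>_def by (intro continuous_intros continuous_on_clip g)
  have \<kappa>0: "\<kappa> n x = 0" if "R + 1 \<le> norm x" for n x using that by (simp add: \<kappa>_def)
  have \<kappa>M: "\<bar>\<kappa> n x\<bar> \<le> M" for n x
    unfolding \<kappa>_def abs_mult using clip_simps(1)[OF M, of "g n x"] by (intro mult_left_le_one_le[THEN order_trans]) auto
  have m: "(\<lambda>x. (v x - \<kappa> n x)\<^sup>2) \<in> borel_measurable lebesgue" for n
    using v(1) continuous_measurable_lebesgue[OF c\<kappa>[of n]] by simp
  have b: "norm ((v x - \<kappa> n x)\<^sup>2) \<le> (2 * M)\<^sup>2 * indicator (cball 0 (R + 1)) x" for n x
  proof (cases "norm x \<le> R + 1")
    case True
    have "\<bar>v x - \<kappa> n x\<bar> \<le> \<bar>2 * M\<bar>" using v(2)[of x] \<kappa>M[of n x] by linarith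
    then show ?thesis using True by (simp add: abs_le_square_iff)
  next
    case False
    then show ?thesis using R[of x] \<kappa>0[of x n] by simp
  qed
  have ib: "integrable lebesgue (\<lambda>x :: 'a. (2 * M)\<^sup>2 * indicator (cball 0 (R + 1)) x)"
    using lmeasurable_cball[of "0::'a" "R+1"] by (simp add: fmeasurable_def)
  have "(\<lambda>n. LINT x|lebesgue. (v x - \<kappa> n x)\<^sup>2) \<longlonglongrightarrow> (LINT x|(lebesgue :: 'a measure). 0)"
  proof (rule integral_dominated_convergence[where w = "\<lambda>x. (2 * M)\<^sup>2 * indicator (cball 0 (R + 1)) x"])
    have "(\<lambda>n. (v x - \<kappa> n x)\<^sup>2) \<longlonglongrightarrow> 0" if "x \<notin> N" for x
    proof -
      have "(\<lambda>n. \<kappa> n x) \<longlonglongrightarrow> max 0 (min 1 (R + 1 - norm x)) * clip M (v x)"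
        unfolding \<kappa>_def clip_def by (intro tendsto_intros lim that)
      also have "max 0 (min 1 (R + 1 - norm x)) * clip M (v x) = v x"
        using R[of x] v(2)[of x] by (cases "norm x \<le> R") (auto simp: clip_simps M)
      finally have "(\<lambda>n. (v x - \<kappa> n x)\<^sup>2) \<longlonglongrightarrow> (v x - v x)\<^sup>2" by (intro tendsto_intros)
      then show ?thesis by simp
    qed
    moreover have "AE x in lebesgue. x \<notin> N" using N by (intro AE_not_in) (simp add: negligible_iff_null_sets)
    ultimately show "AE x in lebesgue. (\<lambda>n. (v x - \<kappa> n x)\<^sup>2) \<longlonglongrightarrow> 0"
      by (metis (mono_tags, lifting) AE_mp AE_I2)
  qed (use b m ib in auto)
  then have "\<forall>\<^sub>F n in sequentially. (LINT x|lebesgue. (v x - \<kappa> n x)\<^sup>2) < \<delta>"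
    using \<delta> by (auto dest: order_tendstoD)
  then obtain n where "(LINT x|lebesgue. (v x - \<kappa> n x)\<^sup>2) < \<delta>" by (auto simp: eventually_sequentially)
  moreover have "integrable lebesgue (\<lambda>x. (v x - \<kappa> n x)\<^sup>2)"
    by (rule Bochner_Integration.integrable_bound[OF ib m]) (rule AE_I2, rule order_trans[OF b], simp)
  ultimately show ?thesis using that[of "\<kappa> n"] c\<kappa> \<kappa>0 by blast
qed

lemma L2_approx_continuous:
  fixes w :: "'a::euclidean_space \<Rightarrow> real"
  assumes w: "w \<in> borel_measurable lebesgue" "integrable lebesgue (\<lambda>x. (w x)\<^sup>2)"
    and R: "\<And>x. R < norm x \<Longrightarrow> w x = 0" and \<delta>: "0 < \<delta>"
  obtains \<kappa> where "continuous_on UNIV \<kappa>" "\<And>x. R + 1 \<le> norm x \<Longrightarrow> \<kappa> x = 0"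
    "integrable lebesgue (\<lambda>x. (w x - \<kappa> x)\<^sup>2)" "(LINT x|lebesgue. (w x - \<kappa> x)\<^sup>2) < \<delta>"
proof -
  obtain M where M: "0 \<le> M" and i: "integrable lebesgue (\<lambda>x. (w x - clip M (w x))\<^sup>2)"
    "(LINT x|lebesgue. (w x - clip M (w x))\<^sup>2) < \<delta> / 4"
    using L2_approx_clip[OF w, of "\<delta> / 4"] \<delta> by auto
  have mv: "(\<lambda>x. clip M (w x)) \<in> borel_measurable lebesgue"
    using w(1) unfolding clip_def by measurable
  obtain \<kappa> where \<kappa>: "continuous_on UNIV \<kappa>" "\<And>x. R + 1 \<le> norm x \<Longrightarrow> \<kappa> x = 0"
    "integrable lebesgue (\<lambda>x. (clip M (w x) - \<kappa> x)\<^sup>2)" "(LINT x|lebesgue. (clip M (w x) - \<kappa> x)\<^sup>2) < \<delta> / 4"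
    using L2_approx_continuous_bounded[OF mv clip_simps(1)[OF M], of R "\<delta> / 4"] R \<delta> M clip_simps(2) by auto
  have m: "(\<lambda>x. w x - clip M (w x)) \<in> borel_measurable lebesgue" "(\<lambda>x. clip M (w x) - \<kappa> x) \<in> borel_measurable lebesgue"
    using w(1) mv continuous_measurable_lebesgue[OF \<kappa>(1)] by auto
  show ?thesis
    using integrable_power2_add[OF m i(1) \<kappa>(3)] i(2) \<kappa>(4) by (intro that[OF \<kappa>(1,2)]) auto
qed

lemma compact_support_uniformly_continuous:
  fixes f :: "'a::euclidean_space \<Rightarrow> 'b::real_normed_vector"
  assumes f: "continuous_on UNIV f" and R: "\<And>x. R \<le> norm x \<Longrightarrow> f x = 0"
  shows "uniformly_continuous_on UNIV f"
  unfolding uniformly_continuous_on_def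
proof (intro allI impI)
  fix e :: real assume e: "0 < e"
  have "uniformly_continuous_on (cball 0 (R + 1)) f"
    using f by (intro compact_uniformly_continuous) (auto intro: continuous_on_subset)
  then obtain d where d: "0 < d" "\<And>x x'. x \<in> cball 0 (R + 1) \<Longrightarrow> x' \<in> cball 0 (R + 1) \<Longrightarrow> dist x' x < d \<Longrightarrow> dist (f x') (f x) < e"
    using e unfolding uniformly_continuous_on_def by metis
  have "dist (f x') (f x) < e" if "dist x' x < min d 1" for x x'
  proof (cases "norm x \<le> R + 1 \<and> norm x' \<le> R + 1")
    case False
    moreover have "\<bar>norm x' - norm x\<bar> < 1" using that norm_triangle_ineq3[of x' x] by (simp add: dist_norm)
    ultimately have "R \<le> norm x" "R \<le> norm x'" by linarith+
    then show ?thesis using R e by simp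
  qed (use d that in auto)
  then show "\<exists>d>0. \<forall>x\<in>UNIV. \<forall>x'\<in>UNIV. dist x' x < d \<longrightarrow> dist (f x') (f x) < e"
    using d(1) by (intro exI[of _ "min d 1"]) auto
qed

lemma compact_support_bounded:
  fixes f :: "'a::euclidean_space \<Rightarrow> real"
  assumes f: "continuous_on UNIV f" and R: "\<And>x. R \<le> norm x \<Longrightarrow> f x = 0"
  obtains C where "\<And>x. \<bar>f x\<bar> \<le> C"
proof -
  have "bounded (f ` cball 0 R)"
    using f by (intro compact_imp_bounded compact_continuous_image) (auto intro: continuous_on_subset)
  then obtain C where "\<forall>y\<in>f ` cball 0 R. norm y \<le> C" unfolding bounded_iff by blast
  then have C: "\<bar>f x\<bar> \<le> C" if "norm x \<le> R" for x using that by auto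
  have "\<bar>f x\<bar> \<le> max C 0" for x
    using C[of x] R[of x] by (cases "norm x \<le> R") auto
  then show ?thesis using that by blast
qed

section \<open>Convolution with a continuous kernel\<close>

definition conv :: "('a::euclidean_space \<Rightarrow> real) \<Rightarrow> ('a \<Rightarrow> real) \<Rightarrow> 'a \<Rightarrow> real" where
  "conv w k x = (LINT y|lebesgue. w y * k (x - y))"

lemma integrable_conv:
  fixes w q :: "'a::euclidean_space \<Rightarrow> real"
  assumes w: "integrable lebesgue w" and q: "continuous_on UNIV q" "\<And>x. \<bar>q x\<bar> \<le> C"
  shows "integrable lebesgue (\<lambda>y. w y * q (x - y))"
proof (rule Bochner_Integration.integrable_bound)
  show "integrable lebesgue (\<lambda>y. C * \<bar>w y\<bar>)" using w by simp
  have "continuous_on UNIV (\<lambda>y. q (x - y))"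
    by (rule continuous_on_compose2[OF q(1)]) (auto intro!: continuous_intros)
  then show "(\<lambda>y. w y * q (x - y)) \<in> borel_measurable lebesgue"
    by (intro borel_measurable_times borel_measurable_integrable[OF w] continuous_measurable_lebesgue)
  have "0 \<le> C" using q(2)[of 0] by linarith
  show "AE y in lebesgue. norm (w y * q (x - y)) \<le> norm (C * \<bar>w y\<bar>)"
    using q(2) \<open>0 \<le> C\<close> by (intro AE_I2) (simp add: abs_mult mult.commute[of C] mult_left_mono)
qed

lemma continuous_on_conv:
  fixes w q :: "'a::euclidean_space \<Rightarrow> real"
  assumes w: "integrable lebesgue w" and q: "continuous_on UNIV q" "\<And>x. R \<le> norm x \<Longrightarrow> q x = 0"
  shows "continuous_on UNIV (conv w q)"
  unfolding continuous_on_iff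
proof (intro ballI allI impI)
  fix x and e :: real assume e: "0 < e"
  obtain C where C: "\<And>x. \<bar>q x\<bar> \<le> C" using compact_support_bounded[OF q] by blast
  define J where "J = (LINT y|lebesgue. \<bar>w y\<bar>)"
  have J: "0 \<le> J" by (simp add: J_def)
  \<comment> \<open>\<open>J + 1\<close> in the denominator, since \<open>J\<close> may be
    0.\<close>
  obtain d where d: "0 < d" "\<And>x x'. dist x' x < d \<Longrightarrow> dist (q x') (q x) < e / (J + 1)"
    using compact_support_uniformly_continuous[OF q] e J unfolding uniformly_continuous_on_def
    by (metis UNIV_I add_nonneg_pos divide_pos_pos zero_less_one)
  have "dist (conv w q x') (conv w q x) < e" if "dist x' x < d" for x'
  proof -
    have "\<bar>conv w q x' - conv w q x\<bar> = \<bar>LINT y|lebesgue. w y * q (x' - y) - w y * q (x - y)\<bar>"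
      unfolding conv_def by (subst Bochner_Integration.integral_diff[OF integrable_conv[OF w q(1) C] integrable_conv[OF w q(1) C]]) simp
    also have "\<dots> \<le> (LINT y|lebesgue. e / (J + 1) * \<bar>w y\<bar>)"
    proof (rule integral_abs_bound[THEN order_trans], rule integral_mono)
      show "integrable lebesgue (\<lambda>y. \<bar>w y * q (x' - y) - w y * q (x - y)\<bar>)"
        by (intro integrable_abs Bochner_Integration.integrable_diff integrable_conv[OF w q(1) C])
      fix y
      have "\<bar>q (x' - y) - q (x - y)\<bar> \<le> e / (J + 1)"
        using d(2)[of "x' - y" "x - y"] that by (simp add: dist_norm)
      from mult_left_mono[OF this, of "\<bar>w y\<bar>"]
      show "\<bar>w y * q (x' - y) - w y * q (x - y)\<bar> \<le> e / (J + 1) * \<bar>w y\<bar>"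
        by (simp add: right_diff_distrib[symmetric] abs_mult mult.commute)
    qed (use w in auto)
    also have "\<dots> = e / (J + 1) * J" by (simp add: J_def)
    also have "\<dots> < e" using e J by (simp add: field_simps)
    finally show ?thesis by (simp add: dist_norm)
  qed
  then show "\<exists>d>0. \<forall>x'\<in>UNIV. dist x' x < d \<longrightarrow> dist (conv w q x') (conv w q x) < e"
    using d(1) by auto
qed

lemma conv_cong_AE:
  fixes w w' q :: "'a::euclidean_space \<Rightarrow> real"
  assumes "AE y in lebesgue. w y = w' y" "w \<in> borel_measurable lebesgue" "w' \<in> borel_measurable lebesgue" "continuous_on UNIV q"
  shows "conv w q x = conv w' q x"
  unfolding conv_def
proof (rule integral_cong_AE)
  have "continuous_on UNIV (\<lambda>y. q (x - y))"
    by (rule continuous_on_compose2[OF assms(4)]) (auto intro!: continuous_intros)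
  from continuous_measurable_lebesgue[OF this]
  show "(\<lambda>y. w y * q (x - y)) \<in> borel_measurable lebesgue" "(\<lambda>y. w' y * q (x - y)) \<in> borel_measurable lebesgue"
    using assms(2,3) by auto
  show "AE y in lebesgue. w y * q (x - y) = w' y * q (x - y)"
    using assms(1) by eventually_elim simp
qed


text \<open>\<open>e\<close> bounds the radius of the support. Evenness gives
  \<open>k (x - y)\<close> mass 1 as a function of either variable. Radial symmetry is stated
  separately where rotations enter.\<close>

locale mollifier_kernel =
  fixes k :: "'a::euclidean_space \<Rightarrow> real" and e :: real
  assumes e_pos: "0 < e"
    and smooth: "Ck n k"
    and nonneg: "0 \<le> k x"
    and support: "e \<le> norm x \<Longrightarrow> k x = 0"
    and mass: "(LINT x|lborel. k x) = 1"
    and even: "k (- x) = k x"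
begin

abbreviation partial :: "'a \<Rightarrow> 'a \<Rightarrow> real" where
  "partial b x \<equiv> frechet_derivative k (at x) b"

definition grad :: "'a \<Rightarrow> 'a" where
  "grad x = (\<Sum>b\<in>Basis. partial b x *\<^sub>R b)"

lemma k_continuous: "continuous_on UNIV k"
  using smooth[of 0] by simp

lemma k_has_derivative: "(k has_derivative frechet_derivative k (at x)) (at x)"
  by (rule Ck_Suc_has_derivative[OF smooth])

lemma frechet_derivative_grad: "frechet_derivative k (at x) h = grad x \<bullet> h"
proof -
  have lin: "linear (frechet_derivative k (at x))"
    using k_has_derivative by (rule has_derivative_linear)
  have "frechet_derivative k (at x) h = frechet_derivative k (at x) (\<Sum>b\<in>Basis. (h \<bullet> b) *\<^sub>R b)"
    by (simp only: euclidean_representation)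
  also have "\<dots> = (\<Sum>b\<in>Basis. (h \<bullet> b) * partial b x)"
    by (simp only: linear_sum[OF lin] linear_scale[OF lin] real_scaleR_def)
  also have "\<dots> = grad x \<bullet> h"
    by (simp add: grad_def inner_sum_left inner_commute[of h] mult.commute)
  finally show ?thesis .
qed

lemma partial_continuous: "b \<in> Basis \<Longrightarrow> continuous_on UNIV (partial b)"
  using smooth[of "Suc 0"] by simp

text \<open>The derivative vanishes on the open complement of \<open>cball 0 e\<close>; the bound
  \<open>e + 1\<close> gives a non-strict condition that implies membership in it.\<close>

lemma partial_support: "e + 1 \<le> norm x \<Longrightarrow> partial b x = 0"
  by (rule frechet_derivative_outside_support[of "cball 0 e"]) (auto intro: support)

lemma partial_bounded:
  assumes "b \<in> Basis" obtains C where "\<And>x. \<bar>partial b x\<bar> \<le> C"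
  using compact_support_bounded[OF partial_continuous[OF assms] partial_support] by blast

lemma k_bounded: obtains C where "\<And>x. \<bar>k x\<bar> \<le> C"
  using compact_support_bounded[OF k_continuous support] by blast

text \<open>The gradient is continuous with compact support, hence uniformly continuous, and the
  mean value estimate turns this into a remainder bound uniform in the base point. Such a bound can
  be integrated against a merely integrable \<open>w\<close>, which is how the convolution is
  differentiated.\<close>

lemma uniformly_differentiable:
  assumes \<eta>: "0 < \<eta>"
  obtains d where "0 < d" "\<And>z h. norm h < d \<Longrightarrow> \<bar>k (z + h) - k z - grad z \<bullet> h\<bar> \<le> \<eta> * norm h"
proof -
  have "continuous_on UNIV grad" unfolding grad_def by (intro continuous_intros partial_continuous)
  then have "uniformly_continuous_on UNIV grad"
    by (rule compact_support_uniformly_continuous[of _ "e + 1"]) (simp add: grad_def partial_support)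
  then obtain d where d: "0 < d" "\<And>x x'. dist x' x < d \<Longrightarrow> dist (grad x') (grad x) < \<eta>"
    using \<eta> unfolding uniformly_continuous_on_def by (metis UNIV_I)
  have "\<bar>k (z + h) - k z - grad z \<bullet> h\<bar> \<le> \<eta> * norm h" if h: "norm h < d" for z h
  proof -
    have "norm ((k (z + h) - grad z \<bullet> (z + h)) - (k z - grad z \<bullet> z)) \<le> \<eta> * norm ((z + h) - z)"
    proof (rule differentiable_bound[where f = "\<lambda>\<xi>. k \<xi> - grad z \<bullet> \<xi>" and f' = "\<lambda>\<xi> h. frechet_derivative k (at \<xi>) h - grad z \<bullet> h"])
      show "convex (ball z d)" by simp
      fix \<xi> assume \<xi>: "\<xi> \<in> ball z d"
      show "((\<lambda>\<xi>. k \<xi> - grad z \<bullet> \<xi>) has_derivative (\<lambda>h. frechet_derivative k (at \<xi>) h - grad z \<bullet> h)) (at \<xi> within ball z d)"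
        by (intro has_derivative_diff has_derivative_inner_right has_derivative_ident has_derivative_at_withinI[OF k_has_derivative])
      have "norm (frechet_derivative k (at \<xi>) h - grad z \<bullet> h) \<le> \<eta> * norm h" for h
      proof -
        have "norm (frechet_derivative k (at \<xi>) h - grad z \<bullet> h) = \<bar>(grad \<xi> - grad z) \<bullet> h\<bar>"
          by (simp add: frechet_derivative_grad inner_diff_left)
        also have "\<dots> \<le> norm (grad \<xi> - grad z) * norm h" by (rule Cauchy_Schwarz_ineq2)
        also have "\<dots> \<le> \<eta> * norm h"
          using d(2)[of \<xi> z] \<xi> by (intro mult_right_mono) (auto simp: dist_norm norm_minus_commute)
        finally show ?thesis .
      qed
      then show "onorm (\<lambda>h. frechet_derivative k (at \<xi>) h - grad z \<bullet> h) \<le> \<eta>"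
        using \<eta> by (intro onorm_bound) auto
    qed (use d(1) h in \<open>auto simp: dist_norm\<close>)
    then show ?thesis by (simp add: inner_add_right algebra_simps)
  qed
  then show ?thesis using that d(1) by blast
qed

lemma conv_has_derivative:
  assumes w: "integrable lebesgue w"
  shows "(conv w k has_derivative (\<lambda>h. \<Sum>b\<in>Basis. (h \<bullet> b) * conv w (partial b) x)) (at x)"
  unfolding has_derivative_at_alt
proof (intro conjI allI impI)
  show "bounded_linear (\<lambda>h. \<Sum>b\<in>Basis. (h \<bullet> b) * conv w (partial b) x)"
    by (intro bounded_linear_sum bounded_linear_mult_const bounded_linear_inner_left)
  fix \<epsilon> :: real assume \<epsilon>: "0 < \<epsilon>"
  define J where "J = (LINT y|lebesgue. \<bar>w y\<bar>)"
  have J: "0 \<le> J" by (simp add: J_def)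
  obtain d where d: "0 < d" "\<And>z h. norm h < d \<Longrightarrow> \<bar>k (z + h) - k z - grad z \<bullet> h\<bar> \<le> \<epsilon> / (J + 1) * norm h"
    using uniformly_differentiable[of "\<epsilon> / (J + 1)"] \<epsilon> J by (metis add_nonneg_pos divide_pos_pos zero_less_one)
  obtain C where C: "\<And>x. \<bar>k x\<bar> \<le> C" using k_bounded by blast
  note ik = integrable_conv[OF w k_continuous C]
  have ip: "integrable lebesgue (\<lambda>y. w y * partial b (x - y))" if b: "b \<in> Basis" for x b
    using partial_bounded[OF b] integrable_conv[OF w partial_continuous[OF b]] by metis
  have "norm (conv w k y - conv w k x - (\<Sum>b\<in>Basis. ((y - x) \<bullet> b) * conv w (partial b) x)) \<le> \<epsilon> * norm (y - x)"
    if y: "norm (y - x) < d" for y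
  proof -
    have "(\<Sum>b\<in>Basis. ((y - x) \<bullet> b) * conv w (partial b) x) = (LINT t|lebesgue. (\<Sum>b\<in>Basis. ((y - x) \<bullet> b) * (w t * partial b (x - t))))"
      unfolding conv_def using ip by (subst Bochner_Integration.integral_sum) auto
    also have "(\<lambda>t. \<Sum>b\<in>Basis. ((y - x) \<bullet> b) * (w t * partial b (x - t))) = (\<lambda>t. w t * (grad (x - t) \<bullet> (y - x)))"
      by (simp add: grad_def inner_sum_left sum_distrib_left inner_commute[of "y - x"] mult_ac)
    finally have 1: "(\<Sum>b\<in>Basis. ((y - x) \<bullet> b) * conv w (partial b) x) = (LINT t|lebesgue. w t * (grad (x - t) \<bullet> (y - x)))" .
    have ig: "integrable lebesgue (\<lambda>t. w t * (grad (x - t) \<bullet> (y - x)))"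
    proof -
      have "integrable lebesgue (\<lambda>t. \<Sum>b\<in>Basis. ((y - x) \<bullet> b) * (w t * partial b (x - t)))"
        using ip by (intro Bochner_Integration.integrable_sum) auto
      also have "(\<lambda>t. \<Sum>b\<in>Basis. ((y - x) \<bullet> b) * (w t * partial b (x - t))) = (\<lambda>t. w t * (grad (x - t) \<bullet> (y - x)))"
        by (simp add: grad_def inner_sum_left sum_distrib_left inner_commute[of "y - x"] mult_ac)
      finally show ?thesis .
    qed
    have "conv w k y - conv w k x - (\<Sum>b\<in>Basis. ((y - x) \<bullet> b) * conv w (partial b) x) =
      (LINT t|lebesgue. w t * k (y - t) - w t * k (x - t) - w t * (grad (x - t) \<bullet> (y - x)))"
      unfolding 1 unfolding conv_def using ik ig by simp
    also have "norm \<dots> \<le> (LINT t|lebesgue. \<epsilon> / (J + 1) * norm (y - x) * \<bar>w t\<bar>)"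
    proof (rule integral_norm_bound[THEN order_trans], rule integral_mono)
      show "integrable lebesgue (\<lambda>t. norm (w t * k (y - t) - w t * k (x - t) - w t * (grad (x - t) \<bullet> (y - x))))"
        using ik ig by (intro integrable_norm Bochner_Integration.integrable_diff)
      fix t
      have "\<bar>k (y - t) - k (x - t) - grad (x - t) \<bullet> (y - x)\<bar> \<le> \<epsilon> / (J + 1) * norm (y - x)"
        using d(2)[OF y, of "x - t"] by (simp add: algebra_simps)
      from mult_left_mono[OF this, of "\<bar>w t\<bar>"]
      show "norm (w t * k (y - t) - w t * k (x - t) - w t * (grad (x - t) \<bullet> (y - x))) \<le> \<epsilon> / (J + 1) * norm (y - x) * \<bar>w t\<bar>"
        by (simp add: right_diff_distrib[symmetric] abs_mult mult.commute)
    qed (use w in auto)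
    also have "\<dots> = (\<epsilon> * norm (y - x)) * (J / (J + 1))" by (simp add: J_def)
    also have "\<dots> \<le> \<epsilon> * norm (y - x)" using \<epsilon> J by (intro mult_left_le) auto
    finally show ?thesis .
  qed
  then show "\<exists>d>0. \<forall>y. norm (y - x) < d \<longrightarrow>
     norm (conv w k y - conv w k x - (\<Sum>b\<in>Basis. ((y - x) \<bullet> b) * conv w (partial b) x)) \<le> \<epsilon> * norm (y - x)"
    using d(1) by blast
qed

lemma integrable_k: "integrable lborel k"
proof -
  have "integrable lborel (\<lambda>x. indicator (cball 0 e) x *\<^sub>R k x)"
    by (intro borel_integrable_compact continuous_on_subset[OF k_continuous]) auto
  also have "(\<lambda>x. indicator (cball 0 e) x *\<^sub>R k x) = k"
    by (auto simp: fun_eq_iff indicator_def support)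
  finally show ?thesis .
qed

lemma k_measurable [measurable]: "k \<in> borel_measurable borel"
  by (rule borel_measurable_continuous_onI[OF k_continuous])

lemma k_translate:
  "(LINT y|lborel. k (x - y)) = 1" "(\<integral>\<^sup>+y. ennreal (k (y - x)) \<partial>lborel) = 1" "integrable lborel (\<lambda>y. k (x - y))"
proof -
  have ev: "k (x - y) = k (- x + y)" for x y using even[of "x - y"] by simp
  have d: "lborel = distr lborel borel ((+) (- x))" by (simp add: lborel_distr_plus)
  have "(LINT y|lborel. k y) = (LINT y|lborel. k (- x + y))"
    by (subst d, subst integral_distr) auto
  then show "(LINT y|lborel. k (x - y)) = 1" by (simp only: ev mass)
  have "integrable (distr lborel borel ((+) (- x))) k" using integrable_k d by simp
  then have "integrable lborel (\<lambda>y. k (- x + y))" by (subst (asm) integrable_distr_eq) auto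
  then show "integrable lborel (\<lambda>y. k (x - y))" by (simp only: ev)
  have "(\<integral>\<^sup>+y. ennreal (k y) \<partial>lborel) = (\<integral>\<^sup>+y. ennreal (k (- x + y)) \<partial>lborel)"
    by (subst d, subst nn_integral_distr) auto
  moreover have "(\<integral>\<^sup>+y. ennreal (k y) \<partial>lborel) = 1"
    using nn_integral_eq_integral[OF integrable_k] nonneg mass by simp
  ultimately show "(\<integral>\<^sup>+y. ennreal (k (y - x)) \<partial>lborel) = 1" by simp
qed

text \<open>Young's inequality for a probability density: Jensen's inequality at each point, then
  Tonelli's theorem and the mass 1 of the kernel. Mollification is thus a contraction, so its
  convergence need only be proved for continuous functions.\<close>

lemma conv_L2_le:
  assumes w: "integrable lebesgue w" "integrable lebesgue (\<lambda>x. (w x)\<^sup>2)"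
  shows "integrable lebesgue (\<lambda>x. (conv w k x)\<^sup>2)" "(LINT x|lebesgue. (conv w k x)\<^sup>2) \<le> (LINT x|lebesgue. (w x)\<^sup>2)"
proof -
  \<comment> \<open>Tonelli's theorem is applied to the product of Borel measures, so
    \<open>w\<close> gives way to a Borel representative; the convolution stays the same.\<close>
  obtain v where v [measurable]: "v \<in> borel_measurable lborel" and wv: "AE x in lborel. w x = v x"
    using completion_ex_borel_measurable_real[OF borel_measurable_integrable[OF w(1)]] by auto
  have wv': "AE x in lebesgue. w x = v x" using AE_completion[OF wv] .
  have mw: "w \<in> borel_measurable lebesgue" using w(1) by auto
  have vl: "v \<in> borel_measurable lebesgue" using v by (rule measurable_completion)
  have cv: "conv w k = conv v k"
    by (rule ext, rule conv_cong_AE[OF wv' mw vl k_continuous])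
  have "integrable lebesgue v"
    using integrable_cong_AE[OF mw vl wv'] w(1) by simp
  have ae2: "AE x in lebesgue. (w x)\<^sup>2 = (v x)\<^sup>2" using wv' by eventually_elim simp
  have "integrable lebesgue (\<lambda>x. (v x)\<^sup>2)"
    using integrable_cong_AE[OF _ _ ae2] w(2) mw vl by simp
  then have iv2: "integrable lborel (\<lambda>x. (v x)\<^sup>2)" by (simp add: integrable_completion)
  have v2: "(LINT x|lebesgue. (w x)\<^sup>2) = (LINT x|lborel. (v x)\<^sup>2)"
    using integral_cong_AE[OF _ _ ae2] mw vl by (simp add: integral_completion)
  obtain C where C: "\<And>x. \<bar>k x\<bar> \<le> C" using k_bounded by blast
  have meas [measurable]: "(\<lambda>y. v y * k (x - y)) \<in> borel_measurable lborel" "(\<lambda>y. (v y)\<^sup>2 * k (x - y)) \<in> borel_measurable lborel" for x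
    by measurable
  have i1: "integrable lborel (\<lambda>y. v y * k (x - y))" for x
    using integrable_conv[OF \<open>integrable lebesgue v\<close> k_continuous C] by (simp add: integrable_completion)
  have i2: "integrable lborel (\<lambda>y. (v y)\<^sup>2 * k (x - y))" for x
    using integrable_conv[OF \<open>integrable lebesgue (\<lambda>x. (v x)\<^sup>2)\<close> k_continuous C] by (simp add: integrable_completion)
  have cvl: "conv v k x = (LINT y|lborel. v y * k (x - y))" for x
    unfolding conv_def by (rule integral_completion) measurable
  \<comment> \<open>Expanding \<open>\<integral> (v y - c)\<^sup>2 * k (x - y) \<ge> 0\<close> about
    the mean value \<open>c\<close>.\<close>
  have jensen: "(conv v k x)\<^sup>2 \<le> (LINT y|lborel. (v y)\<^sup>2 * k (x - y))" for x
  proof -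
    define c where "c = conv v k x"
    have "0 \<le> (LINT y|lborel. (v y - c)\<^sup>2 * k (x - y))"
      by (intro integral_nonneg_AE) (auto simp: nonneg)
    also have "\<dots> = (LINT y|lborel. (v y)\<^sup>2 * k (x - y) - 2 * c * (v y * k (x - y)) + c\<^sup>2 * k (x - y))"
      by (simp add: power2_diff algebra_simps)
    also have "\<dots> = (LINT y|lborel. (v y)\<^sup>2 * k (x - y)) - 2 * c * c + c\<^sup>2 * 1"
      using i1 i2 k_translate(1,3)[of x] by (simp add: c_def cvl)
    finally show ?thesis by (simp add: c_def power2_eq_square)
  qed
  have cc: "continuous_on UNIV (conv v k)"
    by (rule continuous_on_conv[OF \<open>integrable lebesgue v\<close> k_continuous support])
  have mc: "conv v k \<in> borel_measurable borel" by (rule borel_measurable_continuous_onI[OF cc])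
  have "(\<integral>\<^sup>+x. ennreal ((conv v k x)\<^sup>2) \<partial>lborel) \<le> (\<integral>\<^sup>+x. (\<integral>\<^sup>+y. ennreal ((v y)\<^sup>2 * k (x - y)) \<partial>lborel) \<partial>lborel)"
  proof (rule nn_integral_mono)
    fix x
    have "(\<integral>\<^sup>+y. ennreal ((v y)\<^sup>2 * k (x - y)) \<partial>lborel) = ennreal (LINT y|lborel. (v y)\<^sup>2 * k (x - y))"
      by (rule nn_integral_eq_integral[OF i2]) (auto simp: nonneg)
    then show "ennreal ((conv v k x)\<^sup>2) \<le> (\<integral>\<^sup>+y. ennreal ((v y)\<^sup>2 * k (x - y)) \<partial>lborel)"
      using jensen by (simp add: ennreal_leI)
  qed
  also have "\<dots> = (\<integral>\<^sup>+y. (\<integral>\<^sup>+x. ennreal ((v y)\<^sup>2 * k (x - y)) \<partial>lborel) \<partial>lborel)"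
    by (rule lborel_pair.Fubini') measurable
  also have "\<dots> = (\<integral>\<^sup>+y. ennreal ((v y)\<^sup>2) \<partial>lborel)"
  proof (rule nn_integral_cong)
    fix y
    have "(\<integral>\<^sup>+x. ennreal ((v y)\<^sup>2 * k (x - y)) \<partial>lborel) = ennreal ((v y)\<^sup>2) * (\<integral>\<^sup>+x. ennreal (k (x - y)) \<partial>lborel)"
      by (subst nn_integral_cmult[symmetric]) (auto simp: ennreal_mult nonneg)
    then show "(\<integral>\<^sup>+x. ennreal ((v y)\<^sup>2 * k (x - y)) \<partial>lborel) = ennreal ((v y)\<^sup>2)"
      by (simp add: k_translate(2))
  qed
  also have "\<dots> = ennreal (LINT x|lborel. (v x)\<^sup>2)"
    by (rule nn_integral_eq_integral[OF iv2]) auto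
  finally have le: "(\<integral>\<^sup>+x. ennreal ((conv v k x)\<^sup>2) \<partial>lborel) \<le> ennreal (LINT x|lborel. (v x)\<^sup>2)" .
  have ic: "integrable lborel (\<lambda>x. (conv v k x)\<^sup>2)"
  proof (rule integrableI_nonneg)
    show "(\<integral>\<^sup>+x. ennreal ((conv v k x)\<^sup>2) \<partial>lborel) < \<infinity>"
      using le by (rule le_less_trans) simp
  qed (use mc in auto)
  show "integrable lebesgue (\<lambda>x. (conv w k x)\<^sup>2)"
    unfolding cv using ic by (simp add: integrable_completion mc)
  have "ennreal (LINT x|lborel. (conv v k x)\<^sup>2) \<le> ennreal (LINT x|lborel. (v x)\<^sup>2)"
    using le nn_integral_eq_integral[OF ic] by simp
  then have "(LINT x|lborel. (conv v k x)\<^sup>2) \<le> (LINT x|lborel. (v x)\<^sup>2)"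
    by (subst (asm) ennreal_le_iff) auto
  then show "(LINT x|lebesgue. (conv w k x)\<^sup>2) \<le> (LINT x|lebesgue. (w x)\<^sup>2)"
    unfolding v2 cv using mc by (simp add: integral_completion)
qed

end

context mollifier_kernel
begin

lemma k_translate_lebesgue:
  "(LINT y|lebesgue. k (x - y)) = 1" "integrable lebesgue (\<lambda>y. k (x - y))"
proof -
  have [measurable]: "(\<lambda>y. k (x - y)) \<in> borel_measurable lborel" by measurable
  show "(LINT y|lebesgue. k (x - y)) = 1" "integrable lebesgue (\<lambda>y. k (x - y))"
    using k_translate[of x] by (simp_all add: integral_completion integrable_completion)
qed

lemma conv_close:
  assumes \<kappa>: "integrable lebesgue \<kappa>" and \<eta>: "\<And>y. dist y x < e \<Longrightarrow> \<bar>\<kappa> y - \<kappa> x\<bar> \<le> \<eta>"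
  shows "\<bar>conv \<kappa> k x - \<kappa> x\<bar> \<le> \<eta>"
proof -
  obtain C where C: "\<And>x. \<bar>k x\<bar> \<le> C" using k_bounded by blast
  note i1 = integrable_conv[OF \<kappa> k_continuous C, of x]
  note i2 = k_translate_lebesgue[of x]
  have "conv \<kappa> k x - \<kappa> x = (LINT y|lebesgue. \<kappa> y * k (x - y) - \<kappa> x * k (x - y))"
    using i1 i2 by (simp add: conv_def)
  also have "\<bar>\<dots>\<bar> \<le> (LINT y|lebesgue. \<eta> * k (x - y))"
  proof (rule integral_abs_bound[THEN order_trans], rule integral_mono)
    show "integrable lebesgue (\<lambda>y. \<bar>\<kappa> y * k (x - y) - \<kappa> x * k (x - y)\<bar>)"
      using i1 i2 by (intro integrable_abs Bochner_Integration.integrable_diff) auto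
    fix y
    show "\<bar>\<kappa> y * k (x - y) - \<kappa> x * k (x - y)\<bar> \<le> \<eta> * k (x - y)"
    proof (cases "dist y x < e")
      case True
      then show ?thesis
        using mult_right_mono[OF \<eta>[OF True] nonneg[of "x - y"]] nonneg[of "x - y"]
        by (simp add: left_diff_distrib[symmetric] abs_mult)
    next
      case False
      then have "k (x - y) = 0" by (intro support) (simp add: dist_norm norm_minus_commute)
      then show ?thesis by simp
    qed
  qed (use i2 in auto)
  also have "\<dots> = \<eta>" using i2 by simp
  finally show ?thesis .
qed

lemma conv_support:
  assumes "\<And>y. R \<le> norm y \<Longrightarrow> \<kappa> y = 0" "R + e \<le> norm x"
  shows "conv \<kappa> k x = 0"
proof -
  have "\<kappa> y * k (x - y) = 0" for y
  proof (cases "R \<le> norm y")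
    case False
    then have "e \<le> norm (x - y)" using assms(2) norm_triangle_ineq2[of x y] by linarith
    then show ?thesis by (simp add: support)
  qed (simp add: assms)
  then show ?thesis by (simp only: conv_def Bochner_Integration.integral_zero)
qed

end

section \<open>Mean-square convergence of mollified functions\<close>

lemma integrable_indicator_cball: "integrable lebesgue (indicator (cball (0::'a::euclidean_space) R) :: 'a \<Rightarrow> real)"
  using lmeasurable_cball[of "0::'a" R] by (simp add: fmeasurable_def)

text \<open>The threshold \<open>e0\<close> serves all kernels at once, so a single kernel can later
  be chosen to suit several functions. The proof passes to a continuous \<open>\<kappa>\<close> with
  compact support, for which mollification converges uniformly.\<close>

lemma mollify_L2:
  fixes w :: "'a::euclidean_space \<Rightarrow> real"
  assumes w: "w \<in> borel_measurable lebesgue" "integrable lebesgue (\<lambda>x. (w x)\<^sup>2)"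
    and R: "\<And>x. R < norm x \<Longrightarrow> w x = 0" and \<delta>: "0 < \<delta>"
  obtains e0 where "0 < e0" "\<And>k e. mollifier_kernel k e \<Longrightarrow> e < e0 \<Longrightarrow>
     integrable lebesgue (\<lambda>x. (conv w k x - w x)\<^sup>2) \<and> (LINT x|lebesgue. (conv w k x - w x)\<^sup>2) < \<delta>"
proof -
  \<comment> \<open>The error is \<open>A + (B + C)\<close>, where \<open>A\<close> is the mollified
    \<open>w - \<kappa>\<close>, \<open>B\<close> the mollification error of
    \<open>\<kappa>\<close>, and \<open>C = \<kappa> - w\<close>. Its square is at most
    \<open>2 * A\<^sup>2 + 4 * B\<^sup>2 + 4 * C\<^sup>2\<close>, and the shares satisfy
    \<open>2 / 12 + 4 / 8 + 4 / 12 = 1\<close>.\<close>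
  obtain \<kappa> where \<kappa>: "continuous_on UNIV \<kappa>" "\<And>x. R + 1 \<le> norm x \<Longrightarrow> \<kappa> x = 0"
    and i: "integrable lebesgue (\<lambda>x. (w x - \<kappa> x)\<^sup>2)" and c: "(LINT x|lebesgue. (w x - \<kappa> x)\<^sup>2) < \<delta> / 12"
    using L2_approx_continuous[OF w R, where \<delta> = "\<delta> / 12"] \<delta> by auto
  have m\<kappa>: "\<kappa> \<in> borel_measurable lebesgue" using \<kappa>(1) by (rule continuous_measurable_lebesgue)
  have m1: "(\<lambda>x. w x - \<kappa> x) \<in> borel_measurable lebesgue" using w(1) m\<kappa> by simp
  have m2: "(\<lambda>x. \<kappa> x - w x) \<in> borel_measurable lebesgue" using w(1) m\<kappa> by simp
  have wi: "integrable lebesgue w" by (rule integrable_of_square_bounded_support[OF w R])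
  have d1: "integrable lebesgue (\<lambda>x. w x - \<kappa> x)"
    by (rule integrable_of_square_bounded_support[OF m1 i, of "R + 1"]) (simp add: R \<kappa>(2))
  have \<kappa>i: "integrable lebesgue \<kappa>" using Bochner_Integration.integrable_diff[OF wi d1] by simp
  \<comment> \<open>The ball of radius \<open>R + 2\<close> contains the support of
    \<open>\<kappa>\<close> and, for \<open>e < 1\<close>, that of its mollification. The uniform
    error \<open>\<eta>\<close> is chosen so that \<open>\<eta>\<^sup>2 * V\<close> stays below the
    share of \<open>B\<close>.\<close>
  define V where "V = measure lebesgue (cball (0 :: 'a) (R + 2))"
  have V: "0 \<le> V" by (simp add: V_def)
  define \<eta> where "\<eta> = sqrt (\<delta> / (8 * (V + 1)))"
  have \<eta>: "0 < \<eta>" "\<eta>\<^sup>2 * V < \<delta> / 8" using \<delta> V by (simp_all add: \<eta>_def field_simps)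
  obtain d where d: "0 < d" "\<And>x x'. dist x' x < d \<Longrightarrow> dist (\<kappa> x') (\<kappa> x) < \<eta>"
    using compact_support_uniformly_continuous[OF \<kappa>] \<eta>(1) unfolding uniformly_continuous_on_def by (metis UNIV_I)
  show ?thesis
  proof (rule that[of "min d 1"])
    show "0 < min d 1" using d by simp
    fix k :: "'a \<Rightarrow> real" and e
    assume "mollifier_kernel k e" and e: "e < min d 1"
    then interpret mollifier_kernel k e by simp
    obtain C where C: "\<And>x. \<bar>k x\<bar> \<le> C" using k_bounded by blast
    have mc: "conv v k \<in> borel_measurable lebesgue" if "integrable lebesgue v" for v
      by (intro continuous_measurable_lebesgue continuous_on_conv[OF that k_continuous support])
    have B: "(conv \<kappa> k x - \<kappa> x)\<^sup>2 \<le> \<eta>\<^sup>2 * indicator (cball 0 (R + 2)) x" for x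
    proof (cases "norm x \<le> R + 2")
      case True
      have "\<bar>conv \<kappa> k x - \<kappa> x\<bar> \<le> \<eta>"
        using d(2) e by (intro conv_close \<kappa>i) (force simp: dist_real_def intro: less_imp_le)
      then have "(conv \<kappa> k x - \<kappa> x)\<^sup>2 \<le> \<eta>\<^sup>2" using \<eta>(1) by (simp add: abs_le_square_iff[symmetric])
      then show ?thesis using True by simp
    next
      case False
      then show ?thesis using conv_support[of "R + 1" \<kappa> x] \<kappa>(2) e by simp
    qed
    have mB: "(\<lambda>x. conv \<kappa> k x - \<kappa> x) \<in> borel_measurable lebesgue" using mc[OF \<kappa>i] m\<kappa> by simp
    have ib: "integrable lebesgue (\<lambda>x :: 'a. \<eta>\<^sup>2 * indicator (cball 0 (R + 2)) x)"
      by (intro integrable_mult_right integrable_indicator_cball)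
    have iB: "integrable lebesgue (\<lambda>x. (conv \<kappa> k x - \<kappa> x)\<^sup>2)"
      by (rule Bochner_Integration.integrable_bound[OF ib]) (use mB B in auto)
    have "(LINT x|lebesgue. (conv \<kappa> k x - \<kappa> x)\<^sup>2) \<le> (LINT x|lebesgue. \<eta>\<^sup>2 * indicator (cball (0::'a) (R + 2)) x)"
      using iB ib B by (rule integral_mono)
    also have "\<dots> = \<eta>\<^sup>2 * V" by (simp add: V_def)
    finally have LB: "(LINT x|lebesgue. (conv \<kappa> k x - \<kappa> x)\<^sup>2) < \<delta> / 8" using \<eta>(2) by simp
    have iC: "integrable lebesgue (\<lambda>x. (\<kappa> x - w x)\<^sup>2)" "(LINT x|lebesgue. (\<kappa> x - w x)\<^sup>2) < \<delta> / 12"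
      using i c by (simp_all add: power2_commute)
    note s1 = integrable_power2_add[OF mB m2 iB iC(1)]
    have mA: "conv (\<lambda>x. w x - \<kappa> x) k \<in> borel_measurable lebesgue" using mc[OF d1] .
    have mBC: "(\<lambda>x. (conv \<kappa> k x - \<kappa> x) + (\<kappa> x - w x)) \<in> borel_measurable lebesgue"
      by (rule borel_measurable_add[OF mB m2])
    note A = conv_L2_le[OF d1 i]
    note s2 = integrable_power2_add[OF mA mBC A(1) s1(1)]
    have E: "conv w k x - w x = conv (\<lambda>x. w x - \<kappa> x) k x + ((conv \<kappa> k x - \<kappa> x) + (\<kappa> x - w x))" for x
    proof -
      have "conv (\<lambda>x. w x - \<kappa> x) k x = conv w k x - conv \<kappa> k x"
        unfolding conv_def left_diff_distrib
        by (rule Bochner_Integration.integral_diff[OF integrable_conv[OF wi k_continuous C] integrable_conv[OF \<kappa>i k_continuous C]])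
      then show ?thesis by simp
    qed
    show "integrable lebesgue (\<lambda>x. (conv w k x - w x)\<^sup>2) \<and> (LINT x|lebesgue. (conv w k x - w x)\<^sup>2) < \<delta>"
      unfolding E using s2(2) s1(2) A(2) c iC(2) LB by (intro conjI s2(1)) linarith
  qed
qed

text \<open>A function of \<open>x \<bullet> x\<close> is radial and, unlike a function of the norm
  in general, inherits smoothness at the origin.\<close>

lemma mollifier_kernel_exists:
  assumes e: "0 < e"
  obtains k :: "'a::euclidean_space \<Rightarrow> real" where "mollifier_kernel k e" "\<And>x y. norm x = norm y \<Longrightarrow> k x = k y"
proof -
  define \<phi> where "\<phi> x = flat 0 (e\<^sup>2 - x \<bullet> x)" for x :: 'a
  have ck: "Ck n \<phi>" for n
    unfolding \<phi>_def by (intro Ck_flat_compose Ck_diff Ck_const Ck_inner_self)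
  have \<phi>0: "\<phi> x = 0 \<longleftrightarrow> e \<le> norm x" for x
    using e abs_le_square_iff[of e "norm x"] by (simp add: \<phi>_def flat_eq_0_iff dot_square_norm)
  have nn: "0 \<le> \<phi> x" for x by (simp add: \<phi>_def flat_nonneg)
  have i: "integrable lborel \<phi>"
  proof -
    have "integrable lborel (\<lambda>x. indicator (cball 0 e) x *\<^sub>R \<phi> x)"
      by (intro borel_integrable_compact Ck_continuous_on[OF ck]) auto
    also have "(\<lambda>x. indicator (cball 0 e) x *\<^sub>R \<phi> x) = \<phi>"
    proof
      fix x show "indicator (cball 0 e) x *\<^sub>R \<phi> x = \<phi> x"
        using \<phi>0[of x] by (cases "norm x \<le> e") simp_all
    qed
    finally show ?thesis .
  qed
  define Z where "Z = (LINT x|lborel. \<phi> x)"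
  have "Z \<noteq> 0"
  proof
    assume "Z = 0"
    then have "AE x in lborel. \<phi> x = 0"
      using integral_nonneg_eq_0_iff_AE[OF i] nn by (simp add: Z_def)
    then have "AE x in lborel. x \<notin> ball (0 :: 'a) e"
      by eventually_elim (simp add: \<phi>0)
    then have "emeasure lborel (ball (0 :: 'a) e) = 0"
      by (subst (asm) AE_iff_measurable[OF _ refl]) (auto simp: ball_def)
    then show False using content_ball_pos[OF e, of "0 :: 'a"] by (simp add: measure_def)
  qed
  moreover have "0 \<le> Z" unfolding Z_def by (rule Bochner_Integration.integral_nonneg) (rule nn)
  ultimately have Z: "0 < Z" by simp
  show ?thesis
  proof (rule that[of "\<lambda>x. (1 / Z) * \<phi> x"])
    show "mollifier_kernel (\<lambda>x. (1 / Z) * \<phi> x) e"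
    proof
      show "Ck n (\<lambda>x. (1 / Z) * \<phi> x)" for n by (intro Ck_cmult ck)
      show "0 \<le> (1 / Z) * \<phi> x" for x using Z nn by simp
      show "(LINT x|lborel. (1 / Z) * \<phi> x) = 1" using Z by (simp add: Z_def[symmetric])
    qed (use e \<phi>0 in \<open>auto simp: \<phi>_def\<close>)
  qed (simp add: \<phi>_def dot_square_norm)
qed

lemma Ck_reflect: "Ck n k \<Longrightarrow> Ck n (\<lambda>y. k (x - y))"
proof (induction n arbitrary: k)
  case 0
  then show ?case by (auto intro!: continuous_on_compose2[of UNIV k] continuous_intros)
next
  case (Suc n)
  have "((\<lambda>y. k (x - y)) has_derivative (\<lambda>h. frechet_derivative k (at (x - y)) (- h))) (at y)" for y
    by (rule has_derivative_compose[OF _ Ck_Suc_has_derivative[OF Suc.prems]])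
      (auto intro!: derivative_eq_intros)
  moreover have "frechet_derivative k (at (x - y)) (- h) = (- 1) * frechet_derivative k (at (x - y)) h" for y h
    using linear_neg[OF has_derivative_linear[OF Ck_Suc_has_derivative[OF Suc.prems]]] by simp
  ultimately have "((\<lambda>y. k (x - y)) has_derivative (\<lambda>h. (- 1) * frechet_derivative k (at (x - y)) h)) (at y)" for y
    by (simp only:)
  then show ?case
  proof (rule Ck_SucI)
    fix b :: 'a assume b: "b \<in> Basis"
    have "Ck n (\<lambda>y. frechet_derivative k (at (x - y)) b)"
      using Suc.prems b by (intro Suc.IH) simp
    then show "Ck n (\<lambda>y. (- 1) * frechet_derivative k (at (x - y)) b)" by (rule Ck_cmult)
  qed
qed

text \<open>As a function of \<open>y\<close>, \<open>k (x - y)\<close> is a test function once the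
  ball of radius \<open>e\<close> about \<open>x\<close> lies in \<open>\<Omega>\<close>. The sign
  in the definition of the weak gradient cancels against the sign of the reflection.\<close>

lemma conv_weak_gradient:
  fixes f :: "'a::euclidean_space \<Rightarrow> real"
  assumes \<Omega>: "open \<Omega>" and g: "has_weak_gradient \<Omega> f g" and k: "mollifier_kernel k e"
    and x: "cball x e \<subseteq> \<Omega>" and b: "b \<in> Basis"
  shows "conv (\<lambda>y. indicator \<Omega> y * f y) (\<lambda>x. frechet_derivative k (at x) b) x = conv (\<lambda>y. indicator \<Omega> y * (g y \<bullet> b)) k x"
proof -
  interpret mollifier_kernel k e by fact
  have "test_function \<Omega> (\<lambda>y. k (x - y))"
    using x by (intro test_functionI[of _ "cball x e"] Ck_reflect smooth) (auto simp: dist_norm support)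
  then have eq: "(LINT y|lebesgue_on \<Omega>. f y * frechet_derivative (\<lambda>y. k (x - y)) (at y) b) = - (LINT y|lebesgue_on \<Omega>. (g y \<bullet> b) * k (x - y))"
    using g b by (auto simp: has_weak_gradient_def)
  have fd: "frechet_derivative (\<lambda>y. k (x - y)) (at y) b = - partial b (x - y)" for y
  proof -
    have "((\<lambda>y. k (x - y)) has_derivative (\<lambda>h. frechet_derivative k (at (x - y)) (- h))) (at y)"
      by (rule has_derivative_compose[OF _ k_has_derivative]) (auto intro!: derivative_eq_intros)
    from frechet_derivative_at[OF this]
    have "frechet_derivative (\<lambda>y. k (x - y)) (at y) b = frechet_derivative k (at (x - y)) (- b)" by metis
    then show ?thesis by (simp add: frechet_derivative_grad)
  qed
  show ?thesis
    using eq \<Omega> unfolding fd conv_def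
    by (simp add: integral_restrict_space mult.assoc)
qed

lemma integral_orthogonal_transformation:
  fixes F :: "real^'n::{finite,wellorder} \<Rightarrow> real" and T :: "real^'n::_ \<Rightarrow> real^'n::_"
  assumes T: "orthogonal_transformation T" and F: "integrable lebesgue F"
  shows "(LINT x|lebesgue. F (T x)) = (LINT x|lebesgue. F x)"
proof -
  have lin: "linear T" using T by (rule orthogonal_transformation_linear)
  have surj: "T ` UNIV = UNIV" using orthogonal_transformation_surj[OF T] by simp
  let ?v = "\<lambda>x. vec (F x) :: real^1"
  have bl: "bounded_linear (vec :: real \<Rightarrow> real^1)"
    by (rule linear_conv_bounded_linear[THEN iffD1]) (auto intro!: linearI simp: vec_eq_iff)
  have bl': "bounded_linear (\<lambda>x :: real^1. x $ 1)" by (rule bounded_linear_vec_nth)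
  have FU: "F absolutely_integrable_on UNIV" using F by (simp add: set_integrable_def)
  have v: "?v absolutely_integrable_on UNIV"
    using absolutely_integrable_linear[OF FU bl] by (simp add: o_def)
  then have vT: "(?v \<circ> T) absolutely_integrable_on UNIV"
    using absolutely_integrable_on_linear_image[OF lin, where f = ?v and S = UNIV] orthogonal_transformation_det[OF T] surj by auto
  have FT: "(\<lambda>x. F (T x)) absolutely_integrable_on UNIV"
    using absolutely_integrable_linear[OF vT bl'] by (simp add: o_def)
  have "integral UNIV ?v = integral UNIV (?v \<circ> T)"
    using integral_change_of_variables_linear[OF lin, where f = ?v and S = UNIV] v orthogonal_transformation_det[OF T] surj by simp
  then have "integral UNIV F = integral UNIV (\<lambda>x. F (T x))"
    using integral_linear[OF set_lebesgue_integral_eq_integral(1)[OF FU] bl]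
      integral_linear[OF set_lebesgue_integral_eq_integral(1)[OF FT] bl]
    by (simp add: o_def vec_eq_iff)
  then show ?thesis
    using set_lebesgue_integral_eq_integral(2)[OF FU] set_lebesgue_integral_eq_integral(2)[OF FT]
    by (simp add: set_lebesgue_integral_def)
qed

text \<open>After the substitution \<open>y = T z\<close> the kernel sees only
  \<open>norm (T x - T z) = norm (x - z)\<close>. Invariance of \<open>w\<close> almost everywhere
  thereby becomes invariance of the convolution at every point.\<close>

lemma conv_orthogonal_transformation:
  fixes w k :: "real^'n::{finite,wellorder} \<Rightarrow> real" and T :: "real^'n::_ \<Rightarrow> real^'n::_"
  assumes T: "orthogonal_transformation T" and w: "integrable lebesgue w"
    and wT: "AE y in lebesgue. w (T y) = w y" and k: "mollifier_kernel k e" "\<And>x y. norm x = norm y \<Longrightarrow> k x = k y"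
  shows "conv w k (T x) = conv w k x"
proof -
  interpret mollifier_kernel k e by fact
  obtain C where C: "\<And>x. \<bar>k x\<bar> \<le> C" using k_bounded by blast
  have lin: "linear T" using T by (rule orthogonal_transformation_linear)
  have kT: "k (T x - T z) = k (x - z)" for z
    using k(2) orthogonal_transformation_norm[OF T] by (metis linear_diff[OF lin])
  note i = integrable_conv[OF w k_continuous C]
  have "conv w k (T x) = (LINT z|lebesgue. w (T z) * k (T x - T z))"
    unfolding conv_def using integral_orthogonal_transformation[OF T i[of "T x"]] by simp
  also have "\<dots> = (LINT z|lebesgue. w (T z) * k (x - z))" by (simp only: kT)
  also have "\<dots> = conv w k x"
    unfolding conv_def
  proof (rule integral_cong_AE)
    have ae: "AE z in lebesgue. w z * k (x - z) = w (T z) * k (x - z)" using wT by eventually_elim simp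
    show m: "(\<lambda>z. w z * k (x - z)) \<in> borel_measurable lebesgue" using i[of x] by auto
    show "(\<lambda>z. w (T z) * k (x - z)) \<in> borel_measurable lebesgue"
      using borel_measurable_AE[OF m ae] .
    show "AE z in lebesgue. w (T z) * k (x - z) = w z * k (x - z)" using ae by eventually_elim (erule sym)
  qed
  finally show ?thesis .
qed

section \<open>Spherical wedges\<close>

definition rot :: "real \<Rightarrow> real^3 \<Rightarrow> real^3" where
  "rot t x = vector [cos t * x $ 1 - sin t * x $ 2, sin t * x $ 1 + cos t * x $ 2, x $ 3]"

lemma orthogonal_transformation_rot: "orthogonal_transformation (rot t)"
  unfolding orthogonal_transformation
proof
  show "linear (rot t)"
    by (rule linearI) (auto simp: rot_def vec_eq_iff forall_3 algebra_simps)
  have "(cos t * a - sin t * b)\<^sup>2 + (sin t * a + cos t * b)\<^sup>2 = (cos t * cos t + sin t * sin t) * (a\<^sup>2 + b\<^sup>2)" for a b :: real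
    by (simp add: power2_eq_square algebra_simps del: sin_cos_squared_add3)
  then have "(cos t * a - sin t * b)\<^sup>2 + (sin t * a + cos t * b)\<^sup>2 = a\<^sup>2 + b\<^sup>2" for a b :: real
    by simp
  then show "\<forall>v. norm (rot t v) = norm v"
    by (simp add: norm_vec_def L2_set_def sum_3 rot_def)
qed

lemma rho_rot: "rho (rot t x) = rho x"
  using orthogonal_transformation_norm[OF orthogonal_transformation_rot] by (simp add: rho_def)

lemma phi_rot: "phi (rot t x) = phi x"
  using orthogonal_transformation_norm[OF orthogonal_transformation_rot, of t x] unfolding phi_def
  by (simp add: rot_def)

lemma rot_minus: "rot (- t) (rot t x) = x"
proof -
  have *: "cos t * (cos t * a) + sin t * (sin t * a) = a" for a
    using sin_cos_squared_add3[of t] by (metis distrib_right mult.assoc mult_1)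
  show ?thesis by (simp add: rot_def vec_eq_iff forall_3 algebra_simps *)
qed

lemma spherical_rot: "spherical r p t = rot t (spherical r p 0)"
  by (simp add: spherical_def rot_def vec_eq_iff forall_3 mult_ac)

lemma rot_wedge: "rot t x \<in> wedge a b \<beta> \<longleftrightarrow> x \<in> wedge a b \<beta>"
  by (simp add: wedge_def rho_rot phi_rot)

lemma sin_phi_pos: "x \<in> wedge a b \<beta> \<Longrightarrow> \<beta> \<le> pi / 2 \<Longrightarrow> 0 < sin (phi x)"
  by (rule sin_gt_zero) (auto simp: wedge_def)

lemma wedge_nonzero: "0 \<le> a \<Longrightarrow> x \<in> wedge a b \<beta> \<Longrightarrow> x \<noteq> 0"
  by (auto simp: wedge_def rho_def)

section \<open>The coordinate vector fields on a wedge\<close>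

lemma coord_rho_eq: "x \<noteq> 0 \<Longrightarrow> coord_rho x = inverse (rho x) *\<^sub>R x"
  using spherical_coordinates[of x]
  by (auto simp: spherical_def coord_rho_def rho_def vec_eq_iff forall_3 field_simps)

text \<open>\<open>theta\<close> jumps across a half-plane, so continuity of the field cannot be
  read off its definition. This expression is free of the azimuth and continuous off the
  axis.\<close>

lemma coord_phi_eq:
  assumes "x \<noteq> 0" "0 < sin (phi x)"
  shows "coord_phi x = vector [x $ 1 * cos (phi x) / sin (phi x), x $ 2 * cos (phi x) / sin (phi x), - (rho x * sin (phi x))]"
proof -
  have "rho x * sin (phi x) * cos (theta x) = x $ 1" "rho x * sin (phi x) * sin (theta x) = x $ 2"
    using spherical_coordinates[OF assms(1)] by (auto simp: spherical_def vec_eq_iff forall_3)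
  then show ?thesis
    using assms(2) by (simp add: coord_phi_def vec_eq_iff forall_3 field_simps)
qed

lemma norm_coord_rho: "norm (coord_rho x) = 1"
proof -
  have "norm (coord_rho x) = rho (spherical 1 (phi x) (theta x))"
    by (simp add: rho_def coord_rho_def spherical_def)
  then show ?thesis by (simp add: rho_spherical)
qed

lemma norm_coord_phi: "norm (coord_phi x) = rho x"
proof -
  \<comment> \<open>Formally, \<open>coord_phi x\<close> is the point with the same radius and
    azimuth whose polar angle is larger by \<open>pi / 2\<close>.\<close>
  have "norm (coord_phi x) = rho (spherical (rho x) (pi / 2 + phi x) (theta x))"
    by (simp add: rho_def coord_phi_def spherical_def sin_add cos_add)
  also have "\<dots> = rho x" by (rule rho_spherical) (simp add: rho_def)
  finally show ?thesis .
qed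

lemma continuous_on_coord:
  assumes "0 \<le> a" "\<beta> \<le> pi / 2"
  shows "continuous_on (wedge a b \<beta>) coord_rho" "continuous_on (wedge a b \<beta>) coord_phi"
    "continuous_on (wedge a b \<beta>) phi"
proof -
  note nz = wedge_nonzero[OF assms(1)] and sp = sin_phi_pos[OF _ assms(2)]
  show cp: "continuous_on (wedge a b \<beta>) phi"
    using nz by (intro continuous_on_subset[OF continuous_on_phi]) auto
  have "continuous_on (wedge a b \<beta>) (\<lambda>x. inverse (rho x) *\<^sub>R x)"
    unfolding rho_def using nz by (intro continuous_intros) auto
  then show "continuous_on (wedge a b \<beta>) coord_rho"
    by (subst continuous_on_cong[OF refl coord_rho_eq]) (auto dest: nz)
  have "continuous_on (wedge a b \<beta>) (\<lambda>x. vector [x $ 1 * cos (phi x) / sin (phi x), x $ 2 * cos (phi x) / sin (phi x), - (rho x * sin (phi x))] :: real^3)"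
    unfolding vector_3_eq_axis rho_def using sp by (intro continuous_intros cp) force+
  then show "continuous_on (wedge a b \<beta>) coord_phi"
    by (subst continuous_on_cong[OF refl coord_phi_eq]) (auto dest: nz sp)
qed

text \<open>The smaller wedge sits in a compact subset of the larger open one, which has a positive
  distance to the complement. This distance later bounds the mollification radius.\<close>

lemma wedge_compact_inclusion:
  assumes "0 \<le> a0" "a0 < a" "b < b0" "\<beta> < \<beta>0"
  obtains \<epsilon> where "0 < \<epsilon>" "\<And>x. x \<in> wedge a b \<beta> \<Longrightarrow> cball x \<epsilon> \<subseteq> wedge a0 b0 \<beta>0"
proof -
  let ?A = "{x :: real^3. a \<le> norm x \<and> norm x \<le> b}"
  let ?K = "?A \<inter> phi -` {pi / 2 - \<beta>..pi / 2 + \<beta>}"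
  have A: "closed ?A"
    by (intro closed_Collect_conj closed_Collect_le continuous_intros)
  have "closed ?K"
    using assms by (intro continuous_closed_preimage A continuous_on_subset[OF continuous_on_phi]) auto
  moreover have "bounded ?K" by (rule bounded_subset[OF bounded_cball[of 0 b]]) auto
  ultimately have K: "compact ?K" by (simp add: compact_eq_bounded_closed)
  have "?K \<subseteq> wedge a0 b0 \<beta>0" using assms by (auto simp: wedge_def rho_def)
  then obtain \<epsilon> where \<epsilon>: "0 < \<epsilon>" "(\<Union>x\<in>?K. cball x \<epsilon>) \<subseteq> wedge a0 b0 \<beta>0"
    by (rule compact_subset_open_imp_cball_epsilon_subset[OF K open_wedge[OF assms(1)]])
  show ?thesis
  proof (rule that[OF \<epsilon>(1)])
    fix x assume "x \<in> wedge a b \<beta>"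
    then have "x \<in> ?K" by (auto simp: wedge_def rho_def)
    then show "cball x \<epsilon> \<subseteq> wedge a0 b0 \<beta>0" using \<epsilon>(2) by blast
  qed
qed

text \<open>The right-hand side of the inequality, with the gradient as an argument so that smooth
  and weak gradients can be inserted alike.\<close>

definition dirichlet :: "(real^3) set \<Rightarrow> (real^3 \<Rightarrow> real^3) \<Rightarrow> real" where
  "dirichlet S g = 8 / sqrt 3 * (LINT x|lebesgue_on S. (g x \<bullet> coord_rho x)\<^sup>2)
      + 1 / (5 * sqrt 3) * (LINT x|lebesgue_on S. 1 / (rho x)\<^sup>2 * (g x \<bullet> coord_phi x)\<^sup>2)"

text \<open>Restriction to the meridian of azimuth 0 reduces the claim to the rectangle. Since
  \<open>axi\<close> holds at every point, derivatives at other azimuths can be compared with those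
  on this meridian.\<close>

lemma wedge_inequality_smooth:
  fixes u :: "real^3 \<Rightarrow> real" and V :: "real^3 \<Rightarrow> real^3"
  assumes a: "0 < a" "2 * a \<le> b" and \<beta>: "0 < \<beta>" "\<beta> < pi / 6"
    and du: "\<And>x. (u has_derivative (\<lambda>h. V x \<bullet> h)) (at x)" and cV: "continuous_on UNIV V"
    and axi: "\<And>r p t. u (spherical r p t) = u (spherical r p 0)"
    and zero: "(LINT x|lebesgue_on (wedge a b \<beta>). rho x ^ (1 + j) * sin (phi x) * u x) = 0"
  shows "(LINT x|lebesgue_on (wedge a b \<beta>). (u x)\<^sup>2 / (rho x)\<^sup>2) \<le> dirichlet (wedge a b \<beta>) V"
proof -
  let ?W = "wedge a b \<beta>" and ?R = "{a..b} \<times> {-\<beta>..\<beta>}"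
  have ab: "0 \<le> a" "a < b" and \<beta>2: "\<beta> < pi / 2" using a \<beta> by linarith+
  define S where "S r q = spherical r (pi / 2 + q) 0" for r q
  define er :: "real \<Rightarrow> real^3" where "er q = vector [sin (pi / 2 + q), 0, cos (pi / 2 + q)]" for q
  define ep :: "real \<Rightarrow> real \<Rightarrow> real^3" where "ep r q = vector [r * cos (pi / 2 + q), 0, - (r * sin (pi / 2 + q))]" for r q
  define F where "F r q = u (S r q)" for r q
  define Fr where "Fr r q = V (S r q) \<bullet> er q" for r q
  define Fq where "Fq r q = V (S r q) \<bullet> ep r q" for r q
  have cS: "continuous_on ?R (\<lambda>z. S (fst z) (snd z))"
    unfolding S_def spherical_def vector_3_eq_axis by (intro continuous_intros)
  have cu: "continuous_on UNIV u"
    using du by (meson continuous_at_imp_continuous_on has_derivative_continuous)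
  have cVS: "continuous_on ?R (\<lambda>z. V (S (fst z) (snd z)))"
    by (rule continuous_on_compose2[OF cV cS]) auto
  have cF: "continuous_on ?R (\<lambda>z. F (fst z) (snd z))"
    unfolding F_def by (rule continuous_on_compose2[OF cu cS]) auto
  have cFr: "continuous_on ?R (\<lambda>z. Fr (fst z) (snd z))"
    unfolding Fr_def er_def vector_3_eq_axis by (intro continuous_intros cVS)
  have cFq: "continuous_on ?R (\<lambda>z. Fq (fst z) (snd z))"
    unfolding Fq_def ep_def vector_3_eq_axis by (intro continuous_intros cVS)
  have dr: "((\<lambda>r. F r q) has_vector_derivative Fr r q) (at r within A)" for r q A
  proof -
    have "((\<lambda>r. r *\<^sub>R er q) has_vector_derivative er q) (at r within A)"
      by (auto intro!: derivative_eq_intros)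
    moreover have "(\<lambda>r. r *\<^sub>R er q) = (\<lambda>r. S r q)"
      by (simp add: fun_eq_iff S_def spherical_def er_def vec_eq_iff forall_3)
    ultimately have "((\<lambda>r. S r q) has_derivative (\<lambda>h. h *\<^sub>R er q)) (at r within A)"
      by (simp add: has_vector_derivative_def)
    from has_derivative_compose[OF this du]
    show ?thesis by (simp add: has_vector_derivative_def F_def Fr_def mult.commute)
  qed
  have dq: "((\<lambda>q. F r q) has_vector_derivative Fq r q) (at q within A)" for r q A
  proof -
    have "((\<lambda>q. S r q) has_vector_derivative ep r q) (at q within A)"
      unfolding S_def spherical_def ep_def vector_3_eq_axis by (auto intro!: derivative_eq_intros simp: mult.commute)
    then have "((\<lambda>q. S r q) has_derivative (\<lambda>h. h *\<^sub>R ep r q)) (at q within A)"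
      by (simp add: has_vector_derivative_def)
    from has_derivative_compose[OF this du]
    show ?thesis by (simp add: has_vector_derivative_def F_def Fq_def mult.commute)
  qed
  \<comment> \<open>The derivatives of \<open>u\<close> along the coordinate fields at azimuth
    \<open>t\<close> are derivatives of functions that coincide with \<open>F\<close> by symmetry;
    uniqueness of the derivative identifies them with \<open>Fr\<close> and
    \<open>Fq\<close>.\<close>
  have loc: "rho (spherical r (pi / 2 + q) t) = r \<and> phi (spherical r (pi / 2 + q) t) = pi / 2 + q \<and> theta (spherical r (pi / 2 + q) t) = t
      \<and> u (spherical r (pi / 2 + q) t) = F r q \<and> V (spherical r (pi / 2 + q) t) \<bullet> coord_rho (spherical r (pi / 2 + q) t) = Fr r q
      \<and> V (spherical r (pi / 2 + q) t) \<bullet> coord_phi (spherical r (pi / 2 + q) t) = Fq r q"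
    if "a < r" "r < b" "-\<beta> < q" "q < \<beta>" "0 < t" "t < 2 * pi" for r q t
  proof -
    define x where "x = spherical r (pi / 2 + q) t"
    have 1: "rho x = r" "phi x = pi / 2 + q" "theta x = t"
      unfolding x_def using that a \<beta> by (auto intro!: rho_spherical phi_spherical theta_spherical)
    have x: "spherical (rho x) (phi x) (theta x) = x"
      unfolding 1 by (rule x_def[symmetric])
    have "((\<lambda>r. u (spherical r (phi x) (theta x))) has_derivative (\<lambda>h. V x \<bullet> (h *\<^sub>R coord_rho x))) (at (rho x))"
      using has_derivative_compose[OF coord_rho_is_derivative[of x, unfolded has_vector_derivative_def] du] x by simp
    moreover have "(\<lambda>r. u (spherical r (phi x) (theta x))) = (\<lambda>r. F r q)"
      unfolding F_def S_def 1 by (rule ext, rule axi)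
    ultimately have "((\<lambda>r. F r q) has_vector_derivative (V x \<bullet> coord_rho x)) (at r)"
      by (simp add: has_vector_derivative_def 1 mult.commute)
    from vector_derivative_unique_at[OF this dr] have 2: "V x \<bullet> coord_rho x = Fr r q" .
    have "((\<lambda>p. u (spherical (rho x) p (theta x))) has_derivative (\<lambda>h. V x \<bullet> (h *\<^sub>R coord_phi x))) (at (phi x))"
      using has_derivative_compose[OF coord_phi_is_derivative[of x, unfolded has_vector_derivative_def] du] x by simp
    then have D: "((\<lambda>p. u (spherical r p 0)) has_derivative (\<lambda>h. h * (V x \<bullet> coord_phi x))) (at (pi / 2 + q))"
      by (simp add: axi[of _ _ t] 1)
    have "((\<lambda>q. pi / 2 + q) has_derivative (\<lambda>h. h)) (at q)" by (auto intro!: derivative_eq_intros)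
    from has_derivative_compose[OF this D]
    have "((\<lambda>q. F r q) has_vector_derivative (V x \<bullet> coord_phi x)) (at q)"
      by (simp add: has_vector_derivative_def F_def S_def)
    from vector_derivative_unique_at[OF this dq] have 3: "V x \<bullet> coord_phi x = Fq r q" .
    have 4: "u x = F r q" unfolding x_def F_def S_def by (rule axi)
    show ?thesis using 1 2 3 4 unfolding x_def by blast
  qed
  have rpos: "r \<noteq> 0" if "r \<in> {a..b}" for r using that a by auto
  have cI: "integral {a..b} (\<lambda>r. integral {-\<beta>..\<beta>} (\<lambda>q. G r q)) = integral {a..b} (\<lambda>r. integral {-\<beta>..\<beta>} (\<lambda>q. G' r q))"
    if "\<And>r q. r \<in> {a..b} \<Longrightarrow> q \<in> {-\<beta>..\<beta>} \<Longrightarrow> G r q = G' r q" for G G' :: "real \<Rightarrow> real \<Rightarrow> real"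
    using that by (intro integral_cong) auto
  have I1: "(LINT x|lebesgue_on ?W. (u x)\<^sup>2 / (rho x)\<^sup>2) = 2 * pi * integral {a..b} (\<lambda>r. integral {-\<beta>..\<beta>} (\<lambda>q. (F r q)\<^sup>2 * cos q))"
  proof -
    have "(LINT x|lebesgue_on ?W. (u x)\<^sup>2 / (rho x)\<^sup>2) = 2 * pi * integral {a..b} (\<lambda>r. integral {-\<beta>..\<beta>} (\<lambda>q. (F r q)\<^sup>2 / r\<^sup>2 * (r\<^sup>2 * cos q)))"
      by (rule spherical_integral(2)[OF ab \<beta>(1) \<beta>2]) (use loc rpos in \<open>auto intro!: continuous_intros cF\<close>)
    also have "\<dots> = 2 * pi * integral {a..b} (\<lambda>r. integral {-\<beta>..\<beta>} (\<lambda>q. (F r q)\<^sup>2 * cos q))"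
      by (intro arg_cong[where f = "(*) (2 * pi)"] cI) (use rpos in auto)
    finally show ?thesis .
  qed
  have I2: "(LINT x|lebesgue_on ?W. (V x \<bullet> coord_rho x)\<^sup>2) = 2 * pi * integral {a..b} (\<lambda>r. integral {-\<beta>..\<beta>} (\<lambda>q. (r * Fr r q)\<^sup>2 * cos q))"
  proof -
    have "(LINT x|lebesgue_on ?W. (V x \<bullet> coord_rho x)\<^sup>2) = 2 * pi * integral {a..b} (\<lambda>r. integral {-\<beta>..\<beta>} (\<lambda>q. (Fr r q)\<^sup>2 * (r\<^sup>2 * cos q)))"
      by (rule spherical_integral(2)[OF ab \<beta>(1) \<beta>2]) (use loc in \<open>auto intro!: continuous_intros cFr\<close>)
    also have "\<dots> = 2 * pi * integral {a..b} (\<lambda>r. integral {-\<beta>..\<beta>} (\<lambda>q. (r * Fr r q)\<^sup>2 * cos q))"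
      by (intro arg_cong[where f = "(*) (2 * pi)"] cI) (simp add: power_mult_distrib)
    finally show ?thesis .
  qed
  have I3: "(LINT x|lebesgue_on ?W. 1 / (rho x)\<^sup>2 * (V x \<bullet> coord_phi x)\<^sup>2) = 2 * pi * integral {a..b} (\<lambda>r. integral {-\<beta>..\<beta>} (\<lambda>q. (Fq r q)\<^sup>2 * cos q))"
  proof -
    have "(LINT x|lebesgue_on ?W. 1 / (rho x)\<^sup>2 * (V x \<bullet> coord_phi x)\<^sup>2) = 2 * pi * integral {a..b} (\<lambda>r. integral {-\<beta>..\<beta>} (\<lambda>q. 1 / r\<^sup>2 * (Fq r q)\<^sup>2 * (r\<^sup>2 * cos q)))"
      by (rule spherical_integral(2)[OF ab \<beta>(1) \<beta>2]) (use loc rpos in \<open>auto intro!: continuous_intros cFq\<close>)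
    also have "\<dots> = 2 * pi * integral {a..b} (\<lambda>r. integral {-\<beta>..\<beta>} (\<lambda>q. (Fq r q)\<^sup>2 * cos q))"
      by (intro arg_cong[where f = "(*) (2 * pi)"] cI) (use rpos in auto)
    finally show ?thesis .
  qed
  \<comment> \<open>The weight \<open>r ^ (1 + j) * cos q\<close> times the Jacobian
    \<open>r\<^sup>2 * cos q\<close> produces the exponent \<open>3 + j\<close> and the squared
    cosine on which the rectangle inequality is built.\<close>
  have I4: "(LINT x|lebesgue_on ?W. rho x ^ (1 + j) * sin (phi x) * u x) = 2 * pi * integral {a..b} (\<lambda>r. integral {-\<beta>..\<beta>} (\<lambda>q. r ^ (3 + j) * F r q * (cos q)\<^sup>2))"
  proof -
    have "(LINT x|lebesgue_on ?W. rho x ^ (1 + j) * sin (phi x) * u x) = 2 * pi * integral {a..b} (\<lambda>r. integral {-\<beta>..\<beta>} (\<lambda>q. r ^ (1 + j) * cos q * F r q * (r\<^sup>2 * cos q)))"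
      by (rule spherical_integral(2)[OF ab \<beta>(1) \<beta>2]) (use loc in \<open>auto intro!: continuous_intros cF simp: sin_add\<close>)
    also have "\<dots> = 2 * pi * integral {a..b} (\<lambda>r. integral {-\<beta>..\<beta>} (\<lambda>q. r ^ (3 + j) * F r q * (cos q)\<^sup>2))"
      by (intro arg_cong[where f = "(*) (2 * pi)"] cI) (simp add: power2_eq_square power_add eval_nat_numeral algebra_simps)
    finally show ?thesis .
  qed
  have "integral {a..b} (\<lambda>r. integral {-\<beta>..\<beta>} (\<lambda>q. (F r q)\<^sup>2 * cos q))
    \<le> 8 / sqrt 3 * integral {a..b} (\<lambda>r. integral {-\<beta>..\<beta>} (\<lambda>q. (r * Fr r q)\<^sup>2 * cos q))
      + 1 / (5 * sqrt 3) * integral {a..b} (\<lambda>r. integral {-\<beta>..\<beta>} (\<lambda>q. (Fq r q)\<^sup>2 * cos q))"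
    (is "?X \<le> _ * ?Y + _ * ?Z")
    by (rule hardy_poincare_rectangle[OF a _ \<beta> dr dq cF cFr cFq, of "3 + j"]) (use I4 zero in auto)
  then have "2 * pi * ?X \<le> 2 * pi * (8 / sqrt 3 * ?Y + 1 / (5 * sqrt 3) * ?Z)"
    by (intro mult_left_mono) auto
  then show ?thesis unfolding dirichlet_def I1 I2 I3 by (simp add: algebra_simps)
qed

section \<open>Square integrable functions on subdomains\<close>

lemma L2_imp_L2_extend:
  fixes h :: "'a::euclidean_space \<Rightarrow> real"
  assumes \<Omega>: "open \<Omega>" and h: "L2 \<Omega> h"
  shows "(\<lambda>x. indicator \<Omega> x * h x) \<in> borel_measurable lebesgue"
    "integrable lebesgue (\<lambda>x. (indicator \<Omega> x * h x)\<^sup>2)"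
proof -
  have \<Omega>L: "\<Omega> \<inter> space lebesgue \<in> sets lebesgue" using \<Omega> by simp
  show "(\<lambda>x. indicator \<Omega> x * h x) \<in> borel_measurable lebesgue"
    using h borel_measurable_restrict_space_iff[OF \<Omega>L, of h] by (simp add: L2_def)
  have "integrable lebesgue (\<lambda>x. indicator \<Omega> x *\<^sub>R (h x)\<^sup>2)"
    using h integrable_restrict_space[OF \<Omega>L, of "\<lambda>x. (h x)\<^sup>2"] by (simp add: L2_def)
  moreover have "indicator \<Omega> x *\<^sub>R (h x)\<^sup>2 = (indicator \<Omega> x * h x)\<^sup>2" for x
    by (simp add: indicator_def)
  ultimately show "integrable lebesgue (\<lambda>x. (indicator \<Omega> x * h x)\<^sup>2)" by simp
qed

lemma L2_on_restrict:
  assumes "W \<in> sets lebesgue" "L2_on lebesgue h"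
  shows "L2_on (lebesgue_on W) h" "(LINT x|lebesgue_on W. (h x)\<^sup>2) \<le> (LINT x|lebesgue. (h x)\<^sup>2)"
proof -
  have i: "integrable lebesgue (\<lambda>x. indicator W x *\<^sub>R (h x)\<^sup>2)"
    using assms by (intro integrable_mult_indicator L2_onD)
  then show "L2_on (lebesgue_on W) h"
    using assms by (auto simp: L2_on_def integrable_restrict_space measurable_restrict_space1)
  have "(LINT x|lebesgue_on W. (h x)\<^sup>2) = (LINT x|lebesgue. indicator W x *\<^sub>R (h x)\<^sup>2)"
    using assms by (simp add: integral_restrict_space)
  also have "\<dots> \<le> (LINT x|lebesgue. (h x)\<^sup>2)"
    using i assms by (intro integral_mono L2_onD) (auto simp: indicator_def)
  finally show "(LINT x|lebesgue_on W. (h x)\<^sup>2) \<le> (LINT x|lebesgue. (h x)\<^sup>2)" .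
qed

lemma L2_on_cong: "(\<And>x. x \<in> space M \<Longrightarrow> f x = g x) \<Longrightarrow> L2_on M f = L2_on M g"
  unfolding L2_on_def by (metis (mono_tags, lifting) Bochner_Integration.integrable_cong measurable_cong)

text \<open>Mollification converges for functions extended to the whole space, while the identities
  for the mollified gradient hold only on \<open>W\<close>. The lemma exchanges the functions
  there.\<close>

lemma L2_lim_restrict:
  assumes W: "W \<in> sets lebesgue" and w: "L2_on lebesgue w" and ws: "\<And>n. L2_on lebesgue (ws n)"
    and small: "\<And>n. (LINT x|lebesgue. (ws n x - w x)\<^sup>2) < 1 / real (Suc n)"
    and h: "\<And>x. x \<in> W \<Longrightarrow> w x = h x" and hs: "\<And>n x. x \<in> W \<Longrightarrow> ws n x = hs n x"
  shows "L2_lim (lebesgue_on W) hs h"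
  unfolding L2_lim_def
proof (intro conjI allI)
  show "L2_on (lebesgue_on W) (hs n)" for n
    using L2_on_restrict(1)[OF W ws[of n]] L2_on_cong[of "lebesgue_on W" "ws n" "hs n"] hs by simp
  show "L2_on (lebesgue_on W) h"
    using L2_on_restrict(1)[OF W w] L2_on_cong[of "lebesgue_on W" w h] h by simp
  have "(LINT x|lebesgue_on W. (hs n x - h x)\<^sup>2) \<le> 1 / real (Suc n)" for n
  proof -
    have "(LINT x|lebesgue_on W. (hs n x - h x)\<^sup>2) = (LINT x|lebesgue_on W. (ws n x - w x)\<^sup>2)"
      by (rule Bochner_Integration.integral_cong) (auto simp: h hs)
    also have "\<dots> \<le> (LINT x|lebesgue. (ws n x - w x)\<^sup>2)"
      by (rule L2_on_restrict(2)[OF W L2_on_diff[OF ws w]])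
    finally show ?thesis using small[of n] by linarith
  qed
  then show "(\<lambda>n. LINT x|lebesgue_on W. (hs n x - h x)\<^sup>2) \<longlonglongrightarrow> 0"
    by (intro tendsto_sandwich[OF _ _ tendsto_const LIMSEQ_inverse_real_of_nat])
      (auto simp: inverse_eq_divide)
qed

text \<open>The exceptional null set has to be avoided at \<open>x\<close> and at
  \<open>rot t x\<close>. The points that violate the latter form the image of a null set under the
  inverse rotation, which is again null.\<close>

lemma axisymmetric_extension_rot:
  assumes \<Omega>: "\<Omega> = wedge a b \<beta>" "0 \<le> a" and f: "axisymmetric_on \<Omega> f"
  shows "AE x in lebesgue. indicator \<Omega> (rot t x) * f (rot t x) = indicator \<Omega> x * f x"
proof -
  obtain h where h: "AE x in lebesgue_on \<Omega>. f x = h (rho x) (phi x)"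
    using f by (auto simp: axisymmetric_on_def)
  have \<Omega>L: "\<Omega> \<inter> space lebesgue \<in> sets lebesgue" using \<Omega> open_wedge by simp
  have ae: "AE x in lebesgue. x \<in> \<Omega> \<longrightarrow> f x = h (rho x) (phi x)"
    using h AE_restrict_space_iff[OF \<Omega>L] by simp
  then obtain N where N: "{x. \<not> (x \<in> \<Omega> \<longrightarrow> f x = h (rho x) (phi x))} \<subseteq> N" "N \<in> null_sets lebesgue"
    by (auto elim!: AE_E simp: null_sets_def)
  have "negligible (rot (- t) ` N)"
    using N(2) orthogonal_transformation_linear[OF orthogonal_transformation_rot]
    by (intro negligible_differentiable_image_negligible)
      (auto simp: negligible_iff_null_sets intro: linear_imp_differentiable_on)
  then have "AE x in lebesgue. x \<notin> rot (- t) ` N"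
    by (intro AE_not_in) (simp add: negligible_iff_null_sets)
  then have "AE x in lebesgue. rot t x \<notin> N"
    by eventually_elim (metis image_eqI rot_minus)
  with ae show ?thesis
  proof eventually_elim
    case (elim x)
    have "rot t x \<in> \<Omega> \<longleftrightarrow> x \<in> \<Omega>" using \<Omega> rot_wedge by simp
    moreover have "rot t x \<in> \<Omega> \<longrightarrow> f (rot t x) = h (rho x) (phi x)"
      using elim(2) N(1) by (auto simp: rho_rot phi_rot)
    ultimately show ?case using elim(1) by (auto simp: indicator_def)
  qed
qed

lemma L2_on_wedge_one:
  assumes "0 \<le> a"
  shows "L2_on (lebesgue_on (wedge a b \<beta>)) (\<lambda>x. 1)"
proof -
  have "bounded (wedge a b \<beta>)"
    by (rule bounded_subset[OF bounded_cball[of 0 b]]) (auto simp: wedge_def rho_def)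
  then have "wedge a b \<beta> \<in> lmeasurable" using open_wedge[OF assms] by (rule lmeasurable_open)
  then show ?thesis
    using open_wedge[OF assms] by (simp add: L2_on_def integrable_restrict_space fmeasurable_def)
qed

lemma L2_on_wedge_weight:
  assumes "0 \<le> a" "\<beta> \<le> pi / 2"
  shows "L2_on (lebesgue_on (wedge a b \<beta>)) (\<lambda>x. rho x ^ n * sin (phi x))"
proof -
  have "(\<lambda>x. rho x ^ n * sin (phi x)) \<in> borel_measurable (lebesgue_on (wedge a b \<beta>))"
    unfolding rho_def using assms
    by (intro continuous_on_imp_measurable_lebesgue_on open_wedge continuous_intros continuous_on_coord)
  moreover have "\<bar>rho x ^ n * sin (phi x)\<bar> \<le> b ^ n * 1" if "x \<in> wedge a b \<beta>" for x
  proof -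
    have "\<bar>rho x\<bar> \<le> b" using that by (simp add: wedge_def rho_def)
    moreover from this have "0 \<le> b" by linarith
    ultimately show ?thesis unfolding abs_mult power_abs by (intro mult_mono power_mono) auto
  qed
  ultimately show ?thesis
    using L2_on_mult_bounded(1)[OF L2_on_wedge_one[OF assms(1)], of "\<lambda>x. rho x ^ n * sin (phi x)" b \<beta> "b ^ n * 1"]
    by simp
qed

lemma inverse_rho_wedge:
  assumes "0 < a"
  shows "(\<lambda>x. inverse (rho x)) \<in> borel_measurable (lebesgue_on (wedge a b \<beta>))"
    "x \<in> space (lebesgue_on (wedge a b \<beta>)) \<Longrightarrow> \<bar>inverse (rho x)\<bar> \<le> inverse a"
proof -
  have "continuous_on (wedge a b \<beta>) (\<lambda>x. inverse (rho x))"
    unfolding rho_def using wedge_nonzero[of a _ b \<beta>] assms by (intro continuous_intros) auto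
  then show "(\<lambda>x. inverse (rho x)) \<in> borel_measurable (lebesgue_on (wedge a b \<beta>))"
    using assms by (intro continuous_on_imp_measurable_lebesgue_on open_wedge) auto
  show "\<bar>inverse (rho x)\<bar> \<le> inverse a" if "x \<in> space (lebesgue_on (wedge a b \<beta>))"
    using that assms by (auto simp: wedge_def intro!: le_imp_inverse_le)
qed

text \<open>Expansion in the standard basis reduces the claim to components times bounded continuous
  factors: the fields have norm 1 and \<open>rho\<close>, and \<open>inverse (rho x)\<close> is
  bounded since \<open>0 < a\<close>.\<close>

lemma L2_lim_coord:
  assumes a: "0 < a" and \<beta>: "\<beta> \<le> pi / 2"
    and g: "\<And>c. c \<in> Basis \<Longrightarrow> L2_lim (lebesgue_on (wedge a b \<beta>)) (\<lambda>n x. V n x \<bullet> c) (\<lambda>x. g x \<bullet> c)"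
  shows "L2_lim (lebesgue_on (wedge a b \<beta>)) (\<lambda>n x. V n x \<bullet> coord_rho x) (\<lambda>x. g x \<bullet> coord_rho x)"
    "L2_lim (lebesgue_on (wedge a b \<beta>)) (\<lambda>n x. inverse (rho x) * (V n x \<bullet> coord_phi x)) (\<lambda>x. inverse (rho x) * (g x \<bullet> coord_phi x))"
proof -
  let ?M = "lebesgue_on (wedge a b \<beta>)"
  have a': "0 \<le> a" using a by simp
  have lim: "L2_lim ?M (\<lambda>n x. V n x \<bullet> e x) (\<lambda>x. g x \<bullet> e x)"
    if e: "continuous_on (wedge a b \<beta>) e" "\<And>x. x \<in> wedge a b \<beta> \<Longrightarrow> norm (e x) \<le> C" for e C
  proof -
    have "L2_lim ?M (\<lambda>n x. \<Sum>c\<in>Basis. (e x \<bullet> c) * (V n x \<bullet> c)) (\<lambda>x. \<Sum>c\<in>Basis. (e x \<bullet> c) * (g x \<bullet> c))"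
    proof (rule L2_lim_sum[OF finite_Basis], rule L2_lim_mult_bounded[OF g])
      fix c :: "real^3" assume c: "c \<in> Basis"
      show "(\<lambda>x. e x \<bullet> c) \<in> borel_measurable ?M"
        using e(1) by (intro continuous_on_imp_measurable_lebesgue_on open_wedge a' continuous_intros)
      show "\<bar>e x \<bullet> c\<bar> \<le> C" if "x \<in> space ?M" for x
        using Basis_le_norm[OF c, of "e x"] e(2)[of x] that by simp
    qed
    moreover have "(\<Sum>c\<in>Basis. (v \<bullet> c) * (w \<bullet> c)) = w \<bullet> v" for v w :: "real^3"
      by (simp add: euclidean_inner[of w v] mult.commute)
    ultimately show ?thesis by simp
  qed
  show "L2_lim ?M (\<lambda>n x. V n x \<bullet> coord_rho x) (\<lambda>x. g x \<bullet> coord_rho x)"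
    by (rule lim[of _ 1, OF continuous_on_coord(1)[OF a' \<beta>]]) (simp add: norm_coord_rho)
  have "L2_lim ?M (\<lambda>n x. V n x \<bullet> coord_phi x) (\<lambda>x. g x \<bullet> coord_phi x)"
    by (rule lim[of _ b, OF continuous_on_coord(2)[OF a' \<beta>]]) (auto simp: norm_coord_phi wedge_def)
  then show "L2_lim ?M (\<lambda>n x. inverse (rho x) * (V n x \<bullet> coord_phi x)) (\<lambda>x. inverse (rho x) * (g x \<bullet> coord_phi x))"
    by (rule L2_lim_mult_bounded[OF _ inverse_rho_wedge[OF a]])
qed

text \<open>On the smaller wedge the gradient of the mollified function is the mollified weak
  gradient, so both sides of the smooth inequality converge. Extension by 0 may create jumps at the
  boundary of the larger wedge, but they stay beyond the reach of the kernels.\<close>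

lemma wedge_inequality_weak:
  fixes f :: "real^3 \<Rightarrow> real" and g :: "real^3 \<Rightarrow> real^3"
  assumes a: "0 \<le> a0" "a0 < a" "2 * a \<le> b" "b < b0" and \<beta>: "0 < \<beta>" "\<beta> < \<beta>0" "\<beta>0 \<le> pi / 6"
    and f: "L2 (wedge a0 b0 \<beta>0) f" "has_weak_gradient (wedge a0 b0 \<beta>0) f g"
    and g2: "\<And>b. b \<in> Basis \<Longrightarrow> L2 (wedge a0 b0 \<beta>0) (\<lambda>x. g x \<bullet> b)"
    and axi: "axisymmetric_on (wedge a0 b0 \<beta>0) f"
    and Z: "0 < (LINT x|lebesgue_on (wedge a b \<beta>). rho x ^ (1 + j) * sin (phi x))"
    and \<kappa>: "\<kappa> = (LINT x|lebesgue_on (wedge a b \<beta>). rho x ^ (1 + j) * sin (phi x) * f x)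
       / (LINT x|lebesgue_on (wedge a b \<beta>). rho x ^ (1 + j) * sin (phi x))"
  shows "(LINT x|lebesgue_on (wedge a b \<beta>). (f x - \<kappa>)\<^sup>2 / (rho x)\<^sup>2) \<le> dirichlet (wedge a b \<beta>) g"
proof -
  define \<Omega> where "\<Omega> = wedge a0 b0 \<beta>0"
  define W where "W = wedge a b \<beta>"
  define \<omega> where "\<omega> x = rho x ^ (1 + j) * sin (phi x)" for x
  let ?M = "lebesgue_on W"
  have a': "0 < a" "0 \<le> a" and \<beta>': "\<beta> \<le> pi / 2" "\<beta> < pi / 6" using a \<beta> by auto
  have \<Omega>: "open \<Omega>" unfolding \<Omega>_def by (rule open_wedge[OF a(1)])
  have "open W" unfolding W_def by (rule open_wedge[OF a'(2)])
  then have W: "W \<in> sets lebesgue" by simp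
  have W\<Omega>: "x \<in> \<Omega>" if "x \<in> W" for x using that a \<beta> by (auto simp: W_def \<Omega>_def wedge_def)
  obtain \<epsilon> where \<epsilon>: "0 < \<epsilon>" "\<And>x. x \<in> W \<Longrightarrow> cball x \<epsilon> \<subseteq> \<Omega>"
    using wedge_compact_inclusion[OF a(1,2,4) \<beta>(2)] unfolding W_def \<Omega>_def by metis
  define ext where "ext h = (\<lambda>x. indicator \<Omega> x * h x)" for h :: "real^3 \<Rightarrow> real"
  have supp: "ext h x = 0" if "b0 < norm x" for h x
    using that by (auto simp: ext_def \<Omega>_def wedge_def rho_def)
  have ext2: "ext h \<in> borel_measurable lebesgue" "integrable lebesgue (\<lambda>x. (ext h x)\<^sup>2)" if "L2 \<Omega> h" for h
    using L2_imp_L2_extend[OF \<Omega> that] by (auto simp: ext_def)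
  have ext1: "integrable lebesgue (ext h)" if "L2 \<Omega> h" for h
    by (rule integrable_of_square_bounded_support[OF ext2[OF that] supp])
  have f2: "L2 \<Omega> f" and fg: "has_weak_gradient \<Omega> f g" using f by (auto simp: \<Omega>_def)
  have gb2: "L2 \<Omega> (\<lambda>x. g x \<bullet> b)" if "b \<in> Basis" for b using g2[OF that] by (simp add: \<Omega>_def)
  define near where "near h n k \<longleftrightarrow> (LINT x|lebesgue. (conv (ext h) k x - ext h x)\<^sup>2) < 1 / real (Suc n)"
    for h k and n :: nat
  define thresh where "thresh h n e0 \<longleftrightarrow> 0 < e0 \<and> (\<forall>k e. mollifier_kernel k e \<longrightarrow> e < e0 \<longrightarrow> near h n k)"
    for h n e0
  \<comment> \<open>One kernel must serve \<open>f\<close> and every component of its gradient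
    simultaneously, be radial, and have its support within the distance
    \<open>\<epsilon>\<close>.\<close>
  define good where "good n k e \<longleftrightarrow> mollifier_kernel k e \<and> e \<le> \<epsilon> \<and> (\<forall>x y. norm x = norm y \<longrightarrow> k x = k y) \<and>
      near f n k \<and> (\<forall>b\<in>Basis. near (\<lambda>x. g x \<bullet> b) n k)" for n k e
  have ex: "\<exists>k e. good n k e" for n
  proof -
    have small: "\<exists>e0. thresh h n e0" if hL: "L2 \<Omega> h" for h
    proof -
      obtain e0 where "0 < e0" "\<And>k e. mollifier_kernel k e \<Longrightarrow> e < e0 \<Longrightarrow>
         integrable lebesgue (\<lambda>x. (conv (ext h) k x - ext h x)\<^sup>2) \<and> (LINT x|lebesgue. (conv (ext h) k x - ext h x)\<^sup>2) < 1 / real (Suc n)"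
        by (rule mollify_L2[OF ext2[OF hL] supp, where \<delta> = "1 / real (Suc n)"]) auto
      then show ?thesis unfolding thresh_def near_def by blast
    qed
    obtain e1 where e1: "thresh f n e1" using small[OF f2] by blast
    obtain eb where eb: "\<And>b. b \<in> Basis \<Longrightarrow> thresh (\<lambda>x. g x \<bullet> b) n (eb b)" using small[OF gb2] by metis
    \<comment> \<open>Half of the minimum lies strictly below every threshold, as
      \<open>thresh\<close> demands.\<close>
    define e where "e = Min (insert \<epsilon> (insert e1 (eb ` Basis))) / 2"
    have fin: "finite (insert \<epsilon> (insert e1 (eb ` Basis)))" by simp
    have "0 < Min (insert \<epsilon> (insert e1 (eb ` Basis)))"
      using \<epsilon>(1) e1 eb by (subst Min_gr_iff) (auto simp: thresh_def)
    then have e: "0 < e" "e < Min (insert \<epsilon> (insert e1 (eb ` Basis)))" unfolding e_def by linarith+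
    have le: "e < y" if "y \<in> insert \<epsilon> (insert e1 (eb ` Basis))" for y
      using e(2) Min_le[OF fin that] by linarith
    obtain k :: "real^3 \<Rightarrow> real" where k: "mollifier_kernel k e" "\<And>x y. norm x = norm y \<Longrightarrow> k x = k y"
      using mollifier_kernel_exists[OF e(1)] by metis
    have "e < \<epsilon>" "e < e1" by (rule le, simp)+
    moreover have "e < eb b" if "b \<in> Basis" for b using that by (intro le) simp
    ultimately have "good n k e"
      using k e1 eb unfolding good_def thresh_def by (metis less_imp_le)
    then show ?thesis by blast
  qed
  then obtain k e where ke: "\<And>n. good n (k n) (e n)" by metis
  have k: "mollifier_kernel (k n) (e n)" and e: "e n \<le> \<epsilon>"
    and rad: "norm x = norm y \<Longrightarrow> k n x = k n y"
    and kf: "(LINT x|lebesgue. (conv (ext f) (k n) x - ext f x)\<^sup>2) < 1 / real (Suc n)"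
    and kg: "b \<in> Basis \<Longrightarrow> (LINT x|lebesgue. (conv (ext (\<lambda>x. g x \<bullet> b)) (k n) x - ext (\<lambda>x. g x \<bullet> b) x)\<^sup>2) < 1 / real (Suc n)"
    for n x y b
    using ke[of n] unfolding good_def near_def by blast+
  define u where "u n = conv (ext f) (k n)" for n
  define V where "V n x = (\<Sum>b\<in>Basis. conv (ext f) (\<lambda>y. frechet_derivative (k n) (at y) b) x *\<^sub>R b)" for n x
  have du: "(u n has_derivative (\<lambda>h. V n x \<bullet> h)) (at x)" for n x
  proof -
    have "(\<lambda>h. \<Sum>b\<in>Basis. (h \<bullet> b) * conv (ext f) (\<lambda>y. frechet_derivative (k n) (at y) b) x) = (\<lambda>h. V n x \<bullet> h)"
      by (simp add: V_def inner_commute[of "sum f A" for f A] inner_sum_right mult.commute)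
    then show ?thesis
      using mollifier_kernel.conv_has_derivative[OF k ext1[OF f2], of n x] by (simp add: u_def)
  qed
  have cV: "continuous_on UNIV (V n)" for n
    unfolding V_def
    by (intro continuous_intros continuous_on_conv[OF ext1[OF f2]]
      mollifier_kernel.partial_continuous[OF k] mollifier_kernel.partial_support[OF k])
  have axu: "u n (spherical r p t) = u n (spherical r p 0)" for n r p t
  proof -
    have "AE y in lebesgue. ext f (rot t y) = ext f y"
      using axisymmetric_extension_rot[OF \<Omega>_def a(1)] axi unfolding ext_def \<Omega>_def by blast
    from conv_orthogonal_transformation[OF orthogonal_transformation_rot ext1[OF f2] this k rad]
    show ?thesis unfolding u_def by (subst spherical_rot) simp
  qed
  have Vb: "V n x \<bullet> b = conv (ext (\<lambda>x. g x \<bullet> b)) (k n) x" if "x \<in> W" "b \<in> Basis" for n x b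
  proof -
    have "V n x \<bullet> b = conv (ext f) (\<lambda>y. frechet_derivative (k n) (at y) b) x"
      using that(2) by (simp add: V_def inner_sum_left_Basis)
    also have "\<dots> = conv (ext (\<lambda>x. g x \<bullet> b)) (k n) x"
      unfolding ext_def
    proof (rule conv_weak_gradient[OF \<Omega> fg k _ that(2)])
      show "cball x (e n) \<subseteq> \<Omega>" using \<epsilon>(2)[OF that(1)] e[of n] by (meson order_trans subset_cball)
    qed
    finally show ?thesis .
  qed
  have cL2: "L2_on lebesgue (conv (ext h) (k n))" if "L2 \<Omega> h" for h n
    unfolding L2_on_def
    using mollifier_kernel.conv_L2_le(1)[OF k ext1[OF that] ext2(2)[OF that]]
      continuous_measurable_lebesgue[OF continuous_on_conv[OF ext1[OF that] mollifier_kernel.k_continuous[OF k] mollifier_kernel.support[OF k]]]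
    by blast
  have eL2: "L2_on lebesgue (ext h)" if "L2 \<Omega> h" for h
    using ext2[OF that] by (simp add: L2_on_def)
  have extW: "ext h x = h x" if "x \<in> W" for h x using W\<Omega>[OF that] by (simp add: ext_def)
  have lu: "L2_lim ?M u f"
    by (rule L2_lim_restrict[OF W eL2[OF f2] cL2[OF f2] kf]) (auto simp: extW u_def)
  have lV: "L2_lim ?M (\<lambda>n x. V n x \<bullet> b) (\<lambda>x. g x \<bullet> b)" if "b \<in> Basis" for b
    by (rule L2_lim_restrict[OF W eL2[OF gb2[OF that]] cL2[OF gb2[OF that]] kg[OF that]]) (auto simp: extW Vb that)
  note one = L2_on_wedge_one[OF a'(2), where b = b and \<beta> = \<beta>, folded W_def]
  have \<omega>2: "L2_on ?M \<omega>"
    unfolding \<omega>_def[abs_def] W_def by (rule L2_on_wedge_weight[OF a'(2) \<beta>'(1)])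
  define Z0 where "Z0 = (LINT x|?M. \<omega> x)"
  have Z0: "0 < Z0" using Z by (simp add: Z0_def W_def \<omega>_def)
  \<comment> \<open>Every approximant gets its own constant, which makes its weighted integral over
    \<open>W\<close> exactly 0 without changing its gradient. These constants converge to
    \<open>\<kappa>\<close>.\<close>
  define \<kappa>s where "\<kappa>s n = (LINT x|?M. \<omega> x * u n x) / Z0" for n
  have \<kappa>': "\<kappa> = (LINT x|?M. \<omega> x * f x) / Z0" by (simp add: \<kappa> Z0_def W_def \<omega>_def)
  have l\<kappa>: "(\<lambda>n. - \<kappa>s n) \<longlonglongrightarrow> - \<kappa>"
    unfolding \<kappa>s_def \<kappa>' using Z0 by (intro tendsto_intros L2_lim_inner lu \<omega>2) auto
  have ineq: "(LINT x|?M. (u n x - \<kappa>s n)\<^sup>2 / (rho x)\<^sup>2) \<le> dirichlet W (V n)" for n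
    unfolding W_def
  proof (rule wedge_inequality_smooth[OF a'(1) a(3) \<beta>(1) \<beta>'(2) _ cV])
    show "((\<lambda>x. u n x - \<kappa>s n) has_derivative (\<lambda>h. V n x \<bullet> h)) (at x)" for x
      using has_derivative_diff[OF du has_derivative_const[of "\<kappa>s n"]] by simp
    show "u n (spherical r p t) - \<kappa>s n = u n (spherical r p 0) - \<kappa>s n" for r p t
      using axu[of n r p t] by simp
    have "(LINT x|?M. \<omega> x * (u n x - \<kappa>s n)) = (LINT x|?M. \<omega> x * u n x - \<kappa>s n * (\<omega> x * 1))"
      by (simp add: algebra_simps)
    also have "\<dots> = (LINT x|?M. \<omega> x * u n x) - \<kappa>s n * Z0"
      using integral_Cauchy_Schwarz(1)[OF L2_onD[OF \<omega>2] L2_onD[OF one]]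
        integral_Cauchy_Schwarz(1)[OF L2_onD[OF \<omega>2] L2_onD[OF L2_limD(1)[OF lu, of n]]]
      by (simp add: Z0_def)
    also have "\<dots> = 0" using Z0 by (simp add: \<kappa>s_def)
    finally show "(LINT x|lebesgue_on (wedge a b \<beta>). rho x ^ (1 + j) * sin (phi x) * (u n x - \<kappa>s n)) = 0"
      by (simp add: \<omega>_def W_def)
  qed
  have L1: "L2_lim ?M (\<lambda>n x. inverse (rho x) * (u n x + - \<kappa>s n * 1)) (\<lambda>x. inverse (rho x) * (f x + - \<kappa> * 1))"
    by (rule L2_lim_mult_bounded[OF L2_lim_add[OF lu L2_lim_scalar[OF l\<kappa> one]]
      inverse_rho_wedge[OF a'(1), where b = b and \<beta> = \<beta>, folded W_def]])
  note L2 = L2_lim_coord[OF a'(1) \<beta>'(1) lV[unfolded W_def], folded W_def]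
  have e1: "(inverse (rho x) * (y + - c * 1))\<^sup>2 = (y - c)\<^sup>2 / (rho x)\<^sup>2" for x y c
    by (simp add: power_mult_distrib power_inverse divide_inverse mult.commute)
  have e3: "(inverse (rho x) * y)\<^sup>2 = 1 / (rho x)\<^sup>2 * y\<^sup>2" for x y
    by (simp add: power_mult_distrib power_inverse divide_inverse)
  have "(LINT x|?M. (f x - \<kappa>)\<^sup>2 / (rho x)\<^sup>2) \<le> dirichlet W g"
  proof (rule LIMSEQ_le)
    show "(\<lambda>n. LINT x|?M. (u n x - \<kappa>s n)\<^sup>2 / (rho x)\<^sup>2) \<longlonglongrightarrow> (LINT x|?M. (f x - \<kappa>)\<^sup>2 / (rho x)\<^sup>2)"
      using L2_lim_square[OF L1] by (simp only: e1)
    show "(\<lambda>n. dirichlet W (V n)) \<longlonglongrightarrow> dirichlet W g"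
      using L2_lim_square[OF L2(1)] L2_lim_square[OF L2(2)] unfolding dirichlet_def e3 by (intro tendsto_intros)
    show "\<exists>N. \<forall>n\<ge>N. (LINT x|?M. (u n x - \<kappa>s n)\<^sup>2 / (rho x)\<^sup>2) \<le> dirichlet W (V n)"
      using ineq by blast
  qed
  then show ?thesis by (simp add: W_def)
qed

section \<open>Exhaustion of the domain\<close>

text \<open>Measurability of \<open>h'\<close> rests on the completeness of Lebesgue
  measure.\<close>

lemma L2_cong_AE:
  fixes h h' :: "'a::euclidean_space \<Rightarrow> real"
  assumes \<Omega>: "open \<Omega>" and h: "L2 \<Omega> h" and ae: "AE x in lebesgue_on \<Omega>. h x = h' x"
  shows "L2 \<Omega> h'"
proof -
  have \<Omega>L: "\<Omega> \<inter> space lebesgue \<in> sets lebesgue" using \<Omega> by simp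
  note ext = L2_imp_L2_extend[OF \<Omega> h]
  have ae': "AE x in lebesgue. indicator \<Omega> x * h x = indicator \<Omega> x * h' x"
    using ae unfolding AE_restrict_space_iff[OF \<Omega>L] by eventually_elim (auto simp: indicator_def)
  have m: "(\<lambda>x. indicator \<Omega> x * h' x) \<in> borel_measurable lebesgue"
    using borel_measurable_AE[OF ext(1) ae'] .
  have ae2: "AE x in lebesgue. (indicator \<Omega> x * h x)\<^sup>2 = (indicator \<Omega> x * h' x)\<^sup>2"
    using ae' by eventually_elim (simp only:)
  have "integrable lebesgue (\<lambda>x. (indicator \<Omega> x * h' x)\<^sup>2)"
    using integrable_cong_AE[OF _ _ ae2] ext m by simp
  moreover have "(indicator \<Omega> x * h' x)\<^sup>2 = indicator \<Omega> x *\<^sub>R (h' x)\<^sup>2" for x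
    by (simp add: indicator_def)
  ultimately show ?thesis
    using m borel_measurable_restrict_space_iff[OF \<Omega>L, of h'] integrable_restrict_space[OF \<Omega>L, of "\<lambda>x. (h' x)\<^sup>2"]
    by (simp add: L2_def)
qed

text \<open>A vanishing integral of the positive weight would make a nonempty open set negligible.
  The value is the denominator of the subtracted constants.\<close>

lemma wedge_weight_integral_pos:
  assumes a: "0 \<le> a" "a < b" and \<beta>: "0 < \<beta>" "\<beta> < pi / 2"
  shows "0 < (LINT x|lebesgue_on (wedge a b \<beta>). rho x ^ (1 + j) * sin (phi x))"
proof -
  let ?W = "wedge a b \<beta>"
  have W: "open ?W" by (rule open_wedge[OF a(1)])
  then have WL: "?W \<inter> space lebesgue \<in> sets lebesgue" by simp
  have i: "integrable (lebesgue_on ?W) (\<lambda>x. rho x ^ (1 + j) * sin (phi x))"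
  proof (rule spherical_integral(1)[OF a \<beta>])
    show "continuous_on ({a..b} \<times> {-\<beta>..\<beta>}) (\<lambda>z. (\<lambda>r q. r ^ (1 + j) * cos q) (fst z) (snd z))"
      by (intro continuous_intros)
    fix r q t assume "a < r" "r < b" "- \<beta> < q" "q < \<beta>" "0 < t" "t < 2 * pi"
    then show "rho (spherical r (pi / 2 + q) t) ^ (1 + j) * sin (phi (spherical r (pi / 2 + q) t)) = r ^ (1 + j) * cos q"
      using a \<beta> by (simp add: rho_spherical phi_spherical sin_add)
  qed
  have pos: "0 < rho x ^ (1 + j) * sin (phi x)" if "x \<in> ?W" for x
    using sin_phi_pos[OF that] \<beta> that a by (auto simp: wedge_def intro!: mult_pos_pos)
  have nn: "0 \<le> (LINT x|lebesgue_on ?W. rho x ^ (1 + j) * sin (phi x))"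
    using pos by (intro Bochner_Integration.integral_nonneg) (auto intro: less_imp_le)
  have "(LINT x|lebesgue_on ?W. rho x ^ (1 + j) * sin (phi x)) \<noteq> 0"
  proof
    assume "(LINT x|lebesgue_on ?W. rho x ^ (1 + j) * sin (phi x)) = 0"
    moreover have "AE x in lebesgue_on ?W. 0 \<le> rho x ^ (1 + j) * sin (phi x)"
      using pos by (intro AE_I2) (auto intro: less_imp_le)
    ultimately have "AE x in lebesgue_on ?W. rho x ^ (1 + j) * sin (phi x) = 0"
      using integral_nonneg_eq_0_iff_AE[OF i] by simp
    then have "AE x in lebesgue. x \<in> ?W \<longrightarrow> rho x ^ (1 + j) * sin (phi x) = 0"
      using AE_restrict_space_iff[OF WL] by simp
    then have "AE x in lebesgue. x \<notin> ?W"
      by eventually_elim (use pos in force)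
    then have "negligible ?W"
      using W by (simp add: negligible_iff_null_sets AE_iff_null_sets[symmetric])
    moreover have "spherical ((a + b) / 2) (pi / 2) 0 \<in> ?W"
      using a \<beta> by (simp add: wedge_def rho_spherical phi_spherical)
    ultimately show False using open_not_negligible[OF W] by auto
  qed
  then show ?thesis using nn by linarith
qed

lemma integral_exhaustion:
  fixes h :: "'a::euclidean_space \<Rightarrow> real"
  assumes \<Omega>: "open \<Omega>" and W: "\<And>n. open (W n)" "\<And>n. W n \<subseteq> \<Omega>"
    and ev: "\<And>x. x \<in> \<Omega> \<Longrightarrow> \<forall>\<^sub>F n in sequentially. x \<in> W n"
    and h: "integrable (lebesgue_on \<Omega>) h"
  shows "integrable (lebesgue_on (W n)) h" "(\<lambda>n. LINT x|lebesgue_on (W n). h x) \<longlonglongrightarrow> (LINT x|lebesgue_on \<Omega>. h x)"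
proof -
  have L: "U \<inter> space lebesgue \<in> sets lebesgue" if "open U" for U :: "'a set" using that by simp
  have i: "integrable lebesgue (\<lambda>x. indicator \<Omega> x *\<^sub>R h x)"
    using h integrable_restrict_space[OF L[OF \<Omega>], of h] by simp
  have e: "indicator (W n) x *\<^sub>R (indicator \<Omega> x *\<^sub>R h x) = indicator (W n) x *\<^sub>R h x" for n x
    using W(2)[of n] by (auto simp: indicator_def)
  have iW: "integrable lebesgue (\<lambda>x. indicator (W n) x *\<^sub>R h x)" for n
    using integrable_mult_indicator[OF _ i, of "W n"] W(1)[of n] unfolding e by auto
  then show "integrable (lebesgue_on (W n)) h"
    using integrable_restrict_space[OF L[OF W(1)], where f = h] by simp
  have "(\<lambda>n. LINT x|lebesgue. indicator (W n) x *\<^sub>R h x) \<longlonglongrightarrow> (LINT x|lebesgue. indicator \<Omega> x *\<^sub>R h x)"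
  proof (rule integral_dominated_convergence[where w = "\<lambda>x. \<bar>indicator \<Omega> x *\<^sub>R h x\<bar>"])
    show "AE x in lebesgue. (\<lambda>n. indicator (W n) x *\<^sub>R h x) \<longlonglongrightarrow> indicator \<Omega> x *\<^sub>R h x"
    proof (rule AE_I2)
      fix x
      show "(\<lambda>n. indicator (W n) x *\<^sub>R h x) \<longlonglongrightarrow> indicator \<Omega> x *\<^sub>R h x"
      proof (cases "x \<in> \<Omega>")
        case True
        have "\<forall>\<^sub>F n in sequentially. indicator (W n) x *\<^sub>R h x = indicator \<Omega> x *\<^sub>R h x"
          using ev[OF True] by eventually_elim (simp add: True)
        then show ?thesis by (rule tendsto_eventually)
      next
        case False
        then have "x \<notin> W n" for n using W(2)[of n] by blast
        then show ?thesis using False by simp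
      qed
    qed
    show "AE x in lebesgue. norm (indicator (W n) x *\<^sub>R h x) \<le> \<bar>indicator \<Omega> x *\<^sub>R h x\<bar>" for n
      using W(2)[of n] by (intro AE_I2) (auto simp: indicator_def)
  qed (use i iW in \<open>auto dest: borel_measurable_integrable\<close>)
  then show "(\<lambda>n. LINT x|lebesgue_on (W n). h x) \<longlonglongrightarrow> (LINT x|lebesgue_on \<Omega>. h x)"
    by (simp add: integral_restrict_space[OF L[OF W(1)]] integral_restrict_space[OF L[OF \<Omega>]])
qed

lemma wedge_inequality:
  fixes f :: "real^3 \<Rightarrow> real" and g :: "real^3 \<Rightarrow> real^3"
  assumes a: "0 < a0" "2 * a0 < b0" and \<beta>: "0 < \<beta>0" "\<beta>0 \<le> pi / 6"
    and f: "L2 (wedge a0 b0 \<beta>0) f" "has_weak_gradient (wedge a0 b0 \<beta>0) f g"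
    and g2: "\<And>b. b \<in> Basis \<Longrightarrow> L2 (wedge a0 b0 \<beta>0) (\<lambda>x. g x \<bullet> b)"
    and axi: "axisymmetric_on (wedge a0 b0 \<beta>0) f"
    and zero: "(LINT x|lebesgue_on (wedge a0 b0 \<beta>0). rho x ^ (1 + j) * sin (phi x) * f x) = 0"
  shows "(LINT x|lebesgue_on (wedge a0 b0 \<beta>0). (f x)\<^sup>2 / (rho x)\<^sup>2) \<le> dirichlet (wedge a0 b0 \<beta>0) g"
proof -
  define \<Omega> where "\<Omega> = wedge a0 b0 \<beta>0"
  define \<omega> where "\<omega> x = rho x ^ (1 + j) * sin (phi x)" for x
  let ?M = "lebesgue_on \<Omega>"
  \<comment> \<open>Radii are moved by \<open>d * c n < d\<close>, and
    \<open>3 * d \<le> b0 - 2 * a0\<close> preserves the ratio \<open>2 * as n \<le> bs n\<close>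
    for Hardy's inequality. The shift in \<open>c\<close> gives \<open>c n < 1\<close> already for
    \<open>n = 0\<close>, so every half-opening \<open>\<beta>s n\<close> is positive.\<close>
  define d where "d = (b0 - 2 * a0) / 4"
  define c where "c n = inverse (real (Suc (Suc n)))" for n
  have c: "0 < c n" "c n < 1" for n by (auto simp: c_def inverse_eq_divide)
  have clim: "c \<longlonglongrightarrow> 0"
    unfolding c_def using LIMSEQ_inverse_real_of_nat by (rule LIMSEQ_Suc)
  have d: "0 < d" "3 * d \<le> b0 - 2 * a0" using a by (auto simp: d_def)
  define as bs \<beta>s where "as n = a0 + d * c n" and "bs n = b0 - d * c n" and "\<beta>s n = \<beta>0 - \<beta>0 * c n" for n
  define W where "W n = wedge (as n) (bs n) (\<beta>s n)" for n
  have as: "a0 < as n" for n using d c by (simp add: as_def)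
  have bs: "bs n < b0" for n using d c by (simp add: bs_def)
  have \<beta>s: "0 < \<beta>s n" "\<beta>s n < \<beta>0" for n
    using mult_strict_left_mono[OF c(2)[of n] \<beta>(1)] mult_pos_pos[OF \<beta>(1) c(1)[of n]] by (auto simp: \<beta>s_def)
  have abs: "2 * as n \<le> bs n" for n
  proof -
    have "d * c n \<le> d" using d c[of n] by (intro mult_left_le) auto
    then have "2 * (d * c n) + d * c n \<le> b0 - 2 * a0" using d by linarith
    then show ?thesis by (simp add: as_def bs_def)
  qed
  have \<Omega>: "open \<Omega>" unfolding \<Omega>_def using a by (intro open_wedge) auto
  have Wo: "open (W n)" for n unfolding W_def using a as[of n] by (intro open_wedge) auto
  have W\<Omega>: "W n \<subseteq> \<Omega>" for n
    using as[of n] bs[of n] \<beta>s(2)[of n] by (auto simp: W_def \<Omega>_def wedge_def)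
  have ev: "\<forall>\<^sub>F n in sequentially. x \<in> W n" if x: "x \<in> \<Omega>" for x
  proof -
    have l: "as \<longlonglongrightarrow> a0 + d * 0" "bs \<longlonglongrightarrow> b0 - d * 0" "\<beta>s \<longlonglongrightarrow> \<beta>0 - \<beta>0 * 0"
      unfolding as_def bs_def \<beta>s_def by (intro tendsto_intros clim)+
    have "\<bar>phi x - pi / 2\<bar> < \<beta>0" "a0 < rho x" "rho x < b0" using x by (auto simp: \<Omega>_def wedge_def)
    then have "\<forall>\<^sub>F n in sequentially. as n < rho x" "\<forall>\<^sub>F n in sequentially. rho x < bs n" "\<forall>\<^sub>F n in sequentially. \<bar>phi x - pi / 2\<bar> < \<beta>s n"
      using order_tendstoD(2)[OF l(1), of "rho x"] order_tendstoD(1)[OF l(2), of "rho x"] order_tendstoD(1)[OF l(3), of "\<bar>phi x - pi / 2\<bar>"]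
      by simp_all
    then show ?thesis
      by eventually_elim (auto simp: W_def wedge_def)
  qed
  have exh: "integrable ?M h \<Longrightarrow> integrable (lebesgue_on (W n)) h"
    "integrable ?M h \<Longrightarrow> (\<lambda>n. LINT x|lebesgue_on (W n). h x) \<longlonglongrightarrow> (LINT x|?M. h x)"
    for h :: "real^3 \<Rightarrow> real" and n
    using integral_exhaustion[OF \<Omega> Wo W\<Omega> ev] by blast+
  have a': "0 \<le> a0" and \<beta>': "\<beta>0 \<le> pi / 2" using a \<beta> by auto
  have f2: "L2_on ?M f" using f(1) by (simp add: \<Omega>_def L2_iff_L2_on)
  have gb: "L2_on ?M (\<lambda>x. g x \<bullet> b)" if "b \<in> Basis" for b using g2[OF that] by (simp add: \<Omega>_def L2_iff_L2_on)
  note one = L2_on_wedge_one[OF a', where b = b0 and \<beta> = \<beta>0, folded \<Omega>_def]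
  have \<omega>2: "L2_on ?M \<omega>"
    unfolding \<omega>_def[abs_def] \<Omega>_def by (rule L2_on_wedge_weight[OF a' \<beta>'])
  note inv = inverse_rho_wedge[OF a(1), where b = b0 and \<beta> = \<beta>0, folded \<Omega>_def]
  note f\<rho> = L2_on_mult_bounded(1)[OF f2 inv] and one\<rho> = L2_on_mult_bounded(1)[OF one inv]
  have i1: "integrable ?M (\<lambda>x. (f x)\<^sup>2 / (rho x)\<^sup>2)"
    using L2_onD(2)[OF f\<rho>] by (simp add: power_mult_distrib power_inverse divide_inverse mult.commute)
  have i2: "integrable ?M (\<lambda>x. f x / (rho x)\<^sup>2)"
    using integral_Cauchy_Schwarz(1)[OF L2_onD[OF f\<rho>] L2_onD[OF one\<rho>]]
    by (simp add: power2_eq_square divide_inverse mult_ac)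
  have i3: "integrable ?M (\<lambda>x. 1 / (rho x)\<^sup>2)"
    using L2_onD(2)[OF one\<rho>] by (simp add: power_inverse divide_inverse)
  have i4: "integrable ?M (\<lambda>x. \<omega> x * f x)" by (rule integral_Cauchy_Schwarz(1)[OF L2_onD[OF \<omega>2] L2_onD[OF f2]])
  have i5: "integrable ?M \<omega>" using integral_Cauchy_Schwarz(1)[OF L2_onD[OF \<omega>2] L2_onD[OF one]] by simp
  \<comment> \<open>Constant sequences in \<open>L2_lim_coord\<close> yield square integrability of
    \<open>g\<close> along the coordinate fields.\<close>
  have "L2_lim ?M (\<lambda>n x. g x \<bullet> b) (\<lambda>x. g x \<bullet> b)" if "b \<in> Basis" for b
    using gb[OF that] by (simp add: L2_lim_def)
  note G = L2_lim_coord[OF a(1) \<beta>' this[unfolded \<Omega>_def], folded \<Omega>_def, THEN L2_limD(2), THEN L2_onD(2)]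
  have i6: "integrable ?M (\<lambda>x. (g x \<bullet> coord_rho x)\<^sup>2)" by (rule G(1))
  have i7: "integrable ?M (\<lambda>x. 1 / (rho x)\<^sup>2 * (g x \<bullet> coord_phi x)\<^sup>2)"
    using G(2) by (simp add: power_mult_distrib power_inverse divide_inverse)
  define \<kappa> where "\<kappa> n = (LINT x|lebesgue_on (W n). \<omega> x * f x) / (LINT x|lebesgue_on (W n). \<omega> x)" for n
  have Z\<Omega>: "0 < (LINT x|?M. \<omega> x)"
    unfolding \<omega>_def \<Omega>_def using a \<beta> by (intro wedge_weight_integral_pos) auto
  have Zn: "0 < (LINT x|lebesgue_on (W n). \<omega> x)" for n
    unfolding \<omega>_def W_def using a \<beta> as[of n] abs[of n] \<beta>s[of n] by (intro wedge_weight_integral_pos) auto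
  have "\<kappa> \<longlonglongrightarrow> (LINT x|?M. \<omega> x * f x) / (LINT x|?M. \<omega> x)"
    unfolding \<kappa>_def using Z\<Omega> by (intro tendsto_divide exh(2) i4 i5) auto
  \<comment> \<open>The limit of the constants is a quotient whose numerator is the integral assumed
    to be 0.\<close>
  then have \<kappa>lim: "\<kappa> \<longlonglongrightarrow> 0" using zero by (simp add: \<omega>_def \<Omega>_def)
  have ineq: "(LINT x|lebesgue_on (W n). (f x - \<kappa> n)\<^sup>2 / (rho x)\<^sup>2) \<le> dirichlet (W n) g" for n
    unfolding W_def
    by (rule wedge_inequality_weak[OF a' as abs bs \<beta>s \<beta>(2) f g2 axi])
      (use Zn[of n] in \<open>simp_all add: \<kappa>_def \<omega>_def W_def\<close>)
  have expand: "(LINT x|lebesgue_on (W n). (f x - \<kappa> n)\<^sup>2 / (rho x)\<^sup>2) =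
     (LINT x|lebesgue_on (W n). (f x)\<^sup>2 / (rho x)\<^sup>2) - 2 * \<kappa> n * (LINT x|lebesgue_on (W n). f x / (rho x)\<^sup>2)
      + (\<kappa> n)\<^sup>2 * (LINT x|lebesgue_on (W n). 1 / (rho x)\<^sup>2)" for n
  proof -
    have "(f x - \<kappa> n)\<^sup>2 / (rho x)\<^sup>2 = (f x)\<^sup>2 / (rho x)\<^sup>2 - 2 * \<kappa> n * (f x / (rho x)\<^sup>2) + (\<kappa> n)\<^sup>2 * (1 / (rho x)\<^sup>2)" for x
      by (simp add: power2_diff add_divide_distrib diff_divide_distrib)
    then have "(LINT x|lebesgue_on (W n). (f x - \<kappa> n)\<^sup>2 / (rho x)\<^sup>2) =
      (LINT x|lebesgue_on (W n). (f x)\<^sup>2 / (rho x)\<^sup>2 - 2 * \<kappa> n * (f x / (rho x)\<^sup>2) + (\<kappa> n)\<^sup>2 * (1 / (rho x)\<^sup>2))"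
      by (simp only:)
    also have "\<dots> = (LINT x|lebesgue_on (W n). (f x)\<^sup>2 / (rho x)\<^sup>2) - 2 * \<kappa> n * (LINT x|lebesgue_on (W n). f x / (rho x)\<^sup>2)
      + (\<kappa> n)\<^sup>2 * (LINT x|lebesgue_on (W n). 1 / (rho x)\<^sup>2)"
      by (simp only: Bochner_Integration.integral_add Bochner_Integration.integral_diff Bochner_Integration.integral_mult_right_zero
        Bochner_Integration.integrable_diff integrable_mult_right exh(1)[OF i1] exh(1)[OF i2] exh(1)[OF i3])
    finally show ?thesis .
  qed
  have "(LINT x|?M. (f x)\<^sup>2 / (rho x)\<^sup>2) \<le> dirichlet \<Omega> g"
  proof (rule LIMSEQ_le)
    have "(\<lambda>n. LINT x|lebesgue_on (W n). (f x - \<kappa> n)\<^sup>2 / (rho x)\<^sup>2) \<longlonglongrightarrow>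
      (LINT x|?M. (f x)\<^sup>2 / (rho x)\<^sup>2) - 2 * 0 * (LINT x|?M. f x / (rho x)\<^sup>2) + 0\<^sup>2 * (LINT x|?M. 1 / (rho x)\<^sup>2)"
      unfolding expand by (intro tendsto_intros exh(2) i1 i2 i3 \<kappa>lim)
    then show "(\<lambda>n. LINT x|lebesgue_on (W n). (f x - \<kappa> n)\<^sup>2 / (rho x)\<^sup>2) \<longlonglongrightarrow> (LINT x|?M. (f x)\<^sup>2 / (rho x)\<^sup>2)"
      by simp
    show "(\<lambda>n. dirichlet (W n) g) \<longlonglongrightarrow> dirichlet \<Omega> g"
      unfolding dirichlet_def by (intro tendsto_add tendsto_mult tendsto_const exh(2) i6 i7)
  qed (use ineq in blast)
  then show ?thesis by (simp add: \<Omega>_def)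
qed

section \<open>The given domain\<close>

lemma D_eq_wedge: "D m \<alpha> = wedge (1 / real m) 1 \<alpha>"
  by (simp add: D_def wedge_def)

text \<open>\<open>d_rho\<close> and \<open>d_phi\<close> refer to an arbitrarily selected gradient,
  which inherits square integrability from the one in \<open>H1\<close> by uniqueness. The exponent
  \<open>j\<close> lets one statement cover both functions: 0 for \<open>v\<close> and 1 for
  \<open>v / rho\<close>.\<close>

lemma D_inequality:
  assumes m: "10 ^ 3 \<le> m" and \<alpha>: "0 < \<alpha>" "\<alpha> \<le> pi / 6"
    and f: "H1 (D m \<alpha>) f" "axisymmetric_on (D m \<alpha>) f"
    and zero: "(LINT x|lebesgue_on (D m \<alpha>). rho x ^ (1 + j) * sin (phi x) * f x) = 0"
  shows "(LINT x|lebesgue_on (D m \<alpha>). (f x)\<^sup>2 / (rho x)\<^sup>2)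
      \<le> 8 / sqrt 3 * (LINT x|lebesgue_on (D m \<alpha>). \<bar>d_rho (D m \<alpha>) f x\<bar>\<^sup>2)
        + 1 / (5 * sqrt 3) *
          (LINT x|lebesgue_on (D m \<alpha>). 1 / (rho x)\<^sup>2 * \<bar>d_phi (D m \<alpha>) f x\<bar>\<^sup>2)"
proof -
  let ?D = "D m \<alpha>"
  have o: "open ?D" unfolding D_eq_wedge by (rule open_wedge) simp
  obtain g where g: "has_weak_gradient ?D f g" "\<And>b. b \<in> Basis \<Longrightarrow> L2 ?D (\<lambda>x. g x \<bullet> b)"
    using f(1) by (auto simp: H1_def)
  have G: "has_weak_gradient ?D f (weak_gradient ?D f)"
    unfolding weak_gradient_def by (rule someI[where P = "has_weak_gradient ?D f", OF g(1)])
  have ae: "AE x in lebesgue_on ?D. g x = weak_gradient ?D f x"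
    by (rule weak_gradient_unique[OF o g(1) G])
  have G2: "L2 ?D (\<lambda>x. weak_gradient ?D f x \<bullet> b)" if "b \<in> Basis" for b
    by (rule L2_cong_AE[OF o g(2)[OF that]]) (use ae in \<open>auto elim: eventually_mono\<close>)
  have "1000 \<le> real m" using m of_nat_mono[OF m, where 'a = real] by simp
  then have m': "0 < 1 / real m" "2 * (1 / real m) < 1" by (auto simp: field_simps)
  have f2: "L2 ?D f" using f(1) by (simp add: H1_def)
  show ?thesis
    using wedge_inequality[OF m' \<alpha> f2[unfolded D_eq_wedge] G[unfolded D_eq_wedge] G2[unfolded D_eq_wedge]
      f(2)[unfolded D_eq_wedge] zero[unfolded D_eq_wedge]]
    by (simp add: dirichlet_def d_rho_def d_phi_def D_eq_wedge)
qed

theorem corollary5p1: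
  fixes m :: nat and \<alpha> :: real and v\<^sub>\<theta> :: "real^3 \<Rightarrow> real"
  assumes "m \<ge> 10 ^ 3"
    and "0 < \<alpha>" and "\<alpha> \<le> pi / 6"
    and "H1 (D m \<alpha>) v\<^sub>\<theta>"
    and "axisymmetric_on (D m \<alpha>) v\<^sub>\<theta>"
    and "(LINT x|lebesgue_on (D m \<alpha>). rho x * sin (phi x) * v\<^sub>\<theta> x) = 0"
  shows "\<forall>f \<in> {v\<^sub>\<theta>, (\<lambda>x. v\<^sub>\<theta> x / rho x)}.
    (LINT x|lebesgue_on (D m \<alpha>). (f x)\<^sup>2 / (rho x)\<^sup>2)
      \<le> 8 / sqrt 3 * (LINT x|lebesgue_on (D m \<alpha>). \<bar>d_rho (D m \<alpha>) f x\<bar>\<^sup>2)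
        + 1 / (5 * sqrt 3) *
          (LINT x|lebesgue_on (D m \<alpha>). 1 / (rho x)\<^sup>2 * \<bar>d_phi (D m \<alpha>) f x\<bar>\<^sup>2)"
proof -
  let ?D = "D m \<alpha>" and ?w = "\<lambda>x. v\<^sub>\<theta> x / rho x"
  have "1000 \<le> real m" using assms(1) of_nat_mono[OF assms(1), where 'a = real] by simp
  then have m: "0 < 1 / real m" by simp
  have o: "open ?D" unfolding D_eq_wedge by (rule open_wedge) simp
  have \<rho>: "1 / real m \<le> norm x" if "x \<in> ?D" for x using that by (simp add: D_def rho_def)
  have "H1 ?D ?w"
    using H1_divide_norm[OF o m \<rho> assms(4)] by (simp add: rho_def)
  moreover have "axisymmetric_on ?D ?w"
  proof -
    obtain h where "AE x in lebesgue_on ?D. v\<^sub>\<theta> x = h (rho x) (phi x)"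
      using assms(5) by (auto simp: axisymmetric_on_def)
    then have "AE x in lebesgue_on ?D. ?w x = h (rho x) (phi x) / rho x"
      by eventually_elim simp
    then show ?thesis
      unfolding axisymmetric_on_def by (rule exI[where x = "\<lambda>r p. h r p / r"])
  qed
  \<comment> \<open>Since the given function is \<open>rho x * ?w x\<close> on the domain, its
    integral condition is one for \<open>?w\<close> with an additional power of \<open>rho\<close>,
    the case \<open>j = 1\<close>.\<close>
  moreover have "(LINT x|lebesgue_on ?D. rho x ^ (1 + 1) * sin (phi x) * ?w x) = (LINT x|lebesgue_on ?D. rho x * sin (phi x) * v\<^sub>\<theta> x)"
  proof (rule Bochner_Integration.integral_cong)
    fix x assume "x \<in> space (lebesgue_on ?D)"
    then have "rho x \<noteq> 0" using \<rho>[of x] m by (auto simp: rho_def)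
    then show "rho x ^ (1 + 1) * sin (phi x) * ?w x = rho x * sin (phi x) * v\<^sub>\<theta> x" by simp
  qed simp
  ultimately show ?thesis
    using D_inequality[OF assms(1-5), of 0] D_inequality[OF assms(1-3), of ?w 1] assms(6)
    by auto
qed

end
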